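(* Let $p\in\mathbb{N}\cup\{\infty\}$ (with $p\ge 1$) and let $X$ be an infinite-dimensional separable real Banach space with a (complete, equivalent) norm $\|\cdot\|$ that is both LUR and $C^p$ smooth. Then for every continuous mapping $f:X\to\mathbb{R}$ and every continuous function $\varepsilon:X\to(0,\infty)$ there exists a $C^p$ smooth mapping $g:X\to\mathbb{R}$ such that $|f(x)-g(x)|\le\varepsilon(x)$ for all $x\in X$ and $g$ has no critical points, i.e. $g'(x)\neq 0$ for all $x\in X$.
   Context: Smoothness is in the Fréchet sense. A norm $\|\cdot\|$ on $X$ is LUR (locally uniformly rotund) if $\lim_n\|x_n-x\|=0$ whenever the sequence $(x_n)_n$ and the point $x$ lie in the unit sphere of $\|\cdot\|$ and $\lim_n\|x_n+x\|=2$. A norm on $X$ is $C^p$ smooth if it is $C^p$ smooth on $X\setminus\{0\}$. A critical point of a differentiable function $g:X\to\mathbb{R}$ is a point $x$ at which $g'(x)=0$ in $X^*$. *)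

theory Defs
  imports "HOL-Analysis.Analysis" "HOL-Library.Extended_Nat"
begin

definition equivalent_norm :: "('a::real_normed_vector \<Rightarrow> real) \<Rightarrow> bool" where
  "equivalent_norm N \<longleftrightarrow>
     (\<forall>x. N x = 0 \<longleftrightarrow> x = 0) \<and>
     (\<forall>x y. N (x + y) \<le> N x + N y) \<and>
     (\<forall>a x. N (a *\<^sub>R x) = \<bar>a\<bar> * N x) \<and>
     (\<exists>c C. 0 < c \<and> 0 < C \<and> (\<forall>x. c * norm x \<le> N x \<and> N x \<le> C * norm x))"

definition LUR :: "('a::real_vector \<Rightarrow> real) \<Rightarrow> bool" where
  "LUR N \<longleftrightarrow>
     (\<forall>x xs. N x = 1 \<and> (\<forall>n::nat. N (xs n) = 1) \<and> (\<lambda>n. N (xs n + x)) \<longlonglongrightarrow> 2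
        \<longrightarrow> (\<lambda>n. N (xs n - x)) \<longlonglongrightarrow> 0)"

text \<open>
  The iterated spaces \<open>L(X, L(X, \<dots>, L(X, Y)))\<close> in which the higher Fr\'echet derivatives live
  form a family of types depending on the order. As usual, the \<open>k\<close>-fold one is identified with
  the space of bounded \<open>k\<close>-linear maps with its operator norm; a \<open>k\<close>-linear map is represented
  by a function on lists, of which only the values at lists of length \<open>k\<close> matter.
\<close>

definition bounded_multilinear ::
    "nat \<Rightarrow> ('a::real_normed_vector list \<Rightarrow> 'b::real_normed_vector) \<Rightarrow> bool" where
  "bounded_multilinear k A \<longleftrightarrow>
     (\<forall>us ws. length us + length ws + 1 = k \<longrightarrow> linear (\<lambda>v. A (us @ v # ws))) \<and>
     (\<exists>K. \<forall>vs. length vs = k \<longrightarrow> norm (A vs) \<le> K * prod_list (map norm vs))"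

definition multi_onorm ::
    "nat \<Rightarrow> ('a::real_normed_vector list \<Rightarrow> 'b::real_normed_vector) \<Rightarrow> real" where
  "multi_onorm k A = (SUP vs\<in>{vs. length vs = k \<and> (\<forall>v\<in>set vs. norm v \<le> 1)}. norm (A vs))"

text \<open>
  \<open>D k x\<close> is the \<open>k\<close>-th Fr\'echet derivative of \<open>f\<close> at \<open>x\<close>. Differentiability of
  \<open>D k\<close> and continuity of \<open>D k\<close> are with respect to the operator norm on \<open>k\<close>-linear maps
  (not merely pointwise in the arguments), and the new direction of differentiation is prepended.
  For \<open>p = \<infinity>\<close> this is smoothness of all finite orders.
\<close>

definition C_smooth_on ::
    "enat \<Rightarrow> ('a::real_normed_vector \<Rightarrow> 'b::real_normed_vector) \<Rightarrow> 'a set \<Rightarrow> bool" where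
  "C_smooth_on p f U \<longleftrightarrow> open U \<and>
     (\<exists>D :: nat \<Rightarrow> 'a \<Rightarrow> 'a list \<Rightarrow> 'b.
        (\<forall>x\<in>U. D 0 x [] = f x) \<and>
        (\<forall>k. enat k \<le> p \<longrightarrow> (\<forall>x\<in>U.
           bounded_multilinear k (D k x) \<and>
           ((\<lambda>y. multi_onorm k (\<lambda>vs. D k y vs - D k x vs)) \<longlongrightarrow> 0) (at x))) \<and>
        (\<forall>k. enat k < p \<longrightarrow> (\<forall>x\<in>U.
           ((\<lambda>h. multi_onorm k (\<lambda>vs. D k (x + h) vs - D k x vs - D (Suc k) x (h # vs)) / norm h)
              \<longlongrightarrow> 0) (at 0))))"

definition critical_point :: "('a::real_normed_vector \<Rightarrow> real) \<Rightarrow> 'a \<Rightarrow> bool" where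
  "critical_point g x \<longleftrightarrow> g differentiable (at x) \<and> frechet_derivative g (at x) = (\<lambda>h. 0)"

lemma multi_onorm_0 [simp]: "multi_onorm 0 A = norm (A [])"
proof -
  have "{vs::'a list. length vs = 0 \<and> (\<forall>v\<in>set vs. norm v \<le> 1)} = {[]}" by auto
  then show ?thesis unfolding multi_onorm_def by simp
qed

lemma bounded_multilinear_0 [simp]: "bounded_multilinear 0 A"
  unfolding bounded_multilinear_def by (auto intro!: exI[of _ "norm (A [])"])

lemma bounded_multilinear_1: "bounded_multilinear 1 A \<longleftrightarrow> bounded_linear (\<lambda>h. A [h])"
proof -
  have *: "(\<forall>vs::'a list. length vs = 1 \<longrightarrow> P vs) \<longleftrightarrow> (\<forall>h. P [h])" for P
    by (auto simp: length_Suc_conv)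
  show ?thesis
    unfolding bounded_multilinear_def *
    by (auto simp: bounded_linear_def bounded_linear_axioms_def mult.commute)
qed

lemma C_smooth_on_0:
  fixes f :: "'a::real_normed_vector \<Rightarrow> 'b::real_normed_vector"
  shows "C_smooth_on 0 f U \<longleftrightarrow> open U \<and> continuous_on U f"
proof -
  have *: "((\<lambda>y. norm (D y - D x)) \<longlongrightarrow> 0) (at x) \<longleftrightarrow> (D \<longlongrightarrow> D x) (at x)"
    for D :: "'a \<Rightarrow> 'b" and x
    by (simp add: tendsto_norm_zero_iff LIM_zero_iff)
  show ?thesis (is "?L \<longleftrightarrow> ?R")
  proof
    assume ?L
    then obtain D :: "nat \<Rightarrow> 'a \<Rightarrow> 'a list \<Rightarrow> 'b" where D': "\<forall>x\<in>U. D (0::nat) x [] = f x" "open U"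
      "\<forall>x\<in>U. ((\<lambda>y. norm (D 0 y [] - D 0 x [])) \<longlongrightarrow> 0) (at x)"
      unfolding C_smooth_on_def by (force simp: zero_enat_def)
    then have D: "\<forall>x\<in>U. D (0::nat) x [] = f x" "open U"
      "\<forall>x\<in>U. ((\<lambda>y. D 0 y []) \<longlongrightarrow> D 0 x []) (at x)"
      unfolding *[of "\<lambda>y. D 0 y []"] by blast+
    have "continuous_on U (\<lambda>y. D 0 y [])" using D(2,3)
      by (simp add: continuous_on_eq_continuous_at isCont_def)
    then have "continuous_on U f" using D(1) by (simp cong: continuous_on_cong)
    with D(2) show ?R by simp
  next
    assume ?R
    then show ?L unfolding C_smooth_on_def
      by (auto intro!: exI[of _ "\<lambda>k x vs. f x"] simp: zero_enat_def * continuous_on_eq_continuous_at isCont_def)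
  qed
qed

lemma multi_onorm_least:
  assumes "\<And>vs. length vs = k \<Longrightarrow> (\<forall>v\<in>set vs. norm v \<le> 1) \<Longrightarrow> norm (A vs) \<le> B"
  shows "multi_onorm k A \<le> B"
proof -
  have "replicate k 0 \<in> {vs::'a list. length vs = k \<and> (\<forall>v\<in>set vs. norm v \<le> 1)}"
    by (auto simp: in_set_replicate)
  then show ?thesis unfolding multi_onorm_def using assms by (intro cSUP_least) blast+
qed

lemma multi_onorm_upper:
  assumes "bounded_multilinear k A" "length vs = k" "\<forall>v\<in>set vs. norm v \<le> 1"
  shows "norm (A vs) \<le> multi_onorm k A"
proof -
  obtain K where K: "\<And>vs. length vs = k \<Longrightarrow> norm (A vs) \<le> K * prod_list (map norm vs)"
    using assms(1) unfolding bounded_multilinear_def by blast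
  have p: "0 \<le> prod_list (map norm vs) \<and> prod_list (map norm vs) \<le> 1"
    if "\<forall>v\<in>set vs. norm v \<le> 1" for vs :: "'a list"
    using that by (induction vs) (auto simp: mult_le_one)
  have "norm (A vs) \<le> \<bar>K\<bar>" if "length vs = k" "\<forall>v\<in>set vs. norm v \<le> 1" for vs
  proof -
    have "norm (A vs) \<le> K * prod_list (map norm vs)" using K that by blast
    also have "\<dots> \<le> \<bar>K\<bar> * prod_list (map norm vs)" using p[OF that(2)] by (intro mult_right_mono) auto
    also have "\<dots> \<le> \<bar>K\<bar>" using p[OF that(2)] by (simp add: mult_left_le)
    finally show ?thesis .
  qed
  then show ?thesis unfolding multi_onorm_def
    by (intro cSUP_upper) (auto intro!: bdd_aboveI[of _ "\<bar>K\<bar>"] simp: assms)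
qed

lemma bounded_multilinear_diff:
  assumes "bounded_multilinear k A" "bounded_multilinear k B"
  shows "bounded_multilinear k (\<lambda>vs. A vs - B vs)"
proof -
  obtain K where K: "\<And>vs. length vs = k \<Longrightarrow> norm (A vs) \<le> K * prod_list (map norm vs)"
    using assms(1) unfolding bounded_multilinear_def by blast
  obtain L where L: "\<And>vs. length vs = k \<Longrightarrow> norm (B vs) \<le> L * prod_list (map norm vs)"
    using assms(2) unfolding bounded_multilinear_def by blast
  have "norm (A vs - B vs) \<le> (K + L) * prod_list (map norm vs)" if "length vs = k" for vs
    using K[OF that] L[OF that] norm_triangle_ineq4[of "A vs" "B vs"] by (simp add: distrib_right)
  then show ?thesis using assms unfolding bounded_multilinear_def
    by (auto intro!: linear_compose_sub)
qed

lemma bounded_multilinear_Cons: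
  assumes "bounded_multilinear (Suc k) A"
  shows "bounded_multilinear k (\<lambda>vs. A (h # vs))"
proof -
  obtain K where K: "\<And>vs. length vs = Suc k \<Longrightarrow> norm (A vs) \<le> K * prod_list (map norm vs)"
    using assms(1) unfolding bounded_multilinear_def by blast
  have "norm (A (h # vs)) \<le> (K * norm h) * prod_list (map norm vs)" if "length vs = k" for vs
    using K[of "h # vs"] that by (simp add: mult.assoc)
  moreover have "linear (\<lambda>v. A (h # us @ v # ws))" if "length us + length ws + 1 = k" for us ws
  proof -
    have "linear (\<lambda>v. A ((h # us) @ v # ws))"
      using assms that unfolding bounded_multilinear_def by (simp only: length_Cons add_Suc)
    then show ?thesis by simp
  qed
  ultimately show ?thesis unfolding bounded_multilinear_def by blast
qed

lemma bounded_multilinear_curry: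
  fixes A' :: "'a::real_normed_vector list \<Rightarrow> 'a \<Rightarrow>\<^sub>L 'b::real_normed_vector"
  assumes eq: "\<And>vs h. length vs = k \<Longrightarrow> blinfun_apply (A' vs) h = A (vs @ [h])"
  shows "bounded_multilinear k A' \<longleftrightarrow> bounded_multilinear (Suc k) A"
proof
  assume L: "bounded_multilinear k A'"
  obtain K where K: "\<And>vs. length vs = k \<Longrightarrow> norm (A' vs) \<le> K * prod_list (map norm vs)"
    using L unfolding bounded_multilinear_def by blast
  have "norm (A vs) \<le> K * prod_list (map norm vs)" if len: "length vs = Suc k" for vs
  proof -
    obtain us h where vs: "vs = us @ [h]" "length us = k"
      using len by (cases vs rule: rev_cases) auto
    have "norm (A vs) = norm (blinfun_apply (A' us) h)" using eq vs by simp
    also have "\<dots> \<le> norm (A' us) * norm h" by (rule norm_blinfun)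
    also have "\<dots> \<le> K * prod_list (map norm us) * norm h" using K vs by (intro mult_right_mono) auto
    finally show ?thesis by (simp add: vs mult.assoc)
  qed
  moreover have "linear (\<lambda>v. A (us @ v # ws))" if l: "length us + length ws + 1 = Suc k" for us ws
  proof (cases ws rule: rev_cases)
    case Nil
    then have "(\<lambda>v. A (us @ v # ws)) = blinfun_apply (A' us)" using eq l by auto
    then show ?thesis by (simp add: bounded_linear.linear blinfun.bounded_linear_right)
  next
    case (snoc ws' w)
    then have "linear (\<lambda>v. A' (us @ v # ws'))" using L l unfolding bounded_multilinear_def by auto
    moreover have "(\<lambda>v. A (us @ v # ws)) = (\<lambda>v. blinfun_apply (A' (us @ v # ws')) w)"
      using eq[of "us @ _ # ws'" w] l snoc by auto
    ultimately show ?thesis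
      by (auto simp: linear_iff blinfun.add_left blinfun.scaleR_left)
  qed
  ultimately show "bounded_multilinear (Suc k) A" unfolding bounded_multilinear_def by blast
next
  assume R: "bounded_multilinear (Suc k) A"
  obtain K where K: "\<And>vs. length vs = Suc k \<Longrightarrow> norm (A vs) \<le> K * prod_list (map norm vs)"
    using R unfolding bounded_multilinear_def by blast
  have pos: "0 \<le> prod_list (map norm vs)" for vs :: "'a list"
    by (induction vs) auto
  have "norm (A' vs) \<le> \<bar>K\<bar> * prod_list (map norm vs)" if "length vs = k" for vs
  proof (rule norm_blinfun_bound)
    show "norm (blinfun_apply (A' vs) h) \<le> \<bar>K\<bar> * prod_list (map norm vs) * norm h" for h
    proof -
      have "norm (blinfun_apply (A' vs) h) \<le> K * (prod_list (map norm vs) * norm h)"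
        using K[of "vs @ [h]"] that eq by simp
      also have "\<dots> \<le> \<bar>K\<bar> * (prod_list (map norm vs) * norm h)"
        using pos by (intro mult_right_mono) auto
      finally show ?thesis by (simp add: mult.assoc)
    qed
  qed (use pos in auto)
  moreover have "linear (\<lambda>v. A' (us @ v # ws))" if l: "length us + length ws + 1 = k" for us ws
  proof -
    have "linear (\<lambda>v. A (us @ v # (ws @ [w])))" for w
      using R l unfolding bounded_multilinear_def by simp
    then show ?thesis using eq[of "us @ _ # ws"] l
      by (auto simp: linear_iff intro!: blinfun_eqI simp: blinfun.add_left blinfun.scaleR_left)
  qed
  ultimately show "bounded_multilinear k A'" unfolding bounded_multilinear_def by blast
qed

lemma multi_onorm_curry:
  fixes A' :: "'a::real_normed_vector list \<Rightarrow> 'a \<Rightarrow>\<^sub>L 'b::real_normed_vector"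
  assumes eq: "\<And>vs h. length vs = k \<Longrightarrow> blinfun_apply (A' vs) h = A (vs @ [h])"
    and bm: "bounded_multilinear (Suc k) A"
  shows "multi_onorm k A' = multi_onorm (Suc k) A"
proof (rule antisym)
  have bm': "bounded_multilinear k A'" using bm bounded_multilinear_curry eq by blast
  show "multi_onorm k A' \<le> multi_onorm (Suc k) A"
  proof (rule multi_onorm_least)
    fix vs :: "'a list" assume vs: "length vs = k" "\<forall>v\<in>set vs. norm v \<le> 1"
    have 1: "norm (blinfun_apply (A' vs) h) \<le> multi_onorm (Suc k) A" if "norm h \<le> 1" for h
      using multi_onorm_upper[OF bm, of "vs @ [h]"] vs that eq by auto
    have "0 \<le> multi_onorm (Suc k) A" using 1[of 0] by simp
    moreover have "norm (blinfun_apply (A' vs) h) \<le> multi_onorm (Suc k) A * norm h" for h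
    proof (cases "h = 0")
      case False
      then show ?thesis using 1[of "h /\<^sub>R norm h"]
        by (simp add: blinfun.scaleR_right field_simps)
    qed (simp add: blinfun.zero_right)
    ultimately show "norm (A' vs) \<le> multi_onorm (Suc k) A" by (rule norm_blinfun_bound)
  qed
  show "multi_onorm (Suc k) A \<le> multi_onorm k A'"
  proof (rule multi_onorm_least)
    fix vs :: "'a list" assume vs: "length vs = Suc k" "\<forall>v\<in>set vs. norm v \<le> 1"
    obtain us h where us: "vs = us @ [h]" "length us = k"
      using vs(1) by (cases vs rule: rev_cases) auto
    have "norm (A vs) = norm (blinfun_apply (A' us) h)" using eq us by simp
    also have "\<dots> \<le> norm (A' us) * norm h" by (rule norm_blinfun)
    also have "\<dots> \<le> norm (A' us) * 1" using vs us by (intro mult_left_mono) auto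
    also have "\<dots> \<le> multi_onorm k A'" using multi_onorm_upper[OF bm' us(2)] vs us by auto
    finally show "norm (A vs) \<le> multi_onorm k A'" .
  qed
qed

lemma eventually_at_0_add:
  assumes "open U" "(x::'a::real_normed_vector) \<in> U"
  shows "eventually (\<lambda>h. x + h \<in> U) (at 0)"
proof -
  have "((\<lambda>h. x + h) \<longlongrightarrow> x + 0) (at 0)" by (intro tendsto_intros)
  then show ?thesis using assms by (auto dest: topological_tendstoD)
qed

text \<open>
  Together with \<open>C_smooth_on_0\<close> this recovers the usual recursion: \<open>f\<close> is \<open>C\<^sup>p\<^sup>+\<^sup>1\<close> on \<open>U\<close> iff it is
  Fr\'echet differentiable there and its derivative is \<open>C\<^sup>p\<close> as a map into the normed space of
  bounded linear maps.
\<close>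

theorem C_smooth_on_eSuc:
  fixes f :: "'a::real_normed_vector \<Rightarrow> 'b::real_normed_vector"
  shows "C_smooth_on (eSuc p) f U \<longleftrightarrow> open U \<and>
    (\<exists>f' :: 'a \<Rightarrow> 'a \<Rightarrow>\<^sub>L 'b.
      (\<forall>x\<in>U. (f has_derivative blinfun_apply (f' x)) (at x)) \<and> C_smooth_on p f' U)"
proof -
  have e: "enat (Suc k) \<le> eSuc p \<longleftrightarrow> enat k \<le> p" "enat (Suc k) < eSuc p \<longleftrightarrow> enat k < p" for k
    by (simp_all add: eSuc_enat[symmetric])
  have z: "enat 0 < eSuc p" by (simp add: zero_enat_def[symmetric])
  have cont: "((\<lambda>y. multi_onorm k (\<lambda>vs. D' y vs - D' x vs)) \<longlongrightarrow> 0) (at x) \<longleftrightarrow>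
     ((\<lambda>y. multi_onorm (Suc k) (\<lambda>vs. D y vs - D x vs)) \<longlongrightarrow> 0) (at x)"
    if "open U" "x \<in> U" "\<And>y. y \<in> U \<Longrightarrow> bounded_multilinear (Suc k) (D y)"
      "\<And>y vs h. y \<in> U \<Longrightarrow> length vs = k \<Longrightarrow> blinfun_apply (D' y vs) h = D y (vs @ [h])"
    for D and D' :: "'a \<Rightarrow> 'a list \<Rightarrow> 'a \<Rightarrow>\<^sub>L 'b" and x k
  proof (rule tendsto_cong)
    have "eventually (\<lambda>y. y \<in> U) (at x)" using that by (simp add: eventually_at_in_open')
    then show "\<forall>\<^sub>F y in at x. multi_onorm k (\<lambda>vs. D' y vs - D' x vs)
        = multi_onorm (Suc k) (\<lambda>vs. D y vs - D x vs)"
      by eventually_elim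
        (intro multi_onorm_curry bounded_multilinear_diff, auto simp: that blinfun.diff_left)
  qed
  have der: "((\<lambda>h. multi_onorm k (\<lambda>vs. D' (x + h) vs - D' x vs - E' x (h # vs)) / norm h) \<longlongrightarrow> 0) (at 0)
     \<longleftrightarrow> ((\<lambda>h. multi_onorm (Suc k) (\<lambda>vs. D (x + h) vs - D x vs - E x (h # vs)) / norm h) \<longlongrightarrow> 0) (at 0)"
    if "open U" "x \<in> U" "\<And>y. y \<in> U \<Longrightarrow> bounded_multilinear (Suc k) (D y)"
      "\<And>y. y \<in> U \<Longrightarrow> bounded_multilinear (Suc (Suc k)) (E y)"
      "\<And>y vs h. y \<in> U \<Longrightarrow> length vs = k \<Longrightarrow> blinfun_apply (D' y vs) h = D y (vs @ [h])"
      "\<And>y vs h. y \<in> U \<Longrightarrow> length vs = Suc k \<Longrightarrow> blinfun_apply (E' y vs) h = E y (vs @ [h])"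
    for D E and D' E' :: "'a \<Rightarrow> 'a list \<Rightarrow> 'a \<Rightarrow>\<^sub>L 'b" and x k
  proof (rule tendsto_cong)
    have "eventually (\<lambda>h. x + h \<in> U) (at 0)" using that by (simp add: eventually_at_0_add)
    then show "\<forall>\<^sub>F h in at 0. multi_onorm k (\<lambda>vs. D' (x + h) vs - D' x vs - E' x (h # vs)) / norm h
        = multi_onorm (Suc k) (\<lambda>vs. D (x + h) vs - D x vs - E x (h # vs)) / norm h"
    proof eventually_elim
      case (elim h)
      have "multi_onorm k (\<lambda>vs. D' (x + h) vs - D' x vs - E' x (h # vs))
        = multi_onorm (Suc k) (\<lambda>vs. D (x + h) vs - D x vs - E x (h # vs))"
        by (intro multi_onorm_curry bounded_multilinear_diff bounded_multilinear_Cons)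
          (auto simp: that elim blinfun.diff_left)
      then show ?case by simp
    qed
  qed
  show ?thesis (is "?L \<longleftrightarrow> ?R")
  proof
    assume ?L
    then obtain D where o: "open U" and D0: "\<forall>x\<in>U. D 0 x [] = f x"
      and bm: "\<And>k x. enat k \<le> eSuc p \<Longrightarrow> x \<in> U \<Longrightarrow> bounded_multilinear k (D k x)"
      and co: "\<And>k x. enat k \<le> eSuc p \<Longrightarrow> x \<in> U \<Longrightarrow>
        ((\<lambda>y. multi_onorm k (\<lambda>vs. D k y vs - D k x vs)) \<longlongrightarrow> 0) (at x)"
      and de: "\<And>k x. enat k < eSuc p \<Longrightarrow> x \<in> U \<Longrightarrow> ((\<lambda>h. multi_onorm k (\<lambda>vs. D k (x + h) vs - D k x vs - D (Suc k) x (h # vs)) / norm h) \<longlongrightarrow> 0) (at 0)"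
      unfolding C_smooth_on_def by blast
    define D' where "D' = (\<lambda>k x vs. Blinfun (\<lambda>h. D (Suc k) x (vs @ [h])))"
    have D': "blinfun_apply (D' k x vs) h = D (Suc k) x (vs @ [h])"
      if k: "enat k \<le> p" and x: "x \<in> U" and l: "length vs = k" for k x vs h
    proof -
      have b: "bounded_multilinear (Suc k) (D (Suc k) x)" using bm x k e by blast
      then obtain K where K: "\<And>vs. length vs = Suc k \<Longrightarrow> norm (D (Suc k) x vs) \<le> K * prod_list (map norm vs)"
        unfolding bounded_multilinear_def by blast
      have "linear (\<lambda>h. D (Suc k) x (vs @ [h]))" using b l unfolding bounded_multilinear_def by simp
      moreover have "norm (D (Suc k) x (vs @ [h])) \<le> norm h * (K * prod_list (map norm vs))" for h
        using K[of "vs @ [h]"] l by (simp add: ac_simps)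
      ultimately have "bounded_linear (\<lambda>h. D (Suc k) x (vs @ [h]))"
        by (auto simp: bounded_linear_def bounded_linear_axioms_def)
      then show ?thesis unfolding D'_def by (simp add: bounded_linear_Blinfun_apply)
    qed
    have p0: "enat 0 \<le> p" by (simp add: zero_enat_def[symmetric])
    have "(f has_derivative blinfun_apply (D' 0 x [])) (at x)" if x: "x \<in> U" for x
    proof -
      have "((\<lambda>y. D 0 y []) has_derivative blinfun_apply (D' 0 x [])) (at x)"
        using de[OF z x] D'[OF p0 x, of "[]"]
        by (simp add: has_derivative_at blinfun.bounded_linear_right)
      then show ?thesis
        by (rule has_derivative_transform_within_open[OF _ o x]) (use D0 in auto)
    qed
    moreover have "C_smooth_on p (\<lambda>x. D' 0 x []) U"
      unfolding C_smooth_on_def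
    proof (intro conjI exI[of _ D'] allI impI ballI o)
      fix k x assume k: "enat k \<le> p" and x: "x \<in> U"
      show "bounded_multilinear k (D' k x)"
        using bounded_multilinear_curry[of k "D' k x" "D (Suc k) x"] D'[OF k x] bm e k x by blast
      show "((\<lambda>y. multi_onorm k (\<lambda>vs. D' k y vs - D' k x vs)) \<longlongrightarrow> 0) (at x)"
        using cont[of x k "D (Suc k)" "D' k"] o x bm D'[OF k] co e k by blast
    next
      fix k x assume k: "enat k < p" and x: "x \<in> U"
      then have k': "enat k \<le> p" "enat (Suc k) \<le> p" by (auto simp: Suc_ile_eq)
      show "((\<lambda>h. multi_onorm k (\<lambda>vs. D' k (x + h) vs - D' k x vs - D' (Suc k) x (h # vs)) / norm h) \<longlongrightarrow> 0) (at 0)"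
        using der[of x k "D (Suc k)" "D (Suc (Suc k))" "D' k" "D' (Suc k)"]
          o x bm D'[OF k'(1)] D'[OF k'(2)] de e k k' by blast
    qed auto
    ultimately show ?R by (intro conjI o exI[of _ "\<lambda>x. D' 0 x []"]) simp_all
  next
    assume ?R
    then obtain f' :: "'a \<Rightarrow> 'a \<Rightarrow>\<^sub>L 'b" where o: "open U"
      and f': "\<forall>x\<in>U. (f has_derivative blinfun_apply (f' x)) (at x)" and s: "C_smooth_on p f' U"
      by (elim conjE exE)
    from s obtain D' where D0: "\<forall>x\<in>U. D' 0 x [] = f' x"
      and bm: "\<And>k x. enat k \<le> p \<Longrightarrow> x \<in> U \<Longrightarrow> bounded_multilinear k (D' k x)"
      and co: "\<And>k x. enat k \<le> p \<Longrightarrow> x \<in> U \<Longrightarrow>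
        ((\<lambda>y. multi_onorm k (\<lambda>vs. D' k y vs - D' k x vs)) \<longlongrightarrow> 0) (at x)"
      and de: "\<And>k x. enat k < p \<Longrightarrow> x \<in> U \<Longrightarrow> ((\<lambda>h. multi_onorm k (\<lambda>vs. D' k (x + h) vs - D' k x vs - D' (Suc k) x (h # vs)) / norm h) \<longlongrightarrow> 0) (at 0)"
      unfolding C_smooth_on_def by blast
    define D where "D = (\<lambda>k x vs. case k of 0 \<Rightarrow> f x | Suc j \<Rightarrow> blinfun_apply (D' j x (butlast vs)) (last vs))"
    have eq: "blinfun_apply (D' k x vs) h = D (Suc k) x (vs @ [h])" for k x vs h
      by (simp add: D_def)
    have D_0: "D 0 x vs = f x" for x vs by (simp add: D_def)
    have bmD: "bounded_multilinear (Suc k) (D (Suc k) x)" if "enat k \<le> p" "x \<in> U" for k x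
      using bounded_multilinear_curry[of k "D' k x" "D (Suc k) x"] eq bm that by blast
    show ?L
      unfolding C_smooth_on_def
    proof (intro conjI exI[of _ D] allI impI ballI o)
      fix k x assume k: "enat k \<le> eSuc p" and x: "x \<in> U"
      show "bounded_multilinear k (D k x)" using bmD e k x by (cases k) auto
      show "((\<lambda>y. multi_onorm k (\<lambda>vs. D k y vs - D k x vs)) \<longlongrightarrow> 0) (at x)"
      proof (cases k)
        case 0
        have "(f \<longlongrightarrow> f x) (at x)" using f' x has_derivative_continuous[of f _ x UNIV]
          by (auto simp: continuous_within)
        then show ?thesis by (simp add: 0 D_0 tendsto_norm_zero_iff LIM_zero_iff)
      next
        case (Suc j)
        then show ?thesis
          using cont[of x j "D (Suc j)" "D' j"] o x bmD eq co e k by blast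
      qed
    next
      fix k x assume k: "enat k < eSuc p" and x: "x \<in> U"
      show "((\<lambda>h. multi_onorm k (\<lambda>vs. D k (x + h) vs - D k x vs - D (Suc k) x (h # vs)) / norm h) \<longlongrightarrow> 0) (at 0)"
      proof (cases k)
        case 0
        have "(f has_derivative blinfun_apply (f' x)) (at x)" using f' x by blast
        then show ?thesis using D0 x by (simp add: 0 D_0 eq[of 0 x "[]", simplified, symmetric] has_derivative_at)
      next
        case (Suc j)
        then have j: "enat j < p" "enat j \<le> p" "enat (Suc j) \<le> p" using k e by (auto simp: Suc_ile_eq)
        show ?thesis unfolding Suc
          using der[of x j "D (Suc j)" "D (Suc (Suc j))" "D' j" "D' (Suc j)"]
            o x bmD eq de j by blast
      qed
    qed (simp add: D_0)
  qed
qed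

corollary C_smooth_on_imp_differentiable:
  assumes "C_smooth_on p f U" "1 \<le> p" "x \<in> U"
  shows "f differentiable (at x)"
proof -
  obtain q where "p = eSuc q"
  proof (cases p)
    case (enat n)
    then obtain m where "n = Suc m" using assms(2) by (cases n) (auto simp: zero_enat_def[symmetric])
    then show ?thesis using that[of "enat m"] enat by (simp add: eSuc_enat)
  qed (use that[of \<infinity>] in simp)
  then obtain f' where "\<forall>x\<in>U. (f has_derivative blinfun_apply (f' x)) (at x)"
    using assms(1) by (auto simp only: C_smooth_on_eSuc)
  then show ?thesis using assms(3) by (auto intro: differentiableI)
qed

end

theory Submission
  imports Defs
begin

text \<open>
  From the norm one builds a \<open>C\<^sup>p\<close>, Lipschitz, convex function \<open>\<theta>\<close> on the whole space that is locally
  uniformly rotund. The slices \<open>\<theta> y - \<theta> x - \<theta>'(x)(y - x) < s\<close> are then small sets, so countably many of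
  them carry a partition of unity \<open>(w\<^sub>i)\<close> on which \<open>F = \<Sum>\<^sub>i (a\<^sub>i + b\<^sub>i \<Phi>) w\<^sub>i\<close> is close to \<open>f\<close>, where the functional \<open>\<Phi>\<close>
  avoids the spans of finitely many differentials \<open>\<theta>'(x\<^sub>l)\<close>. At a critical point \<open>c\<close> of \<open>F\<close> lying in the
  \<open>i\<close>-th slice, \<open>\<theta>'(c)\<close> is a combination of \<open>\<theta>'(x\<^sub>0), \<dots>, \<theta>'(x\<^sub>i), \<Phi>\<close>; it therefore vanishes on a fixed
  subspace \<open>Z\<close> of finite codimension.

  Let \<open>K\<close> be the set of these points and \<open>P\<close> a projection with kernel \<open>Z\<close>. Rotundity makes the caps
  \<open>{x. P x \<approx> P c, \<theta> x < \<theta> c + \<eta>}\<close> small. Choose \<open>e\<^sub>k \<in> Z\<close>, \<open>e\<^sub>0 = 0\<close>, with \<open>\<theta>'(x) e\<^sub>k \<longlonglongrightarrow> 0\<close> for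
  every \<open>x\<close> and without convergent subsequence. Inside the caps there is a shear \<open>u\<^sub>k\<close> parallel to
  \<open>e\<^sub>k\<^sub>+\<^sub>1 - e\<^sub>k\<close> that maps \<open>c + A c e\<^sub>k\<^sub>+\<^sub>1\<close> to \<open>c + A c e\<^sub>k\<close> for all \<open>c \<in> K\<close>. The shears are locally finite, so
  \<open>U = u\<^sub>0 \<circ> u\<^sub>1 \<circ> \<dots>\<close> is smooth with surjective derivative, and a preimage of \<open>c\<close> would have to equal
  \<open>c + A c e\<^sub>k\<close> for all large \<open>k\<close>; hence \<open>U\<close> misses \<open>K\<close>. Composing such maps for all slices gives \<open>R\<close> that misses
  the critical set of \<open>F\<close>, and \<open>F \<circ> R\<close> has no critical points because \<open>R'(x)\<close> is onto.
\<close>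

section \<open>Smoothness through uniform families of directional derivatives\<close>

text \<open>A diffeomorphism onto the complement of \<open>K\<close> would be more than is required:
  for \<open>F \<circ> R\<close> to lose its critical points, \<open>R\<close> has to miss the
  critical set and each \<open>R'(x)\<close> has to be onto. As a shear moves points along one
  direction only, injectivity and surjectivity of its derivative both come from the slope bound 1/2
  of one real function.

  By convexity a point \<open>c\<close> of \<open>K\<close> minimises \<theta> on its fibre
  \<open>c + Z\<close>, by rotundity uniquely and stably. Thus \<open>K\<close> is a graph over part
  of the finite-dimensional range of \<open>P\<close>. The norm cannot replace \<theta>: it is not
  differentiable at 0, and being linear on rays it has unbounded slices.

  Without \<Phi> the coefficient of \<open>\<theta>'(c)\<close> in the critical equation could
  vanish and nothing would follow; the positive weight of \<Phi> makes the relation nontrivial.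

  The slices overlap, so the map for one slice must not bring points back to what earlier ones
  avoided. It is defined only off the part \<open>Z0\<close> of its \<open>K\<close> in earlier
  slices and moves points inside balls that miss those slices; hence the care about supports near
  \<open>Z0\<close>.\<close>

lemma small_multiplier:
  fixes e C :: real
  assumes "e > 0" "C > 0"
  obtains d where "d > 0" "d \<le> 1" "d * C \<le> e"
proof -
  have "min 1 (e / C) * C \<le> e / C * C" using assms by (intro mult_right_mono) auto
  then show ?thesis using assms by (intro that[of "min 1 (e / C)"]) auto
qed

lemma abs_triangle3: "\<bar>a + b + c\<bar> \<le> \<bar>a\<bar> + \<bar>b\<bar> + \<bar>c :: real\<bar>"
  by linarith

text \<open>Boundedness at \<open>x\<close> is required besides equicontinuity: in a product the
  increments of one family are multiplied by the values of the other.\<close>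

definition unif_cont_at :: "'i set \<Rightarrow> ('i \<Rightarrow> 'a::real_normed_vector \<Rightarrow> real) \<Rightarrow> 'a \<Rightarrow> bool" where
  "unif_cont_at S F x \<longleftrightarrow> (\<exists>M. \<forall>s\<in>S. \<bar>F s x\<bar> \<le> M) \<and>
     (\<forall>e>0. \<forall>\<^sub>F y in nhds x. \<forall>s\<in>S. \<bar>F s y - F s x\<bar> \<le> e)"

text \<open>The remainder is small uniformly in \<open>s\<close>; for a family indexed by unit
  directions this is differentiability in the operator norm.\<close>

definition unif_deriv ::
    "'i set \<Rightarrow> ('i \<Rightarrow> 'a::real_normed_vector \<Rightarrow> real) \<Rightarrow> ('i \<Rightarrow> 'a \<Rightarrow> real) \<Rightarrow> 'a \<Rightarrow> bool" where
  "unif_deriv S F F' x \<longleftrightarrow> (\<exists>M. \<forall>s\<in>S. \<bar>F s x\<bar> \<le> M) \<and> (\<forall>s\<in>S. linear (F' s)) \<and>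
     (\<exists>M. \<forall>s\<in>S. \<forall>h. \<bar>F' s h\<bar> \<le> M * norm h) \<and>
     (\<forall>e>0. \<forall>\<^sub>F y in nhds x. \<forall>s\<in>S. \<bar>F s y - F s x - F' s (y - x)\<bar> \<le> e * norm (y - x))"

lemma unif_derivD:
  "unif_deriv S F F' x \<Longrightarrow> e > 0 \<Longrightarrow>
     \<forall>\<^sub>F y in nhds x. \<forall>s\<in>S. \<bar>F s y - F s x - F' s (y - x)\<bar> \<le> e * norm (y - x)"
  unfolding unif_deriv_def by blast

lemma unif_cont_atD:
  "unif_cont_at S F x \<Longrightarrow> e > 0 \<Longrightarrow> \<forall>\<^sub>F y in nhds x. \<forall>s\<in>S. \<bar>F s y - F s x\<bar> \<le> e"
  unfolding unif_cont_at_def by blast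

lemma unif_deriv_Lipschitz:
  assumes "unif_deriv S F F' x"
  obtains M where "M > 0" "\<forall>\<^sub>F y in nhds x. \<forall>s\<in>S. \<bar>F s y - F s x\<bar> \<le> M * norm (y - x)"
proof -
  obtain K where K: "\<And>s h. s \<in> S \<Longrightarrow> \<bar>F' s h\<bar> \<le> K * norm h"
    using assms unfolding unif_deriv_def by blast
  have "\<forall>\<^sub>F y in nhds x. \<forall>s\<in>S. \<bar>F s y - F s x - F' s (y - x)\<bar> \<le> 1 * norm (y - x)"
    using assms unfolding unif_deriv_def by (meson zero_less_one)
  then have "\<forall>\<^sub>F y in nhds x. \<forall>s\<in>S. \<bar>F s y - F s x\<bar> \<le> (\<bar>K\<bar> + 1) * norm (y - x)"
  proof eventually_elim
    case (elim y)
    show ?case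
    proof
      fix s assume s: "s \<in> S"
      have "\<bar>F' s (y - x)\<bar> \<le> \<bar>K\<bar> * norm (y - x)"
        using K[OF s, of "y - x"] mult_right_mono[OF abs_ge_self[of K] norm_ge_zero[of "y - x"]]
        by linarith
      moreover have "\<bar>F s y - F s x - F' s (y - x)\<bar> \<le> 1 * norm (y - x)" using elim s by blast
      ultimately show "\<bar>F s y - F s x\<bar> \<le> (\<bar>K\<bar> + 1) * norm (y - x)"
        by (simp add: distrib_right)
    qed
  qed
  then show ?thesis by (intro that[of "\<bar>K\<bar> + 1"]) auto
qed

lemma eventually_nhds_norm_less: "r > 0 \<Longrightarrow> \<forall>\<^sub>F y in nhds x. norm (y - x) < r"
  for x :: "'a::real_normed_vector"
  by (auto simp: eventually_nhds_metric dist_norm)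

lemma unif_deriv_imp_cont: "unif_deriv S F F' x \<Longrightarrow> unif_cont_at S F x"
proof -
  assume a: "unif_deriv S F F' x"
  obtain M where M: "M > 0" "\<forall>\<^sub>F y in nhds x. \<forall>s\<in>S. \<bar>F s y - F s x\<bar> \<le> M * norm (y - x)"
    using unif_deriv_Lipschitz[OF a] .
  have "\<forall>\<^sub>F y in nhds x. \<forall>s\<in>S. \<bar>F s y - F s x\<bar> \<le> e" if e: "e > 0" for e
  proof -
    have "\<forall>\<^sub>F y in nhds x. norm (y - x) < e / M" using e M by (intro eventually_nhds_norm_less) auto
    with M(2) show ?thesis
    proof eventually_elim
      case (elim y)
      have "M * norm (y - x) \<le> e" using elim(2) M(1) by (simp add: field_simps)
      then show ?case using elim(1) by force
    qed
  qed
  then show ?thesis using a unfolding unif_cont_at_def unif_deriv_def by blast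
qed

lemma unif_deriv_imp_has_derivative:
  assumes "unif_deriv S F F' x" "s \<in> S"
  shows "(F s has_derivative F' s) (at x)"
proof -
  obtain K where K: "\<And>s h. s \<in> S \<Longrightarrow> \<bar>F' s h\<bar> \<le> K * norm h"
    using assms unfolding unif_deriv_def by blast
  have bl: "bounded_linear (F' s)"
    using assms K[OF assms(2)] unfolding unif_deriv_def
    by (intro bounded_linear_intro[where K=K]) (auto simp: linear_iff mult.commute)
  show ?thesis
  unfolding has_derivative_at_alt
  proof (intro conjI allI impI bl)
    fix e :: real assume "e > 0"
    then have "\<forall>\<^sub>F y in nhds x. \<forall>s\<in>S. \<bar>F s y - F s x - F' s (y - x)\<bar> \<le> e * norm (y - x)"
      using assms unfolding unif_deriv_def by blast
    then show "\<exists>d>0. \<forall>y. norm (y - x) < d \<longrightarrow> norm (F s y - F s x - F' s (y - x)) \<le> e * norm (y - x)"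
      using assms(2) unfolding eventually_nhds_metric dist_norm by auto
  qed
qed

lemma unif_deriv_single:
  assumes "(f has_derivative f') (at x)"
  shows "unif_deriv S (\<lambda>_. f) (\<lambda>_. f') x"
proof -
  have bl: "bounded_linear f'" using assms by (rule has_derivative_bounded_linear)
  obtain K where "\<And>h. norm (f' h) \<le> norm h * K" using bounded_linear.bounded[OF bl] by blast
  moreover have "\<forall>\<^sub>F y in nhds x. \<bar>f y - f x - f' (y - x)\<bar> \<le> e * norm (y - x)" if "e > 0" for e
    using assms that unfolding has_derivative_at_alt eventually_nhds_metric dist_norm by auto
  ultimately show ?thesis unfolding unif_deriv_def
  proof (intro conjI allI impI)
    show "\<exists>M. \<forall>s\<in>S. \<bar>f x\<bar> \<le> M" by blast
    show "\<forall>s\<in>S. linear f'" using bl by (simp add: bounded_linear.linear)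
    assume K: "\<And>h. norm (f' h) \<le> norm h * K"
    show "\<exists>M. \<forall>s\<in>S. \<forall>h. \<bar>f' h\<bar> \<le> M * norm h" using K by (auto simp: mult.commute)
  next
    fix e :: real assume e: "e > 0" "\<And>e. e > 0 \<Longrightarrow> \<forall>\<^sub>F y in nhds x. \<bar>f y - f x - f' (y - x)\<bar> \<le> e * norm (y - x)"
    show "\<forall>\<^sub>F y in nhds x. \<forall>s\<in>S. \<bar>f y - f x - f' (y - x)\<bar> \<le> e * norm (y - x)"
      using e(2)[OF e(1)] by eventually_elim blast
  qed
qed

lemma unif_deriv_reindex:
  assumes "unif_deriv S F F' x" "\<And>t. t \<in> T \<Longrightarrow> r t \<in> S"
  shows "unif_deriv T (\<lambda>t. F (r t)) (\<lambda>t. F' (r t)) x"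
proof -
  have "\<forall>\<^sub>F y in nhds x. \<forall>t\<in>T. \<bar>F (r t) y - F (r t) x - F' (r t) (y - x)\<bar> \<le> e * norm (y - x)"
    if "e > 0" for e
  proof -
    have "\<forall>\<^sub>F y in nhds x. \<forall>s\<in>S. \<bar>F s y - F s x - F' s (y - x)\<bar> \<le> e * norm (y - x)"
      using assms(1) that unfolding unif_deriv_def by blast
    then show ?thesis by eventually_elim (use assms(2) in blast)
  qed
  moreover have "\<exists>M. \<forall>t\<in>T. \<bar>F (r t) x\<bar> \<le> M" "\<forall>t\<in>T. linear (F' (r t))" "\<exists>M. \<forall>t\<in>T. \<forall>h. \<bar>F' (r t) h\<bar> \<le> M * norm h"
    using assms unfolding unif_deriv_def by blast+
  ultimately show ?thesis unfolding unif_deriv_def by blast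
qed

lemma unif_cont_at_reindex:
  assumes "unif_cont_at S F x" "\<And>t. t \<in> T \<Longrightarrow> r t \<in> S"
  shows "unif_cont_at T (\<lambda>t. F (r t)) x"
proof -
  have "\<forall>\<^sub>F y in nhds x. \<forall>t\<in>T. \<bar>F (r t) y - F (r t) x\<bar> \<le> e" if "e > 0" for e
  proof -
    have "\<forall>\<^sub>F y in nhds x. \<forall>s\<in>S. \<bar>F s y - F s x\<bar> \<le> e"
      using assms(1) that unfolding unif_cont_at_def by blast
    then show ?thesis by eventually_elim (use assms(2) in blast)
  qed
  moreover have "\<exists>M. \<forall>t\<in>T. \<bar>F (r t) x\<bar> \<le> M"
    using assms unfolding unif_cont_at_def by blast
  ultimately show ?thesis unfolding unif_cont_at_def by blast
qed

lemma unif_cont_at_const: "(\<And>s. s \<in> S \<Longrightarrow> \<bar>c s\<bar> \<le> M) \<Longrightarrow> unif_cont_at S (\<lambda>s y. c s) x"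
  unfolding unif_cont_at_def by auto

lemma unif_deriv_const: "(\<And>s. s \<in> S \<Longrightarrow> \<bar>c s\<bar> \<le> M) \<Longrightarrow> unif_deriv S (\<lambda>s y. c s) (\<lambda>s h. 0) x"
proof -
  assume c: "\<And>s. s \<in> S \<Longrightarrow> \<bar>c s\<bar> \<le> M"
  have "\<exists>M. \<forall>s\<in>S. \<forall>h::'b. \<bar>0::real\<bar> \<le> M * norm h" by (rule exI[of _ 0]) simp
  then show ?thesis using c unfolding unif_deriv_def by (auto simp: linear_iff)
qed

lemma unif_cont_at_add:
  assumes "unif_cont_at S F x" "unif_cont_at S G x"
  shows "unif_cont_at S (\<lambda>s y. F s y + G s y) x"
proof -
  obtain M K where "\<forall>s\<in>S. \<bar>F s x\<bar> \<le> M" "\<forall>s\<in>S. \<bar>G s x\<bar> \<le> K"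
    using assms unfolding unif_cont_at_def by blast
  then have "\<forall>s\<in>S. \<bar>F s x + G s x\<bar> \<le> M + K" by fastforce
  moreover have "\<forall>\<^sub>F y in nhds x. \<forall>s\<in>S. \<bar>(F s y + G s y) - (F s x + G s x)\<bar> \<le> e" if "e > 0" for e
  proof -
    have "\<forall>\<^sub>F y in nhds x. \<forall>s\<in>S. \<bar>F s y - F s x\<bar> \<le> e/2" "\<forall>\<^sub>F y in nhds x. \<forall>s\<in>S. \<bar>G s y - G s x\<bar> \<le> e/2"
      using assms half_gt_zero[OF that] unfolding unif_cont_at_def by blast+
    then show ?thesis
    proof eventually_elim
      case (elim y)
      show ?case
      proof
        fix s assume "s \<in> S"
        with elim have "\<bar>F s y - F s x\<bar> \<le> e/2" "\<bar>G s y - G s x\<bar> \<le> e/2" by blast+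
        then show "\<bar>F s y + G s y - (F s x + G s x)\<bar> \<le> e" by linarith
      qed
    qed
  qed
  ultimately show ?thesis unfolding unif_cont_at_def by blast
qed

lemma unif_deriv_add:
  assumes "unif_deriv S F F' x" "unif_deriv S G G' x"
  shows "unif_deriv S (\<lambda>s y. F s y + G s y) (\<lambda>s h. F' s h + G' s h) x"
proof -
  obtain M K where "\<forall>s\<in>S. \<bar>F s x\<bar> \<le> M" "\<forall>s\<in>S. \<bar>G s x\<bar> \<le> K"
    using assms unfolding unif_deriv_def by blast
  then have 1: "\<forall>s\<in>S. \<bar>F s x + G s x\<bar> \<le> M + K" by fastforce
  obtain M K where MK: "\<forall>s\<in>S. \<forall>h. \<bar>F' s h\<bar> \<le> M * norm h" "\<forall>s\<in>S. \<forall>h. \<bar>G' s h\<bar> \<le> K * norm h"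
    using assms unfolding unif_deriv_def by blast
  have 2: "\<forall>s\<in>S. \<forall>h. \<bar>F' s h + G' s h\<bar> \<le> (M + K) * norm h"
  proof (intro ballI allI)
    fix s h assume "s \<in> S"
    then have "\<bar>F' s h\<bar> \<le> M * norm h" "\<bar>G' s h\<bar> \<le> K * norm h" using MK by blast+
    then show "\<bar>F' s h + G' s h\<bar> \<le> (M + K) * norm h" by (simp add: distrib_right)
  qed
  have 3: "\<forall>\<^sub>F y in nhds x. \<forall>s\<in>S. \<bar>(F s y + G s y) - (F s x + G s x) - (F' s (y - x) + G' s (y - x))\<bar> \<le> e * norm (y - x)"
    if "e > 0" for e
  proof -
    have "\<forall>\<^sub>F y in nhds x. \<forall>s\<in>S. \<bar>F s y - F s x - F' s (y - x)\<bar> \<le> e/2 * norm (y - x)"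
      "\<forall>\<^sub>F y in nhds x. \<forall>s\<in>S. \<bar>G s y - G s x - G' s (y - x)\<bar> \<le> e/2 * norm (y - x)"
      using assms half_gt_zero[OF that] unfolding unif_deriv_def by blast+
    then show ?thesis
    proof eventually_elim
      case (elim y)
      show ?case
      proof
        fix s assume s: "s \<in> S"
        have "\<bar>F s y - F s x - F' s (y - x)\<bar> \<le> e/2 * norm (y - x)" "\<bar>G s y - G s x - G' s (y - x)\<bar> \<le> e/2 * norm (y - x)"
          using elim s by blast+
        then show "\<bar>F s y + G s y - (F s x + G s x) - (F' s (y - x) + G' s (y - x))\<bar> \<le> e * norm (y - x)"
          by linarith
      qed
    qed
  qed
  have 4: "linear (\<lambda>h. F' s h + G' s h)" if "s \<in> S" for s
    using assms that unfolding unif_deriv_def by (intro linear_compose_add) auto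
  show ?thesis unfolding unif_deriv_def using 1 2 3 4 by blast
qed

lemma unif_cont_at_mult:
  assumes "unif_cont_at S F x" "unif_cont_at S G x"
  shows "unif_cont_at S (\<lambda>s y. F s y * G s y) x"
proof -
  obtain M0 K0 where "\<forall>s\<in>S. \<bar>F s x\<bar> \<le> M0" "\<forall>s\<in>S. \<bar>G s x\<bar> \<le> K0"
    using assms unfolding unif_cont_at_def by blast
  then obtain M K where MK: "\<forall>s\<in>S. \<bar>F s x\<bar> \<le> M" "\<forall>s\<in>S. \<bar>G s x\<bar> \<le> K" "M \<ge> 0" "K \<ge> 0"
    using that[of "\<bar>M0\<bar>" "\<bar>K0\<bar>"] by fastforce
  have 1: "\<forall>s\<in>S. \<bar>F s x * G s x\<bar> \<le> M * K"
    using MK by (auto simp: abs_mult intro!: mult_mono)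
  have "\<forall>\<^sub>F y in nhds x. \<forall>s\<in>S. \<bar>F s y * G s y - F s x * G s x\<bar> \<le> e" if "e > 0" for e
  proof -
    obtain d where d: "d > 0" "d \<le> 1" "d * (K + M + 1) \<le> e"
      by (rule small_multiplier[of e "K + M + 1"]) (use \<open>e > 0\<close> MK in auto)
    have "\<forall>\<^sub>F y in nhds x. \<forall>s\<in>S. \<bar>F s y - F s x\<bar> \<le> d" "\<forall>\<^sub>F y in nhds x. \<forall>s\<in>S. \<bar>G s y - G s x\<bar> \<le> d"
      using assms d(1) unfolding unif_cont_at_def by blast+
    then show ?thesis
    proof eventually_elim
      case (elim y)
      show ?case
      proof
        fix s assume s: "s \<in> S"
        have eq: "F s y * G s y - F s x * G s x
            = (F s y - F s x) * G s x + F s x * (G s y - G s x) + (F s y - F s x) * (G s y - G s x)"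
          by (simp add: algebra_simps)
        have "\<bar>F s y * G s y - F s x * G s x\<bar> \<le> \<bar>(F s y - F s x) * G s x\<bar> + \<bar>F s x * (G s y - G s x)\<bar> + \<bar>(F s y - F s x) * (G s y - G s x)\<bar>"
          unfolding eq by (rule abs_triangle3)
        also have "\<dots> \<le> d * K + M * d + d * 1"
        proof -
          have a: "\<bar>F s y - F s x\<bar> \<le> d" "\<bar>G s y - G s x\<bar> \<le> d" "\<bar>G s y - G s x\<bar> \<le> 1" "\<bar>F s x\<bar> \<le> M" "\<bar>G s x\<bar> \<le> K"
            using elim s MK d(2) by force+
          show ?thesis unfolding abs_mult
            by (intro add_mono mult_mono a) (use MK d(1) in auto)
        qed
        also have "\<dots> \<le> e" using d(3) by (simp add: algebra_simps)
        finally show "\<bar>F s y * G s y - F s x * G s x\<bar> \<le> e" .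
      qed
    qed
  qed
  then show ?thesis unfolding unif_cont_at_def using 1 by blast
qed

lemma unif_deriv_mult:
  assumes "unif_deriv S F F' x" "unif_deriv S G G' x"
  shows "unif_deriv S (\<lambda>s y. F s y * G s y) (\<lambda>s h. F' s h * G s x + F s x * G' s h) x"
proof -
  obtain M0 K0 where "\<forall>s\<in>S. \<bar>F s x\<bar> \<le> M0" "\<forall>s\<in>S. \<bar>G s x\<bar> \<le> K0"
    using assms unfolding unif_deriv_def by blast
  then obtain M K where MK: "\<forall>s\<in>S. \<bar>F s x\<bar> \<le> M" "\<forall>s\<in>S. \<bar>G s x\<bar> \<le> K" "M \<ge> 0" "K \<ge> 0"
    using that[of "\<bar>M0\<bar>" "\<bar>K0\<bar>"] by fastforce
  have 1: "\<forall>s\<in>S. \<bar>F s x * G s x\<bar> \<le> M * K"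
    using MK by (auto simp: abs_mult intro!: mult_mono)
  obtain M1 K1 where MK1: "\<forall>s\<in>S. \<forall>h. \<bar>F' s h\<bar> \<le> M1 * norm h" "\<forall>s\<in>S. \<forall>h. \<bar>G' s h\<bar> \<le> K1 * norm h"
    using assms unfolding unif_deriv_def by blast
  have 2: "\<forall>s\<in>S. \<forall>h. \<bar>F' s h * G s x + F s x * G' s h\<bar> \<le> (M1 * K + M * K1) * norm h"
  proof (intro ballI allI)
    fix s h assume s: "s \<in> S"
    have "\<bar>F' s h * G s x\<bar> \<le> (M1 * norm h) * K"
    proof -
      have a: "\<bar>F' s h\<bar> \<le> M1 * norm h" "\<bar>G s x\<bar> \<le> K" using MK1 MK s by blast+
      then show ?thesis unfolding abs_mult by (intro mult_mono a) auto
    qed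
    moreover have "\<bar>F s x * G' s h\<bar> \<le> M * (K1 * norm h)"
    proof -
      have a: "\<bar>G' s h\<bar> \<le> K1 * norm h" "\<bar>F s x\<bar> \<le> M" using MK1 MK s by blast+
      then show ?thesis unfolding abs_mult by (intro mult_mono a) (use MK in auto)
    qed
    ultimately show "\<bar>F' s h * G s x + F s x * G' s h\<bar> \<le> (M1 * K + M * K1) * norm h"
      by (simp add: algebra_simps)
  qed
  obtain L where L: "L > 0" "\<forall>\<^sub>F y in nhds x. \<forall>s\<in>S. \<bar>F s y - F s x\<bar> \<le> L * norm (y - x)"
    using unif_deriv_Lipschitz[OF assms(1)] .
  have 3: "\<forall>\<^sub>F y in nhds x. \<forall>s\<in>S. \<bar>F s y * G s y - F s x * G s x - (F' s (y - x) * G s x + F s x * G' s (y - x))\<bar> \<le> e * norm (y - x)"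
    if "e > 0" for e
  proof -
    \<comment> \<open>The three error terms of the product carry the factors \<open>K\<close>,
      \<open>M\<close> and \<open>L\<close>; with this \<open>d\<close> they add up to exactly
      \<open>e\<close>.\<close>
    define d where "d = e / (K + M + L)"
    have "K + M + L > 0" using MK L(1) by linarith
    then have d: "d > 0" "d * (K + M + L) = e"
      using that by (simp_all add: d_def)
    note unif_derivD[OF assms(1) d(1)] unif_derivD[OF assms(2) d(1)]
      unif_cont_atD[OF unif_deriv_imp_cont[OF assms(2)] d(1)]
    then show ?thesis using L(2)
    proof eventually_elim
      case (elim y)
      show ?case
      proof
        fix s assume s: "s \<in> S"
        have eq: "F s y * G s y - F s x * G s x - (F' s (y - x) * G s x + F s x * G' s (y - x))
            = (F s y - F s x - F' s (y - x)) * G s x + F s x * (G s y - G s x - G' s (y - x)) + (F s y - F s x) * (G s y - G s x)"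
          by (simp add: algebra_simps)
        have "\<bar>F s y * G s y - F s x * G s x - (F' s (y - x) * G s x + F s x * G' s (y - x))\<bar> \<le> \<bar>(F s y - F s x - F' s (y - x)) * G s x\<bar> + \<bar>F s x * (G s y - G s x - G' s (y - x))\<bar> + \<bar>(F s y - F s x) * (G s y - G s x)\<bar>"
          unfolding eq by (rule abs_triangle3)
        also have "\<dots> \<le> (d * norm (y - x)) * K + M * (d * norm (y - x)) + (L * norm (y - x)) * d"
        proof -
          have a: "\<bar>F s y - F s x - F' s (y - x)\<bar> \<le> d * norm (y - x)" "\<bar>G s y - G s x - G' s (y - x)\<bar> \<le> d * norm (y - x)"
             "\<bar>G s y - G s x\<bar> \<le> d" "\<bar>F s y - F s x\<bar> \<le> L * norm (y - x)" "\<bar>F s x\<bar> \<le> M" "\<bar>G s x\<bar> \<le> K"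
            using elim(1) elim(2) elim(3) elim(4) s MK(1) MK(2) by blast+
          show ?thesis unfolding abs_mult
            by (intro add_mono mult_mono a) (use MK d(1) L(1) in auto)
        qed
        also have "\<dots> = e * norm (y - x)" unfolding d(2)[symmetric] by (simp add: algebra_simps)
        finally show "\<bar>F s y * G s y - F s x * G s x - (F' s (y - x) * G s x + F s x * G' s (y - x))\<bar> \<le> e * norm (y - x)" .
      qed
    qed
  qed
  have 4: "linear (\<lambda>h. F' s h * G s x + F s x * G' s h)" if "s \<in> S" for s
  proof -
    have "linear (F' s)" "linear (G' s)" using assms that unfolding unif_deriv_def by blast+
    then show ?thesis by (simp add: linear_iff algebra_simps)
  qed
  show ?thesis unfolding unif_deriv_def using 1 2 3 4 by blast
qed

lemma unif_cont_at_compose: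
  assumes "unif_cont_at S F (u x)" "isCont u x"
  shows "unif_cont_at S (\<lambda>s y. F s (u y)) x"
proof -
  have "filterlim u (nhds (u x)) (nhds x)"
    using assms(2) by (simp add: isCont_def tendsto_at_iff_tendsto_nhds)
  then show ?thesis using assms(1) unfolding unif_cont_at_def filterlim_iff by blast
qed

lemma unif_deriv_compose:
  assumes F: "unif_deriv S F F' (u x)" and u: "(u has_derivative u') (at x)"
  shows "unif_deriv S (\<lambda>s y. F s (u y)) (\<lambda>s h. F' s (u' h)) x"
proof -
  have blu: "bounded_linear u'" using u by (rule has_derivative_bounded_linear)
  obtain K where K: "K > 0" "\<And>h. norm (u' h) \<le> norm h * K" using bounded_linear.pos_bounded[OF blu] by blast
  obtain M0 where "\<forall>s\<in>S. \<forall>h. \<bar>F' s h\<bar> \<le> M0 * norm h" using F unfolding unif_deriv_def by blast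
  note M0 = this
  have "\<bar>F' s h\<bar> \<le> (\<bar>M0\<bar> + 1) * norm h" if "s \<in> S" for s h
  proof -
    have "\<bar>F' s h\<bar> \<le> M0 * norm h" using M0 that by blast
    also have "\<dots> \<le> (\<bar>M0\<bar> + 1) * norm h" by (intro mult_right_mono) auto
    finally show ?thesis .
  qed
  then obtain M where M: "M > 0" "\<And>s h. s \<in> S \<Longrightarrow> \<bar>F' s h\<bar> \<le> M * norm h"
    using that[of "\<bar>M0\<bar> + 1"] by auto
  have lin: "linear (F' s)" if "s \<in> S" for s using F that unfolding unif_deriv_def by blast
  have cont: "filterlim u (nhds (u x)) (nhds x)"
    using has_derivative_continuous[OF u] by (simp add: continuous_within tendsto_at_iff_tendsto_nhds)
  have 2: "\<bar>F' s (u' h)\<bar> \<le> (M * K) * norm h" if "s \<in> S" for s h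
  proof -
    have "\<bar>F' s (u' h)\<bar> \<le> M * norm (u' h)" by (rule M(2)[OF that])
    also have "\<dots> \<le> M * (norm h * K)" using M K by (intro mult_left_mono) auto
    finally show ?thesis by (simp add: ac_simps)
  qed
  have 3: "\<forall>\<^sub>F y in nhds x. \<forall>s\<in>S. \<bar>F s (u y) - F s (u x) - F' s (u' (y - x))\<bar> \<le> e * norm (y - x)"
    if "e > 0" for e
  proof -
    obtain d where d: "d > 0" "d \<le> 1" "d * (K + 1 + M) \<le> e"
      by (rule small_multiplier[of e "K + 1 + M"]) (use \<open>e > 0\<close> M K in auto)
    have "\<forall>\<^sub>F z in nhds (u x). \<forall>s\<in>S. \<bar>F s z - F s (u x) - F' s (z - u x)\<bar> \<le> d * norm (z - u x)"
      using F d(1) unfolding unif_deriv_def by blast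
    then have "\<forall>\<^sub>F y in nhds x. \<forall>s\<in>S. \<bar>F s (u y) - F s (u x) - F' s (u y - u x)\<bar> \<le> d * norm (u y - u x)"
      using cont unfolding filterlim_iff by blast
    moreover have "\<forall>\<^sub>F y in nhds x. norm (u y - u x - u' (y - x)) \<le> d * norm (y - x)"
      using u d(1) unfolding has_derivative_at_alt eventually_nhds_metric dist_norm by auto
    ultimately show ?thesis
    proof eventually_elim
      case (elim y)
      show ?case
      proof
        fix s assume s: "s \<in> S"
        have n: "norm (u y - u x) \<le> (K + 1) * norm (y - x)"
        proof -
          have "norm (u y - u x) \<le> norm (u y - u x - u' (y - x)) + norm (u' (y - x))"
            by (metis diff_add_cancel norm_triangle_ineq)
          also have "\<dots> \<le> 1 * norm (y - x) + norm (y - x) * K"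
            using elim(2) d(2) K(2)[of "y - x"] mult_right_mono[OF d(2) norm_ge_zero[of "y-x"]] by linarith
          finally show ?thesis by (simp add: algebra_simps)
        qed
        have eq: "F s (u y) - F s (u x) - F' s (u' (y - x))
            = (F s (u y) - F s (u x) - F' s (u y - u x)) + F' s (u y - u x - u' (y - x))"
          by (simp add: linear_diff[OF lin[OF s]])
        have "\<bar>F s (u y) - F s (u x) - F' s (u' (y - x))\<bar> \<le> \<bar>F s (u y) - F s (u x) - F' s (u y - u x)\<bar> + \<bar>F' s (u y - u x - u' (y - x))\<bar>"
          unfolding eq by (rule abs_triangle_ineq)
        also have "\<dots> \<le> d * norm (u y - u x) + M * norm (u y - u x - u' (y - x))"
          using elim s M by (intro add_mono) auto
        also have "\<dots> \<le> d * ((K + 1) * norm (y - x)) + M * (d * norm (y - x))"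
          using elim n d M by (intro add_mono mult_left_mono) auto
        also have "\<dots> = (d * (K + 1 + M)) * norm (y - x)" by (simp add: algebra_simps)
        also have "\<dots> \<le> e * norm (y - x)" using d(3) by (intro mult_right_mono) auto
        finally show "\<bar>F s (u y) - F s (u x) - F' s (u' (y - x))\<bar> \<le> e * norm (y - x)" .
      qed
    qed
  qed
  have 4: "linear (\<lambda>h. F' s (u' h))" if "s \<in> S" for s
    using linear_compose[OF bounded_linear.linear[OF blu] lin[OF that]] by (simp add: o_def)
  have 1: "\<exists>M. \<forall>s\<in>S. \<bar>F s (u x)\<bar> \<le> M" using F unfolding unif_deriv_def by blast
  show ?thesis unfolding unif_deriv_def using 1 2 3 4 by blast
qed

lemma unif_cont_at_cong:
  assumes "unif_cont_at S F x" "open Y" "x \<in> Y" "\<And>s y. s \<in> S \<Longrightarrow> y \<in> Y \<Longrightarrow> F s y = G s y"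
  shows "unif_cont_at S G x"
proof -
  have ev: "\<forall>\<^sub>F y in nhds x. y \<in> Y" using assms by (auto simp: eventually_nhds)
  have "\<forall>\<^sub>F y in nhds x. \<forall>s\<in>S. \<bar>G s y - G s x\<bar> \<le> e" if "e > 0" for e
    using ev unif_cont_atD[OF assms(1) that] by eventually_elim (use assms in auto)
  moreover have "\<exists>M. \<forall>s\<in>S. \<bar>G s x\<bar> \<le> M"
    using assms unfolding unif_cont_at_def by auto
  ultimately show ?thesis unfolding unif_cont_at_def by blast
qed

lemma unif_deriv_cong:
  assumes "unif_deriv S F F' x" "open Y" "x \<in> Y" "\<And>s y. s \<in> S \<Longrightarrow> y \<in> Y \<Longrightarrow> F s y = G s y"
    "\<And>s. s \<in> S \<Longrightarrow> F' s = G' s"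
  shows "unif_deriv S G G' x"
proof -
  have ev: "\<forall>\<^sub>F y in nhds x. y \<in> Y" using assms by (auto simp: eventually_nhds)
  have "\<forall>\<^sub>F y in nhds x. \<forall>s\<in>S. \<bar>G s y - G s x - G' s (y - x)\<bar> \<le> e * norm (y - x)" if "e > 0" for e
    using ev unif_derivD[OF assms(1) that] by eventually_elim (use assms in auto)
  moreover have "\<exists>M. \<forall>s\<in>S. \<bar>G s x\<bar> \<le> M" "\<forall>s\<in>S. linear (G' s)"
      "\<exists>M. \<forall>s\<in>S. \<forall>h. \<bar>G' s h\<bar> \<le> M * norm h"
    using assms unfolding unif_deriv_def by auto
  ultimately show ?thesis unfolding unif_deriv_def by blast
qed

definition Scons :: "'a::real_normed_vector list set \<Rightarrow> 'a list set" where
  "Scons S = {h # s | h s. norm h \<le> 1 \<and> s \<in> S}"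

lemma Scons_iff: "h # s \<in> Scons S \<longleftrightarrow> norm h \<le> 1 \<and> s \<in> S"
  by (auto simp: Scons_def)

lemma SconsD: "l \<in> Scons S \<Longrightarrow> norm (hd l) \<le> 1" "l \<in> Scons S \<Longrightarrow> tl l \<in> S"
  by (auto simp: Scons_def)

text \<open>
  \<open>UC k Y S F\<close>: the family \<open>(F s)\<close>, \<open>s \<in> S\<close>, is \<open>C\<^sup>k\<close> on \<open>Y\<close> with derivatives and moduli uniform in \<open>s\<close>.
  Derivatives are again families of real functions, indexed by the directions in the unit ball that
  are prepended to \<open>s\<close>, so no operator-valued maps are needed.
\<close>

primrec UC :: "nat \<Rightarrow> 'a::real_normed_vector set \<Rightarrow> 'a list set \<Rightarrow> ('a list \<Rightarrow> 'a \<Rightarrow> real) \<Rightarrow> bool" where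
  "UC 0 Y S F = (\<forall>x\<in>Y. unif_cont_at S F x)"
| "UC (Suc k) Y S F = (\<exists>F'. (\<forall>x\<in>Y. unif_deriv S F (\<lambda>s. F' s x) x) \<and>
     UC k Y (Scons S) (\<lambda>l x. F' (tl l) x (hd l)))"

lemma UC_SucI:
  assumes "\<And>x. x \<in> Y \<Longrightarrow> unif_deriv S F (\<lambda>s. F' s x) x" "UC k Y (Scons S) (\<lambda>l x. F' (tl l) x (hd l))"
  shows "UC (Suc k) Y S F"
  using assms by auto

lemma UC_reindex:
  "UC k Y S F \<Longrightarrow> (\<And>t. t \<in> T \<Longrightarrow> r t \<in> S) \<Longrightarrow> UC k Y T (\<lambda>t. F (r t))"
proof (induction k arbitrary: S T F r)
  case 0
  have "unif_cont_at T (\<lambda>t. F (r t)) x" if "x \<in> Y" for x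
    by (rule unif_cont_at_reindex[of S F]) (use 0(1) that in simp, rule 0(2))
  then show ?case by simp
next
  case (Suc k)
  obtain F' where F': "\<And>x. x \<in> Y \<Longrightarrow> unif_deriv S F (\<lambda>s. F' s x) x"
    and U: "UC k Y (Scons S) (\<lambda>l x. F' (tl l) x (hd l))" using Suc.prems(1) by auto
  show ?case
  proof (rule UC_SucI[where F'="\<lambda>t. F' (r t)"])
    show "unif_deriv T (\<lambda>t. F (r t)) (\<lambda>s. F' (r s) x) x" if "x \<in> Y" for x
      using unif_deriv_reindex[OF F'[OF that] Suc.prems(2)] .
    show "UC k Y (Scons T) (\<lambda>l x. F' (r (tl l)) x (hd l))"
    proof -
      have "UC k Y (Scons T) (\<lambda>l x. F' (tl (hd l # r (tl l))) x (hd (hd l # r (tl l))))"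
        by (rule Suc.IH[OF U]) (simp add: Scons_iff SconsD Suc.prems(2))
      then show ?thesis by simp
    qed
  qed
qed

lemma UC_cong:
  "UC k Y S F \<Longrightarrow> open Y \<Longrightarrow> (\<And>s y. s \<in> S \<Longrightarrow> y \<in> Y \<Longrightarrow> F s y = G s y) \<Longrightarrow> UC k Y S G"
proof (cases k)
  case 0
  assume "UC k Y S F" "open Y" "(\<And>s y. s \<in> S \<Longrightarrow> y \<in> Y \<Longrightarrow> F s y = G s y)"
  note a = this
  have "unif_cont_at S G x" if "x \<in> Y" for x
    by (rule unif_cont_at_cong[of S F x Y]) (use a(1) 0 that in simp, rule a(2), rule that, rule a(3))
  then show ?thesis using 0 by simp
next
  case (Suc j)
  assume a: "UC k Y S F" "open Y" "(\<And>s y. s \<in> S \<Longrightarrow> y \<in> Y \<Longrightarrow> F s y = G s y)"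
  obtain F' where F': "\<And>x. x \<in> Y \<Longrightarrow> unif_deriv S F (\<lambda>s. F' s x) x"
    and U: "UC j Y (Scons S) (\<lambda>l x. F' (tl l) x (hd l))" using a(1) Suc by auto
  have "unif_deriv S G (\<lambda>s. F' s x) x" if "x \<in> Y" for x
    by (rule unif_deriv_cong[OF F'[OF that] a(2) that]) (rule a(3), assumption+, rule refl)
  then show ?thesis unfolding Suc using U by (intro UC_SucI)
qed

lemma UC_subset: "UC k Y S F \<Longrightarrow> Z \<subseteq> Y \<Longrightarrow> UC k Z S F"
  by (induction k arbitrary: S F) (auto, blast)

lemma UC_Suc_imp: "UC (Suc k) Y S F \<Longrightarrow> UC k Y S F"
proof (induction k arbitrary: S F)
  case 0
  then obtain F' where "\<And>x. x \<in> Y \<Longrightarrow> unif_deriv S F (\<lambda>s. F' s x) x" by auto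
  then have "unif_cont_at S F x" if "x \<in> Y" for x using that by (blast intro: unif_deriv_imp_cont)
  then show ?case by simp
next
  case (Suc k)
  obtain F' where F': "\<And>x. x \<in> Y \<Longrightarrow> unif_deriv S F (\<lambda>s. F' s x) x"
    and U: "UC (Suc k) Y (Scons S) (\<lambda>l x. F' (tl l) x (hd l))" using Suc.prems by auto
  show ?case using Suc.IH[OF U] F' by (intro UC_SucI)
qed

lemma UC_const: "(\<And>s. s \<in> S \<Longrightarrow> \<bar>c s\<bar> \<le> M) \<Longrightarrow> UC k Y S (\<lambda>s y. c s)"
proof (induction k arbitrary: S c M)
  case 0
  then show ?case by (auto intro: unif_cont_at_const)
next
  case (Suc k)
  show ?case
  proof (rule UC_SucI[where F'="\<lambda>s x h. 0"])
    show "unif_deriv S (\<lambda>s y. c s) (\<lambda>s h. 0) x" for x using unif_deriv_const[of S c M] Suc.prems by blast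
    show "UC k Y (Scons S) (\<lambda>l x. 0)" by (rule Suc.IH[of _ _ 0]) auto
  qed
qed

lemma UC_add: "UC k Y S F \<Longrightarrow> UC k Y S G \<Longrightarrow> UC k Y S (\<lambda>s y. F s y + G s y)"
proof (induction k arbitrary: S F G)
  case 0
  have "unif_cont_at S (\<lambda>s y. F s y + G s y) x" if "x \<in> Y" for x
    by (rule unif_cont_at_add) (use 0 that in simp_all)
  then show ?case by simp
next
  case (Suc k)
  obtain F' where F': "\<And>x. x \<in> Y \<Longrightarrow> unif_deriv S F (\<lambda>s. F' s x) x"
    and U: "UC k Y (Scons S) (\<lambda>l x. F' (tl l) x (hd l))" using Suc.prems(1) by auto
  obtain G' where G': "\<And>x. x \<in> Y \<Longrightarrow> unif_deriv S G (\<lambda>s. G' s x) x"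
    and V: "UC k Y (Scons S) (\<lambda>l x. G' (tl l) x (hd l))" using Suc.prems(2) by auto
  show ?case
  proof (rule UC_SucI[where F'="\<lambda>s x h. F' s x h + G' s x h"])
    show "unif_deriv S (\<lambda>s y. F s y + G s y) (\<lambda>s h. F' s x h + G' s x h) x" if "x \<in> Y" for x
      using unif_deriv_add[OF F'[OF that] G'[OF that]] .
    show "UC k Y (Scons S) (\<lambda>l x. F' (tl l) x (hd l) + G' (tl l) x (hd l))"
      using Suc.IH[OF U V] .
  qed
qed

lemma UC_tl: "UC k Y S F \<Longrightarrow> UC k Y (Scons S) (\<lambda>l. F (tl l))"
  by (rule UC_reindex[of k Y S F]) (assumption, rule SconsD)

lemma UC_mult: "UC k Y S F \<Longrightarrow> UC k Y S G \<Longrightarrow> UC k Y S (\<lambda>s y. F s y * G s y)"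
proof (induction k arbitrary: S F G)
  case 0
  have "unif_cont_at S (\<lambda>s y. F s y * G s y) x" if "x \<in> Y" for x
    by (rule unif_cont_at_mult) (use 0 that in simp_all)
  then show ?case by simp
next
  case (Suc k)
  obtain F' where F': "\<And>x. x \<in> Y \<Longrightarrow> unif_deriv S F (\<lambda>s. F' s x) x"
    and U: "UC k Y (Scons S) (\<lambda>l x. F' (tl l) x (hd l))" using Suc.prems(1) by auto
  obtain G' where G': "\<And>x. x \<in> Y \<Longrightarrow> unif_deriv S G (\<lambda>s. G' s x) x"
    and V: "UC k Y (Scons S) (\<lambda>l x. G' (tl l) x (hd l))" using Suc.prems(2) by auto
  have FG: "UC k Y (Scons S) (\<lambda>l. F (tl l))" "UC k Y (Scons S) (\<lambda>l. G (tl l))"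
    using Suc.prems by (blast intro: UC_tl UC_Suc_imp)+
  show ?case
  proof (rule UC_SucI[where F'="\<lambda>s x h. F' s x h * G s x + F s x * G' s x h"])
    show "unif_deriv S (\<lambda>s y. F s y * G s y) (\<lambda>s h. F' s x h * G s x + F s x * G' s x h) x" if "x \<in> Y" for x
      using unif_deriv_mult[OF F'[OF that] G'[OF that]] .
    show "UC k Y (Scons S) (\<lambda>l x. F' (tl l) x (hd l) * G (tl l) x + F (tl l) x * G' (tl l) x (hd l))"
      by (intro UC_add Suc.IH U V FG)
  qed
qed

lemma UC_cmult: "UC k Y S F \<Longrightarrow> UC k Y S (\<lambda>s y. c * F s y)"
  using UC_mult[OF UC_const[of S "\<lambda>_. c" "\<bar>c\<bar>"]] by simp

lemma UC_linear:
  assumes "bounded_linear \<phi>"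
  shows "UC k Y S (\<lambda>_. \<phi>)"
proof -
  have 1: "unif_deriv S (\<lambda>_. \<phi>) (\<lambda>_. \<phi>) x" for x S
    using assms by (intro unif_deriv_single bounded_linear_imp_has_derivative)
  have "UC k Y (Scons S) (\<lambda>l x. \<phi> (hd l))" for k
  proof -
    obtain K where K: "K \<ge> 0" "\<And>h. norm (\<phi> h) \<le> norm h * K" using bounded_linear.nonneg_bounded[OF assms] by blast
    show ?thesis
    proof (rule UC_const)
      fix l assume "l \<in> Scons S"
      then have "norm (hd l) \<le> 1" by (auto simp: Scons_def)
      then show "\<bar>\<phi> (hd l)\<bar> \<le> 1 * K" using K(2)[of "hd l"] mult_right_mono[OF _ K(1), of "norm (hd l)" 1] by simp
    qed
  qed
  note 2 = this
  show ?thesis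
  proof (cases k)
    case 0
    have "unif_cont_at S (\<lambda>_. \<phi>) x" for x using 1 by (rule unif_deriv_imp_cont)
    then show ?thesis using 0 by simp
  next
    case (Suc j) then show ?thesis using 1 2 by (auto simp del: UC.simps intro!: UC_SucI[where F'="\<lambda>s x h. \<phi> h"])
  qed
qed

lemma UC_has_derivative:
  assumes "UC (Suc k) Y S F"
  obtains F' where "\<And>x. x \<in> Y \<Longrightarrow> unif_deriv S F (\<lambda>s. F' s x) x"
     "UC k Y (Scons S) (\<lambda>l x. F' (tl l) x (hd l))"
     "\<And>x s. x \<in> Y \<Longrightarrow> s \<in> S \<Longrightarrow> (F s has_derivative F' s x) (at x)"
proof -
  obtain F' where F': "\<And>x. x \<in> Y \<Longrightarrow> unif_deriv S F (\<lambda>s. F' s x) x"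
     "UC k Y (Scons S) (\<lambda>l x. F' (tl l) x (hd l))" using assms by auto
  show ?thesis by (rule that[OF F']) (auto dest: F'(1) intro: unif_deriv_imp_has_derivative)
qed

text \<open>The whole sequence of derivatives \<xi> is given at once, so that the induction on
  \<open>k\<close> can pass from \<open>\<xi> n\<close> to \<open>\<xi> (Suc n)\<close>.\<close>

lemma UC_scalar:
  assumes I: "open I" "\<And>n t. t \<in> I \<Longrightarrow> ((\<xi> n) has_real_derivative \<xi> (Suc n) t) (at t)"
    and f: "UC k Y {[]::'a::real_normed_vector list} (\<lambda>_. f)" "\<And>x. x \<in> Y \<Longrightarrow> f x \<in> I"
  shows "UC k Y S (\<lambda>_ x. \<xi> n (f x))"
  using f(1)
proof (induction k arbitrary: n S)
  case 0
  have "unif_cont_at S (\<lambda>_ x. \<xi> n (f x)) x" if x: "x \<in> Y" for x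
  proof -
    have "unif_cont_at {[]::'a list} (\<lambda>_. f) x" using 0 x by auto
    then have "isCont f x"
      unfolding isCont_def tendsto_iff
    proof (intro allI impI)
      fix e :: real assume e: "e > 0" and u: "unif_cont_at {[]::'a list} (\<lambda>_. f) x"
      have "\<forall>\<^sub>F y in nhds x. \<bar>f y - f x\<bar> \<le> e/2" using unif_cont_atD[OF u, of "e/2"] e by simp
      then have "\<forall>\<^sub>F y in nhds x. dist (f y) (f x) < e"
        by eventually_elim (use e in \<open>auto simp: dist_real_def\<close>)
      then show "\<forall>\<^sub>F y in at x. dist (f y) (f x) < e"
        by (simp add: eventually_nhds_conv_at)
    qed
    moreover have "isCont (\<xi> n) (f x)" using I(2)[OF f(2)[OF x]] by (rule DERIV_isCont)
    ultimately have "isCont (\<lambda>x. \<xi> n (f x)) x" using isCont_o2 by blast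
    then have ev: "\<forall>\<^sub>F y in nhds x. \<bar>\<xi> n (f y) - \<xi> n (f x)\<bar> \<le> e" if "e > 0" for e
    proof -
      assume "isCont (\<lambda>x. \<xi> n (f x)) x"
      then have "((\<lambda>x. \<xi> n (f x)) \<longlongrightarrow> \<xi> n (f x)) (nhds x)" using tendsto_at_iff_tendsto_nhds[of "\<lambda>x. \<xi> n (f x)" x] by (simp add: isCont_def)
      then have "\<forall>\<^sub>F y in nhds x. dist (\<xi> n (f y)) (\<xi> n (f x)) < e" using that by (simp add: tendsto_iff)
      then show ?thesis by eventually_elim (auto simp: dist_real_def)
    qed
    have "\<forall>\<^sub>F y in nhds x. \<forall>s\<in>S. \<bar>\<xi> n (f y) - \<xi> n (f x)\<bar> \<le> e" if "e > 0" for e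
      using ev[OF that] by eventually_elim blast
    then show ?thesis unfolding unif_cont_at_def by blast
  qed
  then show ?case by simp
next
  case (Suc k)
  obtain f' where f': "\<And>x. x \<in> Y \<Longrightarrow> unif_deriv {[]} (\<lambda>_. f) (\<lambda>s. f' s x) x"
     "UC k Y (Scons {[]}) (\<lambda>l x. f' (tl l) x (hd l))"
     "\<And>x s. x \<in> Y \<Longrightarrow> s \<in> {[]} \<Longrightarrow> (f has_derivative f' s x) (at x)"
    by (rule UC_has_derivative[OF Suc.prems]) blast
  have IH: "UC k Y S (\<lambda>_ x. \<xi> n (f x))" for n S using Suc.IH UC_Suc_imp[OF Suc.prems] .
  show ?case
  proof (rule UC_SucI[where F'="\<lambda>s x h. \<xi> (Suc n) (f x) * f' [] x h"])
    show "unif_deriv S (\<lambda>_ x. \<xi> n (f x)) (\<lambda>s h. \<xi> (Suc n) (f x) * f' [] x h) x" if x: "x \<in> Y" for x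
    proof (rule unif_deriv_single)
      have "((\<xi> n) has_derivative (\<lambda>h. h * \<xi> (Suc n) (f x))) (at (f x))"
        using I(2)[OF f(2)[OF x]] by (simp add: has_field_derivative_def mult.commute[of _ "\<xi> (Suc n) (f x)"])
      from has_derivative_compose[OF f'(3)[OF x] this]
      show "((\<lambda>x. \<xi> n (f x)) has_derivative (\<lambda>h. \<xi> (Suc n) (f x) * f' [] x h)) (at x)"
        by (simp add: mult.commute)
    qed
    have "UC k Y (Scons S) (\<lambda>l x. f' [] x (hd l))"
    proof -
      have "UC k Y (Scons S) (\<lambda>l x. f' (tl [hd l]) x (hd [hd l]))"
        by (rule UC_reindex[OF f'(2)]) (simp add: Scons_iff SconsD)
      then show ?thesis by simp
    qed
    then show "UC k Y (Scons S) (\<lambda>l x. \<xi> (Suc n) (f x) * f' [] x (hd l))"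
      by (intro UC_mult IH)
  qed
qed


text \<open>The nonlinear part of the inner map moves in the single direction \<open>d\<close>, so
  the chain rule yields two terms, \<open>F'\<close> in the direction \<open>L h\<close> and a
  scalar times \<open>F'\<close> in the direction \<open>d\<close>. Both are real families again,
  and the induction stays within real functions.\<close>

lemma UC_shear:
  fixes L :: "'a::real_normed_vector \<Rightarrow> 'a"
  assumes "UC k T S F" "UC k Y {[]} (\<lambda>_. a)" and L: "bounded_linear L"
    and Y: "open Y" and T: "\<And>x. x \<in> Y \<Longrightarrow> L x + b + a x *\<^sub>R d \<in> T"
  shows "UC k Y S (\<lambda>s x. F s (L x + b + a x *\<^sub>R d))"
  using assms(1,2)
proof (induction k arbitrary: S F)
  case 0
  have "unif_cont_at S (\<lambda>s x. F s (L x + b + a x *\<^sub>R d)) x" if x: "x \<in> Y" for x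
  proof (rule unif_cont_at_compose)
    show "unif_cont_at S F (L x + b + a x *\<^sub>R d)" using 0 T[OF x] by simp
    have "unif_cont_at {[]::'a list} (\<lambda>_. a) x" using 0 x by auto
    then have "isCont a x"
      unfolding isCont_def tendsto_iff
    proof (intro allI impI)
      fix e :: real assume e: "e > 0" and u: "unif_cont_at {[]::'a list} (\<lambda>_. a) x"
      have "\<forall>\<^sub>F y in nhds x. \<bar>a y - a x\<bar> \<le> e/2" using unif_cont_atD[OF u, of "e/2"] e by simp
      then have "\<forall>\<^sub>F y in nhds x. dist (a y) (a x) < e"
        by eventually_elim (use e in \<open>auto simp: dist_real_def\<close>)
      then show "\<forall>\<^sub>F y in at x. dist (a y) (a x) < e"
        by (simp add: eventually_nhds_conv_at)
    qed
    moreover have "isCont L x" using L by (rule linear_continuous_at)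
    ultimately show "isCont (\<lambda>x. L x + b + a x *\<^sub>R d) x" by (intro continuous_intros)
  qed
  then show ?case by simp
next
  case (Suc k)
  obtain F' where F': "\<And>x. x \<in> T \<Longrightarrow> unif_deriv S F (\<lambda>s. F' s x) x"
     "UC k T (Scons S) (\<lambda>l x. F' (tl l) x (hd l))"
    by (rule UC_has_derivative[OF Suc.prems(1)]) blast
  obtain a' where a': "\<And>x. x \<in> Y \<Longrightarrow> unif_deriv {[]} (\<lambda>_. a) (\<lambda>s. a' s x) x"
     "UC k Y (Scons {[]}) (\<lambda>l x. a' (tl l) x (hd l))"
     "\<And>x s. x \<in> Y \<Longrightarrow> s \<in> {[]} \<Longrightarrow> (a has_derivative a' s x) (at x)"
    by (rule UC_has_derivative[OF Suc.prems(2)]) blast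
  have UCa: "UC k Y {[]} (\<lambda>_. a)" using UC_Suc_imp[OF Suc.prems(2)] .
  let ?u = "\<lambda>x. L x + b + a x *\<^sub>R d"
  have lin: "linear (F' s z)" if "z \<in> T" "s \<in> S" for s z
    using F'(1)[OF that(1)] that unfolding unif_deriv_def by blast
  obtain C where C: "C > 0" "\<And>h. norm (L h) \<le> norm h * C" using bounded_linear.pos_bounded[OF L] by blast
  \<comment> \<open>Index lists contain only directions of norm at most 1. A direction
    \<open>w l\<close> of norm up to \<open>C'\<close> is scaled into the unit ball, and linearity
    returns the factor \<open>C'\<close>.\<close>
  have scal: "UC k Y (Scons S) (\<lambda>l x. F' (tl l) (?u x) (w l))"
    if w: "\<And>l. l \<in> Scons S \<Longrightarrow> norm (w l) \<le> C'" and C': "C' > 0" for w C'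
  proof -
    have 1: "UC k Y (Scons S) (\<lambda>l x. F' (tl l) (?u x) (hd l))" using Suc.IH[OF F'(2) UCa] .
    have 2: "UC k Y (Scons S) (\<lambda>l x. F' (tl l) (?u x) ((1/C') *\<^sub>R w l))"
    proof -
      have "UC k Y (Scons S) (\<lambda>l x. F' (tl (((1/C') *\<^sub>R w l) # tl l)) (?u x) (hd (((1/C') *\<^sub>R w l) # tl l)))"
      proof (rule UC_reindex[OF 1])
        fix l assume l: "l \<in> Scons S"
        have "norm ((1/C') *\<^sub>R w l) \<le> 1" using w[OF l] C' by (simp add: field_simps)
        then show "((1/C') *\<^sub>R w l) # tl l \<in> Scons S" using SconsD(2)[OF l] by (simp only: Scons_iff)
      qed
      then show ?thesis by simp
    qed
    have 3: "UC k Y (Scons S) (\<lambda>l x. C' * F' (tl l) (?u x) ((1/C') *\<^sub>R w l))" by (rule UC_cmult[OF 2])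
    have eq: "C' * F' (tl l) (?u x) ((1/C') *\<^sub>R w l) = F' (tl l) (?u x) (w l)" if "l \<in> Scons S" "x \<in> Y" for l x
    proof -
      have "tl l \<in> S" using that(1) by (rule SconsD)
      then have "linear (F' (tl l) (?u x))" using lin T that by blast
      then show ?thesis using C' by (simp add: linear_scale)
    qed
    show ?thesis by (rule UC_cong[OF 3 Y]) (rule eq)
  qed
  show ?case
  proof (rule UC_SucI[where F'="\<lambda>s x h. F' s (?u x) (L h + a' [] x h *\<^sub>R d)"])
    show "unif_deriv S (\<lambda>s x. F s (?u x)) (\<lambda>s h. F' s (?u x) (L h + a' [] x h *\<^sub>R d)) x" if x: "x \<in> Y" for x
    proof (rule unif_deriv_compose)
      show "unif_deriv S F (\<lambda>s. F' s (?u x)) (?u x)" using F'(1) T x by blast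
      have "(a has_derivative a' [] x) (at x)" using a'(3)[OF x] by simp
      moreover have "(L has_derivative L) (at x)" using L by (rule bounded_linear_imp_has_derivative)
      ultimately show "(?u has_derivative (\<lambda>h. L h + a' [] x h *\<^sub>R d)) (at x)"
        by (auto intro!: derivative_eq_intros)
    qed
    have w1: "norm (L (hd l)) \<le> C" if "l \<in> Scons S" for l
    proof -
      have "norm (hd l) \<le> 1" using that by (rule SconsD)
      then have "norm (hd l) * C \<le> 1 * C" using C by (intro mult_right_mono) auto
      then show ?thesis using C(2)[of "hd l"] by simp
    qed
    have s1: "UC k Y (Scons S) (\<lambda>l x. F' (tl l) (?u x) (L (hd l)))" by (rule scal[OF w1 C(1)])
    have s2: "UC k Y (Scons S) (\<lambda>l x. F' (tl l) (?u x) d)" by (rule scal[of "\<lambda>_. d" "norm d + 1"]) (auto simp: add_nonneg_pos)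
    have s3: "UC k Y (Scons S) (\<lambda>l x. a' [] x (hd l))"
    proof -
      have "UC k Y (Scons S) (\<lambda>l x. a' (tl [hd l]) x (hd [hd l]))"
        by (rule UC_reindex[OF a'(2)]) (simp add: Scons_iff SconsD)
      then show ?thesis by simp
    qed
    have s4: "UC k Y (Scons S) (\<lambda>l x. F' (tl l) (?u x) (L (hd l)) + a' [] x (hd l) * F' (tl l) (?u x) d)"
      by (intro UC_add UC_mult s1 s2 s3)
    show "UC k Y (Scons S) (\<lambda>l x. F' (tl l) (?u x) (L (hd l) + a' [] x (hd l) *\<^sub>R d))"
    proof (rule UC_cong[OF s4 Y])
      fix l x assume l: "l \<in> Scons S" and x: "x \<in> Y"
      have "tl l \<in> S" using l by (rule SconsD)
      then have "linear (F' (tl l) (?u x))" using lin T x by blast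
      then show "F' (tl l) (?u x) (L (hd l)) + a' [] x (hd l) * F' (tl l) (?u x) d
         = F' (tl l) (?u x) (L (hd l) + a' [] x (hd l) *\<^sub>R d)"
        by (simp add: linear_add linear_scale)
    qed
  qed
qed

lemma UC_local:
  assumes "\<And>x. x \<in> Y \<Longrightarrow> \<exists>T. open T \<and> x \<in> T \<and> UC k T S F"
  shows "UC k Y S F"
  using assms
proof (induction k arbitrary: S F)
  case 0
  then show ?case by auto
next
  case (Suc k)
  \<comment> \<open>The local derivatives are glued through a canonical choice, with which each of
    them agrees by uniqueness.\<close>
  define F' where "F' = (\<lambda>s x. frechet_derivative (F s) (at x))"
  have loc: "\<exists>T. open T \<and> x \<in> T \<and> (\<forall>y\<in>T. unif_deriv S F (\<lambda>s. F' s y) y) \<and> UC k T (Scons S) (\<lambda>l x. F' (tl l) x (hd l))"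
    if x: "x \<in> Y" for x
  proof -
    obtain T where T: "open T" "x \<in> T" "UC (Suc k) T S F" using Suc.prems[OF x] by blast
    obtain G where G: "\<And>x. x \<in> T \<Longrightarrow> unif_deriv S F (\<lambda>s. G s x) x"
     "UC k T (Scons S) (\<lambda>l x. G (tl l) x (hd l))"
     "\<And>x s. x \<in> T \<Longrightarrow> s \<in> S \<Longrightarrow> (F s has_derivative G s x) (at x)"
      by (rule UC_has_derivative[OF T(3)]) blast
    have eq: "G s y = F' s y" if "y \<in> T" "s \<in> S" for s y
      unfolding F'_def using G(3)[OF that] by (rule frechet_derivative_at)
    have 1: "unif_deriv S F (\<lambda>s. F' s y) y" if "y \<in> T" for y
      by (rule unif_deriv_cong[OF G(1)[OF that] T(1) that]) (use eq that in auto)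
    have 2: "UC k T (Scons S) (\<lambda>l x. F' (tl l) x (hd l))"
      by (rule UC_cong[OF G(2) T(1)]) (auto simp: eq Scons_def)
    show ?thesis using T(1,2) 1 2 by blast
  qed
  show ?case
  proof (rule UC_SucI[where F'=F'])
    show "unif_deriv S F (\<lambda>s. F' s x) x" if "x \<in> Y" for x using loc[OF that] by blast
    show "UC k Y (Scons S) (\<lambda>l x. F' (tl l) x (hd l))"
      by (rule Suc.IH) (use loc in blast)
  qed
qed

section \<open>Iterated directional derivatives and the agreement with
  \<open>C_smooth_on\<close>\<close>

definition unit_lists :: "nat \<Rightarrow> 'a::real_normed_vector list set" where
  "unit_lists m = {vs. length vs = m \<and> (\<forall>v\<in>set vs. norm v \<le> 1)}"

lemma unit_lists_0: "unit_lists 0 = {[]}"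
  by (auto simp: unit_lists_def)

lemma unit_lists_Suc: "unit_lists (Suc m) = Scons (unit_lists m)"
  by (auto simp: unit_lists_def Scons_def length_Suc_conv)

lemma map_sgn_unit_lists: "map sgn vs \<in> unit_lists (length vs)"
  by (auto simp: unit_lists_def norm_sgn)

lemma norm_scaleR_sgn: "norm v *\<^sub>R sgn v = v"
  for v :: "'a::real_normed_vector"
  by (cases "v = 0") (auto simp: sgn_div_norm)

definition smooth :: "enat \<Rightarrow> ('a::real_normed_vector \<Rightarrow> real) \<Rightarrow> 'a set \<Rightarrow> bool" where
  "smooth p f Y \<longleftrightarrow> open Y \<and> (\<forall>k. enat k \<le> p \<longrightarrow> UC k Y {[]} (\<lambda>_. f))"

primrec iterD :: "('a::real_normed_vector \<Rightarrow> real) \<Rightarrow> 'a list \<Rightarrow> 'a \<Rightarrow> real" where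
  "iterD f [] = f"
| "iterD f (h # vs) = (\<lambda>x. frechet_derivative (iterD f vs) (at x) h)"

lemma iterD_UC:
  assumes "open Y" "UC k Y {[]} (\<lambda>_. f)" "m \<le> k"
  shows "UC (k - m) Y (unit_lists m) (iterD f)"
  using assms(3)
proof (induction m)
  case 0
  show ?case using assms(2) by (auto simp: unit_lists_0 intro: UC_cong[OF _ assms(1)])
next
  case (Suc m)
  then have "UC (Suc (k - Suc m)) Y (unit_lists m) (iterD f)" by (simp add: Suc_diff_Suc del: UC.simps)
  then obtain F' where F': "\<And>x. x \<in> Y \<Longrightarrow> unif_deriv (unit_lists m) (iterD f) (\<lambda>s. F' s x) x"
     "UC (k - Suc m) Y (Scons (unit_lists m)) (\<lambda>l x. F' (tl l) x (hd l))"
     "\<And>x s. x \<in> Y \<Longrightarrow> s \<in> unit_lists m \<Longrightarrow> (iterD f s has_derivative F' s x) (at x)"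
    by (rule UC_has_derivative) blast
  show ?case unfolding unit_lists_Suc
  proof (rule UC_cong[OF F'(2) assms(1)])
    fix l :: "'a list" and x assume l: "l \<in> Scons (unit_lists m)" and x: "x \<in> Y"
    obtain h s where hs: "l = h # s" "s \<in> unit_lists m" using l by (auto simp: Scons_def)
    show "F' (tl l) x (hd l) = iterD f l x"
      using frechet_derivative_at[OF F'(3)[OF x hs(2)]] by (simp add: hs(1))
  qed
qed

lemma UC_differentiable:
  assumes "UC (Suc k) Y S F" "x \<in> Y" "s \<in> S"
  shows "(F s has_derivative frechet_derivative (F s) (at x)) (at x)"
proof -
  obtain F' where "\<And>x s. x \<in> Y \<Longrightarrow> s \<in> S \<Longrightarrow> (F s has_derivative F' s x) (at x)"
    by (rule UC_has_derivative[OF assms(1)]) blast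
  from this[OF assms(2,3)] show ?thesis using frechet_derivative_at by metis
qed

lemma frechet_derivative_cong_open:
  assumes "open Y" "x \<in> Y" "\<And>y. y \<in> Y \<Longrightarrow> f y = g y" "(g has_derivative g') (at x)"
  shows "frechet_derivative f (at x) = g'"
proof -
  have "(f has_derivative g') (at x)"
    by (rule has_derivative_transform_within_open[OF assms(4,1,2)]) (simp add: assms(3))
  then show ?thesis by (metis frechet_derivative_at)
qed

context
  fixes f :: "'a::real_normed_vector \<Rightarrow> real" and Y k
  assumes Y: "open Y" and f: "UC k Y {[]} (\<lambda>_. f)"
begin

lemma iterD_deriv_unit:
  assumes "vs \<in> unit_lists m" "m < k" "x \<in> Y"
  shows "(iterD f vs has_derivative (\<lambda>h. iterD f (h # vs) x)) (at x)"
proof -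
  have "UC (Suc (k - Suc m)) Y (unit_lists m) (iterD f)"
    using iterD_UC[OF Y f, of m] assms(2) by (simp add: Suc_diff_Suc del: UC.simps)
  from UC_differentiable[OF this assms(3,1)] show ?thesis by simp
qed

text \<open>\<open>UC\<close> speaks only of directions in the unit ball. Homogeneity, gained one
  direction at a time, reduces all others to their \<open>sgn\<close>.\<close>

lemma iterD_scale:
  "length vs \<le> k \<Longrightarrow> x \<in> Y \<Longrightarrow> iterD f vs x = prod_list (map norm vs) * iterD f (map sgn vs) x"
proof (induction vs arbitrary: x)
  case Nil
  then show ?case by simp
next
  case (Cons v vs)
  let ?c = "prod_list (map norm vs)" and ?us = "map sgn vs"
  have d: "(iterD f ?us has_derivative (\<lambda>h. iterD f (h # ?us) x)) (at x)"
    using iterD_deriv_unit[OF map_sgn_unit_lists] Cons.prems by auto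
  have "frechet_derivative (iterD f vs) (at x) = (\<lambda>h. ?c * iterD f (h # ?us) x)"
    by (rule frechet_derivative_cong_open[OF Y Cons.prems(2), where g="\<lambda>x. ?c * iterD f ?us x"])
      (use Cons.IH Cons.prems d in \<open>auto intro!: derivative_eq_intros\<close>)
  then have 1: "iterD f (v # vs) x = ?c * iterD f (v # ?us) x" by simp
  have "linear (\<lambda>h. iterD f (h # ?us) x)" using d has_derivative_linear by blast
  from linear_scale[OF this, of "norm v" "sgn v"]
  have "iterD f (v # ?us) x = norm v * iterD f (sgn v # ?us) x"
    by (simp add: norm_scaleR_sgn del: iterD.simps)
  then show ?case using 1 by simp
qed

lemma iterD_deriv:
  assumes "length vs < k" "x \<in> Y"
  shows "(iterD f vs has_derivative (\<lambda>h. iterD f (h # vs) x)) (at x)"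
proof -
  let ?c = "prod_list (map norm vs)" and ?us = "map sgn vs"
  have d: "(iterD f ?us has_derivative (\<lambda>h. iterD f (h # ?us) x)) (at x)"
    using iterD_deriv_unit[OF map_sgn_unit_lists] assms by auto
  then have "((\<lambda>x. ?c * iterD f ?us x) has_derivative (\<lambda>h. ?c * iterD f (h # ?us) x)) (at x)"
    by (auto intro!: derivative_eq_intros)
  then have d2: "(iterD f vs has_derivative (\<lambda>h. ?c * iterD f (h # ?us) x)) (at x)"
    by (rule has_derivative_transform_within_open[OF _ Y assms(2)])
      (simp add: iterD_scale[of vs] assms(1) less_imp_le)
  then have "frechet_derivative (iterD f vs) (at x) = (\<lambda>h. ?c * iterD f (h # ?us) x)"
    by (metis frechet_derivative_at)
  then show ?thesis using d2 by simp
qed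

text \<open>For an innermost new direction this is linearity of a derivative. As an identity between
  functions on the open set \<open>Y\<close> it can be differentiated once more, which carries the
  slot past the next direction.\<close>

lemma iterD_linear:
  "length us + length ws + 1 \<le> k \<Longrightarrow> x \<in> Y \<Longrightarrow> linear (\<lambda>v. iterD f (us @ v # ws) x)"
proof (induction us arbitrary: x)
  case Nil
  then have "(iterD f ws has_derivative (\<lambda>h. iterD f (h # ws) x)) (at x)" by (intro iterD_deriv) auto
  then show ?case using has_derivative_linear by fastforce
next
  case (Cons u us)
  have lin: "linear (\<lambda>v. iterD f (us @ v # ws) y)" if "y \<in> Y" for y using Cons that by auto
  have d: "(iterD f (us @ v # ws) has_derivative (\<lambda>h. iterD f (h # us @ v # ws) x)) (at x)" for v
    using Cons.prems by (intro iterD_deriv) auto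
  show ?case
  proof (rule linearI)
    fix v w :: 'a
    have "frechet_derivative (iterD f (us @ (v + w) # ws)) (at x)
        = (\<lambda>h. iterD f (h # us @ v # ws) x + iterD f (h # us @ w # ws) x)"
      by (rule frechet_derivative_cong_open[OF Y Cons.prems(2), where g="\<lambda>y. iterD f (us @ v # ws) y + iterD f (us @ w # ws) y"])
        (simp add: linear_add[OF lin], intro has_derivative_add d)
    then show "iterD f ((u # us) @ (v + w) # ws) x = iterD f ((u # us) @ v # ws) x + iterD f ((u # us) @ w # ws) x"
      by simp
  next
    fix c :: real and v :: 'a
    have "frechet_derivative (iterD f (us @ (c *\<^sub>R v) # ws)) (at x)
        = (\<lambda>h. c * iterD f (h # us @ v # ws) x)"
      by (rule frechet_derivative_cong_open[OF Y Cons.prems(2), where g="\<lambda>y. c * iterD f (us @ v # ws) y"])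
        (simp add: linear_scale[OF lin], intro has_derivative_mult_right d)
    then show "iterD f ((u # us) @ (c *\<^sub>R v) # ws) x = c *\<^sub>R iterD f ((u # us) @ v # ws) x"
      by simp
  qed
qed

end

lemma multi_onorm_nonneg:
  assumes "bounded_multilinear k A"
  shows "0 \<le> multi_onorm k A"
proof -
  have "norm (A (replicate k 0)) \<le> multi_onorm k A"
    by (rule multi_onorm_upper[OF assms]) (auto simp: in_set_replicate)
  then show ?thesis using norm_ge_zero order_trans by blast
qed

lemma dist_quotient_0_less:
  fixes M n e :: real
  assumes "0 \<le> M" "M \<le> a" "a < e * n" "n > 0"
  shows "dist (M / n) 0 < e"
  using assms by (simp add: dist_real_def divide_less_eq)

text \<open>The witness is \<open>iterD f\<close>. The supremum in \<open>multi_onorm\<close> runs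
  over \<open>unit_lists k\<close>, so estimates uniform on that set are operator norm
  estimates.\<close>

lemma smooth_imp_C_smooth_on:
  assumes "smooth p f Y"
  shows "C_smooth_on p f Y"
  unfolding C_smooth_on_def
proof (intro conjI exI[of _ "\<lambda>k x vs. iterD f vs x"] ballI allI impI)
  show Y: "open Y" using assms by (simp add: smooth_def)
  have U: "UC k Y {[]} (\<lambda>_. f)" if "enat k \<le> p" for k using assms that by (simp add: smooth_def)
  show "iterD f [] x = f x" for x by simp
  fix k x assume x: "x \<in> Y"
  have bm: "bounded_multilinear k (\<lambda>vs. iterD f vs x)" if k: "enat k \<le> p" and x: "x \<in> Y" for k x
    unfolding bounded_multilinear_def
  proof (intro conjI allI impI)
    show "linear (\<lambda>v. iterD f (us @ v # ws) x)" if "length us + length ws + 1 = k" for us ws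
      using iterD_linear[OF Y U[OF k] _ x] that by auto
    have "UC 0 Y (unit_lists k) (iterD f)" using iterD_UC[OF Y U[OF k], of k] by simp
    then obtain M where M: "\<And>vs. vs \<in> unit_lists k \<Longrightarrow> \<bar>iterD f vs x\<bar> \<le> M"
      using x unfolding UC.simps unif_cont_at_def by blast
    have "norm (iterD f vs x) \<le> M * prod_list (map norm vs)" if "length vs = k" for vs
    proof -
      have pos: "0 \<le> prod_list (map norm vs)" by (induction vs) auto
      have "norm (iterD f vs x) = prod_list (map norm vs) * \<bar>iterD f (map sgn vs) x\<bar>"
        using iterD_scale[OF Y U[OF k], of vs x] that x pos by (simp add: abs_mult)
      also have "\<dots> \<le> prod_list (map norm vs) * M"
        using M[of "map sgn vs"] map_sgn_unit_lists[of vs] that pos by (intro mult_left_mono) auto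
      finally show ?thesis by (simp add: mult.commute)
    qed
    then show "\<exists>K. \<forall>vs. length vs = k \<longrightarrow> norm (iterD f vs x) \<le> K * prod_list (map norm vs)" by blast
  qed
  show "bounded_multilinear k (\<lambda>vs. iterD f vs x)" if "enat k \<le> p" using bm that x .
  have evY: "\<forall>\<^sub>F y in at x. y \<in> Y" using Y x by (simp add: eventually_at_in_open')
  show "((\<lambda>y. multi_onorm k (\<lambda>vs. iterD f vs y - iterD f vs x)) \<longlongrightarrow> 0) (at x)" if k: "enat k \<le> p"
    unfolding tendsto_iff
  proof (intro allI impI)
    fix e :: real assume e: "e > 0"
    have "UC 0 Y (unit_lists k) (iterD f)" using iterD_UC[OF Y U[OF k], of k] by simp
    then have u: "unif_cont_at (unit_lists k) (iterD f) x" using x by simp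
    have "\<forall>\<^sub>F y in nhds x. \<forall>s\<in>unit_lists k. \<bar>iterD f s y - iterD f s x\<bar> \<le> e/2"
      using unif_cont_atD[OF u half_gt_zero[OF e]] .
    then have "\<forall>\<^sub>F y in at x. \<forall>s\<in>unit_lists k. \<bar>iterD f s y - iterD f s x\<bar> \<le> e/2"
      by (simp add: eventually_nhds_conv_at)
    with evY show "\<forall>\<^sub>F y in at x. dist (multi_onorm k (\<lambda>vs. iterD f vs y - iterD f vs x)) 0 < e"
    proof eventually_elim
      case (elim y)
      have "multi_onorm k (\<lambda>vs. iterD f vs y - iterD f vs x) \<le> e/2"
        by (rule multi_onorm_least) (use elim(2) in \<open>auto simp: unit_lists_def\<close>)
      moreover have "0 \<le> multi_onorm k (\<lambda>vs. iterD f vs y - iterD f vs x)"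
        by (intro multi_onorm_nonneg bounded_multilinear_diff bm k elim(1) x)
      ultimately show ?case using e by (simp add: dist_real_def)
    qed
  qed
  show "((\<lambda>h. multi_onorm k (\<lambda>vs. iterD f vs (x + h) - iterD f vs x - iterD f (h # vs) x) / norm h) \<longlongrightarrow> 0) (at 0)"
    if k: "enat k < p"
    unfolding tendsto_iff
  proof (intro allI impI)
    fix e :: real assume e: "e > 0"
    have k': "enat (Suc k) \<le> p" "enat k \<le> p" using k by (auto simp: Suc_ile_eq)
    have "UC (Suc 0) Y (unit_lists k) (iterD f)" using iterD_UC[OF Y U[OF k'(1)], of k] by simp
    then obtain F' where F': "\<And>x. x \<in> Y \<Longrightarrow> unif_deriv (unit_lists k) (iterD f) (\<lambda>s. F' s x) x"
      "\<And>x s. x \<in> Y \<Longrightarrow> s \<in> unit_lists k \<Longrightarrow> (iterD f s has_derivative F' s x) (at x)"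
      by (rule UC_has_derivative) blast
    have eq: "F' s x h = iterD f (h # s) x" if "s \<in> unit_lists k" for s h
      using frechet_derivative_at[OF F'(2)[OF x that]] by simp
    have "\<forall>\<^sub>F y in nhds x. \<forall>s\<in>unit_lists k. \<bar>iterD f s y - iterD f s x - F' s x (y - x)\<bar> \<le> e/2 * norm (y - x)"
      using unif_derivD[OF F'(1)[OF x] half_gt_zero[OF e]] .
    moreover have "filterlim (\<lambda>h. x + h) (nhds x) (at 0)"
      by (rule tendsto_eq_intros refl)+ simp
    ultimately have "\<forall>\<^sub>F h in at 0. \<forall>s\<in>unit_lists k. \<bar>iterD f s (x + h) - iterD f s x - F' s x ((x + h) - x)\<bar> \<le> e/2 * norm ((x + h) - x)"
      unfolding filterlim_iff by blast
    moreover have "\<forall>\<^sub>F h in at 0. x + h \<in> Y" using Y x by (rule eventually_at_0_add)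
    moreover have "\<forall>\<^sub>F h in at (0::'a). h \<noteq> 0" by (simp add: eventually_at_filter)
    ultimately show "\<forall>\<^sub>F h in at 0. dist (multi_onorm k (\<lambda>vs. iterD f vs (x + h) - iterD f vs x - iterD f (h # vs) x) / norm h) 0 < e"
    proof eventually_elim
      case (elim h)
      have "multi_onorm k (\<lambda>vs. iterD f vs (x + h) - iterD f vs x - iterD f (h # vs) x) \<le> e/2 * norm h"
      proof (rule multi_onorm_least)
        fix vs :: "'a list" assume "length vs = k" "\<forall>v\<in>set vs. norm v \<le> 1"
        then have vs: "vs \<in> unit_lists k" by (simp add: unit_lists_def)
        show "norm (iterD f vs (x + h) - iterD f vs x - iterD f (h # vs) x) \<le> e/2 * norm h"
          using elim(1) vs eq[OF vs] by fastforce
      qed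
      moreover have "0 \<le> multi_onorm k (\<lambda>vs. iterD f vs (x + h) - iterD f vs x - iterD f (h # vs) x)"
        by (intro multi_onorm_nonneg bounded_multilinear_diff bm k' elim(2) x bounded_multilinear_Cons)
      moreover have "e/2 * norm h < e * norm h" using elim(3) e by simp
      moreover have "norm h > 0" using elim(3) by simp
      ultimately show ?case by (intro dist_quotient_0_less[where a="e/2 * norm h"])
    qed
  qed
qed

text \<open>Each \<open>D m\<close> is read as a family of real functions indexed by
  \<open>unit_lists m\<close>; the induction is on the number \<open>j\<close> of derivatives still
  to be taken.\<close>

lemma C_smooth_on_imp_smooth:
  assumes "C_smooth_on p f Y"
  shows "smooth p f Y"
proof -
  obtain D where Y: "open Y" and D0: "\<And>x. x \<in> Y \<Longrightarrow> D 0 x [] = f x"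
      and bm: "\<And>k x. enat k \<le> p \<Longrightarrow> x \<in> Y \<Longrightarrow> bounded_multilinear k (D k x)"
      and co: "\<And>k x. enat k \<le> p \<Longrightarrow> x \<in> Y \<Longrightarrow>
        ((\<lambda>y. multi_onorm k (\<lambda>vs. D k y vs - D k x vs)) \<longlongrightarrow> 0) (at x)"
      and de: "\<And>k x. enat k < p \<Longrightarrow> x \<in> Y \<Longrightarrow>
        ((\<lambda>h. multi_onorm k (\<lambda>vs. D k (x + h) vs - D k x vs - D (Suc k) x (h # vs)) / norm h) \<longlongrightarrow> 0) (at 0)"
    using assms unfolding C_smooth_on_def by blast
  have bd: "\<exists>M. \<forall>s\<in>unit_lists m. \<bar>D m x s\<bar> \<le> M" if "enat m \<le> p" "x \<in> Y" for m x
    using multi_onorm_upper[OF bm[OF that]] by (intro exI[of _ "multi_onorm m (D m x)"]) (auto simp: unit_lists_def)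
  have "UC j Y (unit_lists m) (\<lambda>vs x. D m x vs)" if "enat (m + j) \<le> p" for j m
    using that
  proof (induction j arbitrary: m)
    case 0
    have "unif_cont_at (unit_lists m) (\<lambda>vs x. D m x vs) x" if x: "x \<in> Y" for x
      unfolding unif_cont_at_def
    proof (intro conjI allI impI)
      show "\<exists>M. \<forall>s\<in>unit_lists m. \<bar>D m x s\<bar> \<le> M" using bd 0 x by simp
      fix e :: real assume e: "e > 0"
      have "\<forall>\<^sub>F y in at x. dist (multi_onorm m (\<lambda>vs. D m y vs - D m x vs)) 0 < e"
        using tendstoD[OF co e] 0 x by simp
      moreover have "\<forall>\<^sub>F y in at x. y \<in> Y" using Y x by (simp add: eventually_at_in_open')
      ultimately have "\<forall>\<^sub>F y in at x. \<forall>s\<in>unit_lists m. \<bar>D m y s - D m x s\<bar> \<le> e"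
      proof eventually_elim
        case (elim y)
        have b: "bounded_multilinear m (\<lambda>vs. D m y vs - D m x vs)"
          using 0 by (intro bounded_multilinear_diff bm elim(2) x) auto
        show ?case using multi_onorm_upper[OF b] elim(1) by (fastforce simp: unit_lists_def)
      qed
      then show "\<forall>\<^sub>F y in nhds x. \<forall>s\<in>unit_lists m. \<bar>D m y s - D m x s\<bar> \<le> e"
        using e by (simp add: eventually_nhds_conv_at)
    qed
    then show ?case by simp
  next
    case (Suc j)
    have m: "enat m < p" "enat (Suc m) \<le> p" "enat m \<le> p"
      using Suc.prems by (auto intro: order_less_le_trans[OF _ Suc.prems] order_trans[OF _ Suc.prems])
    show ?case
    proof (rule UC_SucI[where F'="\<lambda>vs x h. D (Suc m) x (h # vs)"])
      have "UC j Y (unit_lists (Suc m)) (\<lambda>vs x. D (Suc m) x vs)" using Suc by simp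
      then show "UC j Y (Scons (unit_lists m)) (\<lambda>l x. D (Suc m) x (hd l # tl l))"
        unfolding unit_lists_Suc by (rule UC_cong[OF _ Y]) (auto simp: Scons_def)
    next
      fix x assume x: "x \<in> Y"
      show "unif_deriv (unit_lists m) (\<lambda>vs x. D m x vs) (\<lambda>vs h. D (Suc m) x (h # vs)) x"
        unfolding unif_deriv_def
      proof (intro conjI allI impI ballI)
        show "\<exists>M. \<forall>s\<in>unit_lists m. \<bar>D m x s\<bar> \<le> M" using bd m x by simp
        show lin: "linear (\<lambda>h. D (Suc m) x (h # vs))" if "vs \<in> unit_lists m" for vs
        proof -
          have "length ([]::'a list) + length vs + 1 = Suc m" using that by (simp add: unit_lists_def)
          then have "linear (\<lambda>v. D (Suc m) x ([] @ v # vs))"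
            using bm[OF m(2) x] unfolding bounded_multilinear_def by blast
          then show ?thesis by simp
        qed
        obtain M where M: "\<And>s. s \<in> unit_lists (Suc m) \<Longrightarrow> \<bar>D (Suc m) x s\<bar> \<le> M" using bd m x by blast
        have "\<bar>D (Suc m) x (h # s)\<bar> \<le> M * norm h" if "s \<in> unit_lists m" for s h
        proof -
          have "h = norm h *\<^sub>R sgn h" by (simp add: norm_scaleR_sgn)
          then have "D (Suc m) x (h # s) = norm h * D (Suc m) x (sgn h # s)"
            using linear_scale[OF lin[OF that], of "norm h" "sgn h"] by (simp add: norm_scaleR_sgn)
          moreover have "\<bar>D (Suc m) x (sgn h # s)\<bar> \<le> M"
            using that by (intro M) (auto simp: unit_lists_Suc Scons_iff norm_sgn)
          ultimately show ?thesis using mult_left_mono[of _ M "norm h"] by (simp add: abs_mult mult.commute[of M])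
        qed
        then show "\<exists>M. \<forall>s\<in>unit_lists m. \<forall>h. \<bar>D (Suc m) x (h # s)\<bar> \<le> M * norm h" by blast
        fix e :: real assume e: "e > 0"
        have "\<forall>\<^sub>F h in at 0. dist (multi_onorm m (\<lambda>vs. D m (x + h) vs - D m x vs - D (Suc m) x (h # vs)) / norm h) 0 < e"
          using tendstoD[OF de[OF m(1) x] e] .
        moreover have "\<forall>\<^sub>F h in at 0. x + h \<in> Y" using Y x by (rule eventually_at_0_add)
        moreover have "\<forall>\<^sub>F h in at (0::'a). h \<noteq> 0" by (simp add: eventually_at_filter)
        ultimately have "\<forall>\<^sub>F h in at 0. \<forall>s\<in>unit_lists m. \<bar>D m (x + h) s - D m x s - D (Suc m) x (h # s)\<bar> \<le> e * norm h"
        proof eventually_elim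
          case (elim h)
          have b: "bounded_multilinear m (\<lambda>vs. D m (x + h) vs - D m x vs - D (Suc m) x (h # vs))"
            by (intro bounded_multilinear_diff bm bounded_multilinear_Cons elim(2) x m)
          have "multi_onorm m (\<lambda>vs. D m (x + h) vs - D m x vs - D (Suc m) x (h # vs)) \<le> e * norm h"
            using elim(1,3) by (simp add: dist_real_def field_simps abs_less_iff)
          then show ?case using multi_onorm_upper[OF b] by (fastforce simp: unit_lists_def)
        qed
        then have "\<forall>\<^sub>F h in nhds 0. \<forall>s\<in>unit_lists m. \<bar>D m (x + h) s - D m x s - D (Suc m) x (h # s)\<bar> \<le> e * norm h"
        \<comment> \<open>The limit in \<open>C_smooth_on\<close> excludes \<open>h = 0\<close>;
          there the estimate holds because the linear term vanishes.\<close>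
        proof (simp add: eventually_nhds_conv_at, intro ballI)
          show "D (Suc m) x (0 # s) = 0" if "s \<in> unit_lists m" for s using linear_0[OF lin[OF that]] .
        qed
        moreover have "filterlim (\<lambda>y. y - x) (nhds 0) (nhds x)"
          by (rule tendsto_eq_intros filterlim_ident refl)+ simp
        ultimately have "\<forall>\<^sub>F y in nhds x. \<forall>s\<in>unit_lists m. \<bar>D m (x + (y - x)) s - D m x s - D (Suc m) x ((y - x) # s)\<bar> \<le> e * norm (y - x)"
          unfolding filterlim_iff by blast
        then show "\<forall>\<^sub>F y in nhds x. \<forall>s\<in>unit_lists m. \<bar>D m y s - D m x s - D (Suc m) x ((y - x) # s)\<bar> \<le> e * norm (y - x)"
          by simp
      qed
    qed
  qed
  from this[of 0] have 1: "UC k Y {[]} (\<lambda>vs x. D 0 x vs)" if "enat k \<le> p" for k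
    using that by (simp add: unit_lists_0)
  have "UC k Y {[]} (\<lambda>_. f)" if "enat k \<le> p" for k
    by (rule UC_cong[OF 1[OF that] Y]) (simp add: D0)
  then show ?thesis using Y by (simp add: smooth_def)
qed

section \<open>Closure properties of smooth real functions\<close>

lemma smooth_open: "smooth p f Y \<Longrightarrow> open Y"
  by (simp add: smooth_def)

lemma smooth_const: "open Y \<Longrightarrow> smooth p (\<lambda>_. c) Y"
  unfolding smooth_def using UC_const[of _ "\<lambda>_. c" "\<bar>c\<bar>"] by blast

lemma smooth_add: "smooth p f Y \<Longrightarrow> smooth p g Y \<Longrightarrow> smooth p (\<lambda>x. f x + g x) Y"
  unfolding smooth_def using UC_add[of _ Y "{[]}" "\<lambda>_. f" "\<lambda>_. g"] by blast

lemma smooth_mult: "smooth p f Y \<Longrightarrow> smooth p g Y \<Longrightarrow> smooth p (\<lambda>x. f x * g x) Y"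
  unfolding smooth_def using UC_mult[of _ Y "{[]}" "\<lambda>_. f" "\<lambda>_. g"] by blast

lemma smooth_diff: "smooth p f Y \<Longrightarrow> smooth p g Y \<Longrightarrow> smooth p (\<lambda>x. f x - g x) Y"
  using smooth_add[of p f Y "\<lambda>x. (-1) * g x"] smooth_mult[OF smooth_const[of Y p "-1"], of g]
  by (simp add: smooth_open)

lemma smooth_linear: "bounded_linear \<phi> \<Longrightarrow> open Y \<Longrightarrow> smooth p \<phi> Y"
  unfolding smooth_def using UC_linear by blast

lemma smooth_cong: "smooth p f Y \<Longrightarrow> (\<And>x. x \<in> Y \<Longrightarrow> f x = g x) \<Longrightarrow> smooth p g Y"
  unfolding smooth_def by (auto intro: UC_cong)

lemma smooth_subset: "smooth p f Y \<Longrightarrow> open Z \<Longrightarrow> Z \<subseteq> Y \<Longrightarrow> smooth p f Z"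
  unfolding smooth_def using UC_subset by blast

lemma smooth_local:
  assumes "\<And>x. x \<in> Y \<Longrightarrow> \<exists>T. x \<in> T \<and> T \<subseteq> Y \<and> smooth p f T"
  shows "smooth p f Y"
proof -
  have "open Y" using assms by (meson openI openE open_subopen smooth_open)
  moreover have "UC k Y {[]} (\<lambda>_. f)" if "enat k \<le> p" for k
  proof (rule UC_local)
    fix x assume "x \<in> Y"
    then obtain T where "x \<in> T" "T \<subseteq> Y" "smooth p f T" using assms by blast
    then have "open T \<and> x \<in> T \<and> UC k T {[]} (\<lambda>_. f)" using that unfolding smooth_def by blast
    then show "\<exists>T. open T \<and> x \<in> T \<and> UC k T {[]} (\<lambda>_. f)" by blast
  qed
  ultimately show ?thesis unfolding smooth_def by blast
qed

lemma smooth_sum: "finite I \<Longrightarrow> open Y \<Longrightarrow> (\<And>i. i \<in> I \<Longrightarrow> smooth p (f i) Y) \<Longrightarrow> smooth p (\<lambda>x. \<Sum>i\<in>I. f i x) Y"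
  by (induction I rule: finite_induct) (auto intro: smooth_const smooth_add)

lemma smooth_prod: "finite I \<Longrightarrow> open Y \<Longrightarrow> (\<And>i. i \<in> I \<Longrightarrow> smooth p (f i) Y) \<Longrightarrow> smooth p (\<lambda>x. \<Prod>i\<in>I. f i x) Y"
  by (induction I rule: finite_induct) (auto intro: smooth_const smooth_mult)

lemma smooth_scalar:
  assumes "open I" "\<And>n t. t \<in> I \<Longrightarrow> ((\<xi> n) has_real_derivative \<xi> (Suc n) t) (at t)"
    and "smooth p f Y" "\<And>x. x \<in> Y \<Longrightarrow> f x \<in> I"
  shows "smooth p (\<lambda>x. \<xi> n (f x)) Y"
  unfolding smooth_def
proof (intro conjI allI impI)
  show "open Y" using assms(3) by (rule smooth_open)
  fix k assume "enat k \<le> p"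
  then have U: "UC k Y {[]} (\<lambda>_. f)" using assms(3) unfolding smooth_def by blast
  show "UC k Y {[]} (\<lambda>_ x. \<xi> n (f x))"
    by (rule UC_scalar[where \<xi>=\<xi> and f=f and n=n and I=I, OF assms(1,2) U assms(4)])
qed

lemma smooth_shear:
  fixes L :: "'a::real_normed_vector \<Rightarrow> 'a"
  assumes "smooth p F T" "smooth p a Y" "bounded_linear L"
    and "\<And>x. x \<in> Y \<Longrightarrow> L x + b + a x *\<^sub>R d \<in> T"
  shows "smooth p (\<lambda>x. F (L x + b + a x *\<^sub>R d)) Y"
  using assms(1,2) UC_shear[OF _ _ assms(3) _ assms(4)] unfolding smooth_def by blast

lemma smooth_affine:
  fixes L :: "'a::real_normed_vector \<Rightarrow> 'a"
  assumes "smooth p F T" "bounded_linear L" "open Y" "\<And>x. x \<in> Y \<Longrightarrow> L x + b \<in> T"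
  shows "smooth p (\<lambda>x. F (L x + b)) Y"
  using smooth_shear[OF assms(1) smooth_const[OF assms(3), of p 0] assms(2), of b 0] assms(4) by simp

lemma smooth_inverse:
  assumes "smooth p f Y" "\<And>x. x \<in> Y \<Longrightarrow> f x \<noteq> 0"
  shows "smooth p (\<lambda>x. 1 / f x) Y"
proof -
  define \<xi> :: "nat \<Rightarrow> real \<Rightarrow> real" where "\<xi> = (\<lambda>n t. (-1) ^ n * fact n * inverse t ^ Suc n)"
  have d: "((\<xi> n) has_real_derivative \<xi> (Suc n) t) (at t)" if "t \<in> - {0}" for n t
  proof -
    have "((\<lambda>t. inverse t ^ Suc n) has_real_derivative (1 + real n) * (- (inverse t ^ Suc (Suc 0)) * inverse t ^ n)) (at t)"
      using DERIV_power_Suc[OF DERIV_inverse, of t n] that by simp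
    from DERIV_cmult[OF this, of "(-1) ^ n * fact n"] show ?thesis
      unfolding \<xi>_def by (simp add: algebra_simps)
  qed
  have "smooth p (\<lambda>x. \<xi> 0 (f x)) Y"
    by (rule smooth_scalar[of "- {0}" \<xi>, OF _ d assms(1)]) (simp_all add: assms(2) open_Compl)
  then show ?thesis by (simp add: \<xi>_def inverse_eq_divide)
qed

lemma smooth_divide:
  assumes "smooth p f Y" "smooth p g Y" "\<And>x. x \<in> Y \<Longrightarrow> g x \<noteq> 0"
  shows "smooth p (\<lambda>x. f x / g x) Y"
  using smooth_mult[OF assms(1) smooth_inverse[OF assms(2,3)]] by simp

lemma smooth_isCont:
  assumes "smooth p f Y" "x \<in> Y"
  shows "isCont f x"
proof -
  have "UC 0 Y {[]} (\<lambda>_. f)" using assms by (simp add: smooth_def zero_enat_def[symmetric] del: UC.simps)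
  then have u: "unif_cont_at {[]::'a list} (\<lambda>_. f) x" using assms(2) by simp
  show ?thesis unfolding isCont_def tendsto_iff
  proof (intro allI impI)
    fix e :: real assume e: "e > 0"
    have "\<forall>\<^sub>F y in nhds x. \<bar>f y - f x\<bar> \<le> e/2" using unif_cont_atD[OF u, of "e/2"] e by simp
    then have "\<forall>\<^sub>F y in nhds x. dist (f y) (f x) < e"
      by eventually_elim (use e in \<open>auto simp: dist_real_def\<close>)
    then show "\<forall>\<^sub>F y in at x. dist (f y) (f x) < e"
      by (simp add: eventually_nhds_conv_at)
  qed
qed

lemma smooth_continuous_on: "smooth p f Y \<Longrightarrow> continuous_on Y f"
  using smooth_isCont continuous_at_imp_continuous_on by blast

lemma smooth_derivative:
  assumes "smooth p f Y" "1 \<le> p" "x \<in> Y"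
  shows "(f has_derivative frechet_derivative f (at x)) (at x)"
    and "e > 0 \<Longrightarrow> \<forall>\<^sub>F y in nhds x. \<forall>h. \<bar>frechet_derivative f (at y) h - frechet_derivative f (at x) h\<bar> \<le> e * norm h"
proof -
  have Y: "open Y" using assms by (simp add: smooth_def)
  have U: "UC (Suc 0) Y {[]} (\<lambda>_. f)" using assms by (simp add: smooth_def one_enat_def del: UC.simps)
  show d: "(f has_derivative frechet_derivative f (at x)) (at x)"
    using UC_differentiable[OF U assms(3)] by simp
  have dY: "(f has_derivative frechet_derivative f (at y)) (at y)" if "y \<in> Y" for y
    using UC_differentiable[OF U that] by simp
  have "UC 0 Y (unit_lists 1) (iterD f)" using iterD_UC[OF Y U, of 1] by simp
  then have u: "unif_cont_at (unit_lists 1) (iterD f) x" using assms(3) by simp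
  assume e: "e > 0"
  have "\<forall>\<^sub>F y in nhds x. y \<in> Y" using Y assms(3) by (auto simp: eventually_nhds)
  with unif_cont_atD[OF u e]
  show "\<forall>\<^sub>F y in nhds x. \<forall>h. \<bar>frechet_derivative f (at y) h - frechet_derivative f (at x) h\<bar> \<le> e * norm h"
  proof eventually_elim
    case (elim y)
    show ?case
    proof
      fix h :: 'a
      let ?A = "frechet_derivative f (at y)" and ?B = "frechet_derivative f (at x)"
      have "[sgn h] \<in> unit_lists 1" by (simp add: unit_lists_def norm_sgn)
      then have "\<bar>?A (sgn h) - ?B (sgn h)\<bar> \<le> e" using elim(1) by force
      then have "norm h * \<bar>?A (sgn h) - ?B (sgn h)\<bar> \<le> norm h * e" by (intro mult_left_mono) auto
      moreover have "norm h * \<bar>?A (sgn h) - ?B (sgn h)\<bar> = \<bar>norm h * ?A (sgn h) - norm h * ?B (sgn h)\<bar>"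
        by (simp add: abs_mult right_diff_distrib[symmetric])
      moreover have "norm h * ?A (sgn h) = ?A h" "norm h * ?B (sgn h) = ?B h"
        using linear_scale[OF has_derivative_linear[OF dY[OF elim(2)]], of "norm h" "sgn h"]
          linear_scale[OF has_derivative_linear[OF d], of "norm h" "sgn h"] by (simp_all add: norm_scaleR_sgn)
      ultimately show "\<bar>?A h - ?B h\<bar> \<le> e * norm h" by (simp add: mult.commute)
    qed
  qed
qed

section \<open>Cutoff functions\<close>

text \<open>All derivatives of \<open>exp (-1/t)\<close> have the form \<open>q(1/t) exp (-1/t)\<close> with a polynomial \<open>q\<close>.\<close>

definition flat :: "real poly \<Rightarrow> real \<Rightarrow> real" where
  "flat q t = (if t > 0 then poly q (1 / t) * exp (- (1 / t)) else 0)"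

lemma flat_tendsto_0: "(flat q \<longlongrightarrow> 0) (at 0)"
proof -
  have "((\<lambda>u. poly q u * exp (- u)) \<longlongrightarrow> 0) at_top"
  proof -
    have "((\<lambda>u. \<Sum>i\<le>degree q. coeff q i * (u ^ i / exp u)) \<longlongrightarrow> (\<Sum>i\<le>degree q. coeff q i * 0)) at_top"
      by (intro tendsto_sum tendsto_mult tendsto_const tendsto_power_div_exp_0)
    moreover have "(\<Sum>i\<le>degree q. coeff q i * (u ^ i / exp u)) = poly q u * exp (- u)" for u
      by (simp add: poly_altdef sum_distrib_right exp_minus divide_inverse mult.assoc)
    ultimately show ?thesis by simp
  qed
  moreover have "filterlim (\<lambda>t::real. 1 / t) at_top (at_right 0)"
    using filterlim_inverse_at_top_right by (simp add: inverse_eq_divide)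
  ultimately have "((\<lambda>t. poly q (1 / t) * exp (- (1 / t))) \<longlongrightarrow> 0) (at_right 0)"
    by (rule filterlim_compose)
  then have 1: "(flat q \<longlongrightarrow> 0) (at_right 0)"
    by (rule Lim_transform_eventually) (auto simp: flat_def eventually_at_filter)
  have 2: "(flat q \<longlongrightarrow> 0) (at_left 0)"
    by (rule Lim_transform_eventually[of "\<lambda>_. 0"]) (auto simp: flat_def eventually_at_filter)
  show ?thesis using 1 2 by (simp add: filterlim_split_at)
qed

text \<open>The polynomial \<open>[:0, 0, 1:]\<close> is the factor 1/t^2 from the inner derivative.
  At 0 the difference quotient of \<open>flat q\<close> is itself flat, with polynomial
  \<open>[:0, 1:] * q\<close>, and so tends to 0.\<close>

lemma flat_deriv: "(flat q has_real_derivative flat ([:0, 0, 1:] * (q - pderiv q)) t) (at t)"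
proof -
  consider "t > 0" | "t < 0" | "t = 0" by linarith
  then show ?thesis
  proof cases
    case 1
    have "((\<lambda>t. poly q (1 / t) * exp (- (1 / t))) has_real_derivative
        poly (pderiv q) (1 / t) * (- 1 / t^2) * exp (- (1 / t)) + exp (- (1 / t)) * (1 / t^2) * poly q (1 / t)) (at t)"
      using 1 by (auto intro!: derivative_eq_intros DERIV_chain2[OF poly_DERIV] simp: field_simps power2_eq_square)
    moreover have "poly (pderiv q) (1 / t) * (- 1 / t^2) * exp (- (1 / t)) + exp (- (1 / t)) * (1 / t^2) * poly q (1 / t)
        = flat ([:0, 0, 1:] * (q - pderiv q)) t"
      using 1 by (simp add: flat_def field_simps power2_eq_square)
    ultimately have "((\<lambda>t. poly q (1 / t) * exp (- (1 / t))) has_real_derivative flat ([:0, 0, 1:] * (q - pderiv q)) t) (at t)"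
      by simp
    then show ?thesis
      by (rule has_field_derivative_transform_within_open[of _ _ _ "{0<..}"]) (use 1 in \<open>auto simp: flat_def\<close>)
  next
    case 2
    have "((\<lambda>_. 0) has_real_derivative flat ([:0, 0, 1:] * (q - pderiv q)) t) (at t)"
      using 2 by (simp add: flat_def)
    then show ?thesis
      by (rule has_field_derivative_transform_within_open[of _ _ _ "{..<0}"]) (use 2 in \<open>auto simp: flat_def\<close>)
  next
    case 3
    have "((\<lambda>h. (flat q (0 + h) - flat q 0) / h) \<longlongrightarrow> 0) (at 0)"
      by (rule Lim_transform_eventually[OF flat_tendsto_0[of "[:0, 1:] * q"]])
        (auto simp: flat_def eventually_at_filter)
    moreover have "flat r 0 = 0" for r by (simp add: flat_def)
    ultimately show ?thesis unfolding 3 DERIV_def by simp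
  qed
qed

primrec flat_poly :: "nat \<Rightarrow> real poly" where
  "flat_poly 0 = 1"
| "flat_poly (Suc n) = [:0, 0, 1:] * (flat_poly n - pderiv (flat_poly n))"

lemma smooth_flat: "smooth p f Y \<Longrightarrow> smooth p (\<lambda>x. flat 1 (f x)) Y"
proof -
  assume f: "smooth p f Y"
  have d: "((flat (flat_poly n)) has_real_derivative flat (flat_poly (Suc n)) t) (at t)" for n t
    using flat_deriv by simp
  have "smooth p (\<lambda>x. flat (flat_poly 0) (f x)) Y"
    by (rule smooth_scalar[of UNIV "\<lambda>n. flat (flat_poly n)", OF _ d f]) simp_all
  then show ?thesis by simp
qed

definition step :: "real \<Rightarrow> real" where
  "step t = flat 1 t / (flat 1 t + flat 1 (1 - t))"

lemma flat_1: "flat 1 t \<ge> 0" "flat 1 t > 0 \<longleftrightarrow> t > 0"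
  by (auto simp: flat_def)

lemma step_denom_pos: "flat 1 t + flat 1 (1 - t) > 0"
  using flat_1[of t] flat_1[of "1 - t"] by (cases "t > 0") (auto simp: add_pos_nonneg add_nonneg_pos)

lemma step_bounds: "0 \<le> step t" "step t \<le> 1"
  using step_denom_pos[of t] flat_1[of t] flat_1[of "1 - t"] by (auto simp: step_def)

lemma step_eq_0: "t \<le> 0 \<Longrightarrow> step t = 0"
  by (simp add: step_def flat_def)

lemma step_eq_1: "t \<ge> 1 \<Longrightarrow> step t = 1"
  using step_denom_pos[of t] by (simp add: step_def flat_def)

lemma smooth_step: "smooth p f Y \<Longrightarrow> smooth p (\<lambda>x. step (f x)) Y"
  unfolding step_def
  by (intro smooth_divide smooth_add smooth_flat smooth_diff smooth_const)
    (auto dest: smooth_open simp: step_denom_pos less_imp_neq[symmetric])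

lemma step_Lipschitz: obtains C where "C > 0" "\<And>s t. \<bar>step s - step t\<bar> \<le> C * \<bar>s - t\<bar>"
proof -
  let ?f = "flat 1" and ?f' = "flat ([:0, 0, 1:] * (1 - pderiv 1))"
  define D where "D = (\<lambda>t. (?f' t * (?f t + ?f (1 - t)) - ?f t * (?f' t - ?f' (1 - t))) / (?f t + ?f (1 - t))^2)"
  have cf: "continuous_on UNIV (flat q)" for q
    using flat_deriv DERIV_isCont continuous_at_imp_continuous_on by blast
  have d: "(step has_real_derivative D t) (at t)" for t
  proof -
    have 1: "(?f has_real_derivative ?f' t) (at t)" by (rule flat_deriv)
    have 2: "((\<lambda>t. ?f (1 - t)) has_real_derivative - ?f' (1 - t)) (at t)"
    proof -
      have "((\<lambda>t::real. 1 - t) has_real_derivative -1) (at t)"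
        by (auto intro!: derivative_eq_intros)
      from DERIV_chain2[where f="?f" and g="\<lambda>t. 1 - t", OF flat_deriv[of 1 "1 - t"] this]
      show ?thesis by simp
    qed
    have "((\<lambda>t. ?f t / (?f t + ?f (1 - t))) has_real_derivative D t) (at t)"
      using DERIV_divide[OF 1 DERIV_add[OF 1 2]] step_denom_pos[of t]
      unfolding D_def by (simp add: power2_eq_square)
    then show ?thesis by (simp add: step_def[abs_def])
  qed
  have "continuous_on {0..1} D"
    unfolding D_def
    by (intro continuous_intros continuous_on_subset[OF cf] continuous_on_compose2[OF cf])
      (use step_denom_pos in \<open>auto simp: less_imp_neq[symmetric]\<close>)
  then have "bounded (D ` {0..1})" by (intro compact_imp_bounded compact_continuous_image) auto
  then obtain B where B: "B > 0" "\<And>t. t \<in> {0..1} \<Longrightarrow> norm (D t) \<le> B"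
    unfolding bounded_pos by auto
  have L: "\<bar>step s - step t\<bar> \<le> B * \<bar>s - t\<bar>" if "s \<in> {0..1}" "t \<in> {0..1}" for s t
  proof -
    have "norm (step s - step t) \<le> B * norm (s - t)"
      by (rule field_differentiable_bound[of "{0..1}" step D])
        (use d B that in \<open>auto intro: has_field_derivative_at_within\<close>)
    then show ?thesis by simp
  qed
  \<comment> \<open>\<open>step\<close> is constant on each side of the unit interval, so the bound
    obtained on the interval extends through the 1-Lipschitz retraction \<open>cl\<close>.\<close>
  define cl where "cl = (\<lambda>t::real. max 0 (min 1 t))"
  have cl: "step t = step (cl t)" for t
    using step_eq_0[of t] step_eq_1[of t] step_eq_0[of 0] step_eq_1[of 1] unfolding cl_def
    by (cases "t \<le> 0"; cases "t \<ge> 1") (auto simp: max_def min_def)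
  have "\<bar>step s - step t\<bar> \<le> B * \<bar>s - t\<bar>" for s t
  proof -
    have "\<bar>step s - step t\<bar> \<le> B * \<bar>cl s - cl t\<bar>"
      unfolding cl[of s] cl[of t] by (rule L) (auto simp: cl_def)
    also have "\<dots> \<le> B * \<bar>s - t\<bar>" using B(1) by (intro mult_left_mono) (auto simp: cl_def)
    finally show ?thesis .
  qed
  then show ?thesis using that B(1) by blast
qed

section \<open>Smooth maps with surjective derivative\<close>

text \<open>Smoothness of a map of the space into itself is expressed by composition with real functions.\<close>

definition submersive :: "enat \<Rightarrow> ('a::real_normed_vector \<Rightarrow> 'a) \<Rightarrow> 'a set \<Rightarrow> bool" where
  "submersive p u Y \<longleftrightarrow> open Y \<and>
     (\<forall>f T. smooth p f T \<longrightarrow> smooth p (\<lambda>x. f (u x)) (Y \<inter> u -` T)) \<and>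
     (\<forall>x\<in>Y. \<exists>u'. (u has_derivative u') (at x) \<and> surj u')"

lemma submersive_id: "open Y \<Longrightarrow> submersive p (\<lambda>x. x) Y"
  unfolding submersive_def
  by (auto intro!: exI[of _ "\<lambda>x. x"] has_derivative_ident intro: smooth_subset simp: smooth_open open_Int surj_def)

lemma submersive_compose:
  assumes u: "submersive p u Y" and v: "submersive p v Z" and Z: "u ` Y \<subseteq> Z"
  shows "submersive p (\<lambda>x. v (u x)) Y"
  unfolding submersive_def
proof (intro conjI allI impI ballI)
  show "open Y" using u by (simp add: submersive_def)
  show "smooth p (\<lambda>x. f (v (u x))) (Y \<inter> (\<lambda>x. v (u x)) -` T)" if f: "smooth p f T" for f :: "'a \<Rightarrow> real" and T
  proof -
    have "smooth p (\<lambda>x. f (v x)) (Z \<inter> v -` T)" using v f unfolding submersive_def by blast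
    then have "smooth p (\<lambda>x. f (v (u x))) (Y \<inter> u -` (Z \<inter> v -` T))" using u unfolding submersive_def by blast
    moreover have "Y \<inter> u -` (Z \<inter> v -` T) = Y \<inter> (\<lambda>x. v (u x)) -` T" using Z by auto
    ultimately show ?thesis by simp
  qed
  fix x assume x: "x \<in> Y"
  obtain u' where u': "(u has_derivative u') (at x)" "surj u'" using u x unfolding submersive_def by blast
  obtain v' where v': "(v has_derivative v') (at (u x))" "surj v'" using v x Z unfolding submersive_def by blast
  have "((\<lambda>x. v (u x)) has_derivative (\<lambda>h. v' (u' h))) (at x)" using has_derivative_compose[OF u'(1) v'(1)] .
  moreover have "surj (\<lambda>h. v' (u' h))" using comp_surj[OF u'(2) v'(2)] by (simp add: o_def)
  ultimately show "\<exists>w. ((\<lambda>x. v (u x)) has_derivative w) (at x) \<and> surj w" by blast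
qed

lemma submersive_local:
  assumes Y: "open Y" and loc: "\<And>x. x \<in> Y \<Longrightarrow> \<exists>T v Z. open T \<and> x \<in> T \<and> T \<subseteq> Y \<and> T \<subseteq> Z \<and> submersive p v Z \<and> (\<forall>y\<in>T. u y = v y)"
  shows "submersive p u Y"
  unfolding submersive_def
proof (intro conjI allI impI ballI Y)
  fix f :: "'a \<Rightarrow> real" and S assume f: "smooth p f S"
  show "smooth p (\<lambda>x. f (u x)) (Y \<inter> u -` S)"
  proof (rule smooth_local)
    fix x assume x: "x \<in> Y \<inter> u -` S"
    then have "x \<in> Y" by simp
    from loc[OF this] obtain T v Z where T: "open T" "x \<in> T" "T \<subseteq> Y" "T \<subseteq> Z" "submersive p v Z" "\<forall>y\<in>T. u y = v y"
      by (elim exE conjE)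
    have 1: "smooth p (\<lambda>x. f (v x)) (Z \<inter> v -` S)" using T(5) f unfolding submersive_def by blast
    have "open (T \<inter> (Z \<inter> v -` S))" by (rule open_Int[OF T(1) smooth_open[OF 1]])
    then have "smooth p (\<lambda>x. f (v x)) (T \<inter> (Z \<inter> v -` S))" by (rule smooth_subset[OF 1]) auto
    then have "smooth p (\<lambda>x. f (u x)) (T \<inter> (Z \<inter> v -` S))" by (rule smooth_cong) (use T(6) in auto)
    then show "\<exists>W. x \<in> W \<and> W \<subseteq> Y \<inter> u -` S \<and> smooth p (\<lambda>x. f (u x)) W"
      using T x by (intro exI[of _ "T \<inter> (Z \<inter> v -` S)"]) auto
  qed
next
  fix x assume x: "x \<in> Y"
  from loc[OF this] obtain T v Z where T: "open T" "x \<in> T" "T \<subseteq> Y" "T \<subseteq> Z" "submersive p v Z" "\<forall>y\<in>T. u y = v y"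
    by (elim exE conjE)
  then obtain v' where v': "(v has_derivative v') (at x)" "surj v'" unfolding submersive_def by blast
  have "(u has_derivative v') (at x)"
    by (rule has_derivative_transform_within_open[OF v'(1) T(1,2)]) (use T(6) in auto)
  then show "\<exists>u'. (u has_derivative u') (at x) \<and> surj u'" using v'(2) by blast
qed

lemma submersive_isCont: "submersive p u Y \<Longrightarrow> x \<in> Y \<Longrightarrow> isCont u x"
  unfolding submersive_def by (meson has_derivative_continuous)

text \<open>The derivative is the identity minus a rank-one map with image spanned by
  \<open>d\<close>. Whether it is onto depends only on the slope of \<open>a\<close> along
  \<open>d\<close>, and a slope of modulus at most 1/2 keeps \<open>1 - ?a d\<close> away from
  0.\<close>

lemma submersive_shear:
  assumes a: "smooth p a Y" and p: "1 \<le> p"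
    and lip: "\<And>x s. x \<in> Y \<Longrightarrow> \<bar>a (x + s *\<^sub>R d) - a x\<bar> \<le> 1/2 * \<bar>s\<bar>"
  shows "submersive p (\<lambda>x. x - a x *\<^sub>R d) Y"
  unfolding submersive_def
proof (intro conjI allI impI ballI)
  show Y: "open Y" using a by (rule smooth_open)
  have da: "(a has_derivative frechet_derivative a (at x)) (at x)" if "x \<in> Y" for x
    using smooth_derivative(1)[OF a p that] .
  have du: "((\<lambda>x. x - a x *\<^sub>R d) has_derivative (\<lambda>h. h - frechet_derivative a (at x) h *\<^sub>R d)) (at x)" if "x \<in> Y" for x
    by (intro has_derivative_diff has_derivative_ident has_derivative_scaleR_left da[OF that])
  show "smooth p (\<lambda>x. f (x - a x *\<^sub>R d)) (Y \<inter> (\<lambda>x. x - a x *\<^sub>R d) -` T)" if f: "smooth p f T" for f :: "'a \<Rightarrow> real" and T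
  proof -
    have "continuous_on Y (\<lambda>x. x - a x *\<^sub>R d)"
      using du has_derivative_continuous continuous_at_imp_continuous_on by blast
    then have o: "open (Y \<inter> (\<lambda>x. x - a x *\<^sub>R d) -` T)"
      using Y smooth_open[OF f] by (simp add: continuous_on_open_vimage Int_commute)
    have "smooth p a (Y \<inter> (\<lambda>x. x - a x *\<^sub>R d) -` T)" by (rule smooth_subset[OF a o]) auto
    then have "smooth p (\<lambda>x. f (x + 0 + a x *\<^sub>R (- d))) (Y \<inter> (\<lambda>x. x - a x *\<^sub>R d) -` T)"
      by (intro smooth_shear[OF f] bounded_linear_ident) auto
    then show ?thesis by simp
  qed
  fix x assume x: "x \<in> Y"
  let ?a = "frechet_derivative a (at x)"
  have "\<bar>?a d\<bar> \<le> 1/2"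
  proof -
    have "((\<lambda>s. a (x + s *\<^sub>R d)) has_derivative (\<lambda>s. ?a (s *\<^sub>R d))) (at 0)"
    proof -
      have "((\<lambda>s. x + s *\<^sub>R d) has_derivative (\<lambda>s. s *\<^sub>R d)) (at (0::real))"
        by (auto intro!: derivative_eq_intros)
      from has_derivative_compose[OF this, of a ?a] da[OF x] show ?thesis by simp
    qed
    moreover have "(\<lambda>s. ?a (s *\<^sub>R d)) = (*) (?a d)"
      using linear_scale[OF has_derivative_linear[OF da[OF x]]] by (simp add: fun_eq_iff mult.commute)
    ultimately have "((\<lambda>s. a (x + s *\<^sub>R d)) has_real_derivative ?a d) (at 0)"
      by (simp add: has_field_derivative_def)
    then have "((\<lambda>s. (a (x + s *\<^sub>R d) - a x) / s) \<longlongrightarrow> ?a d) (at 0)"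
      by (simp add: DERIV_def)
    then have "((\<lambda>s. \<bar>(a (x + s *\<^sub>R d) - a x) / s\<bar>) \<longlongrightarrow> \<bar>?a d\<bar>) (at 0)" by (rule tendsto_rabs)
    then show ?thesis
    proof (rule tendsto_upperbound)
      show "\<forall>\<^sub>F s in at 0. \<bar>(a (x + s *\<^sub>R d) - a x) / s\<bar> \<le> 1/2"
        using lip[OF x] by (auto simp: eventually_at_filter abs_divide divide_le_eq intro!: always_eventually)
    qed simp
  qed
  then have ne: "1 - ?a d \<noteq> 0" by auto
  have lin: "linear ?a" using has_derivative_linear[OF da[OF x]] .
  have "surj (\<lambda>h. h - ?a h *\<^sub>R d)"
  proof (rule surjI)
    fix w
    \<comment> \<open>The preimage of \<open>w\<close> is sought as \<open>w + t d\<close>, which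
      requires \<open>t = ?a w + t * ?a d\<close>.\<close>
    let ?t = "?a w / (1 - ?a d)"
    have "?a (w + ?t *\<^sub>R d) = ?t"
      using ne by (simp add: linear_add[OF lin] linear_scale[OF lin] field_simps)
    then show "(w + ?t *\<^sub>R d) - ?a (w + ?t *\<^sub>R d) *\<^sub>R d = w" by simp
  qed
  then show "\<exists>u'. ((\<lambda>x. x - a x *\<^sub>R d) has_derivative u') (at x) \<and> surj u'" using du[OF x] by blast
qed

section \<open>Directional derivatives, finite-rank projections, countable covers and telescoping
  weights\<close>

lemma directional_derivative:
  assumes "(f has_derivative f') (at x)"
  shows "((\<lambda>t. f (x + t *\<^sub>R h)) has_real_derivative f' h) (at 0)"
proof -
  have "((\<lambda>s. x + s *\<^sub>R h) has_derivative (\<lambda>s. s *\<^sub>R h)) (at (0::real))"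
    by (auto intro!: derivative_eq_intros)
  from has_derivative_compose[OF this, of f f'] assms
  have "((\<lambda>s. f (x + s *\<^sub>R h)) has_derivative (\<lambda>s. f' (s *\<^sub>R h))) (at 0)" by simp
  moreover have "(\<lambda>s. f' (s *\<^sub>R h)) = (*) (f' h)"
    using linear_scale[OF has_derivative_linear[OF assms]] by (simp add: fun_eq_iff mult.commute)
  ultimately show ?thesis by (simp add: has_field_derivative_def)
qed

lemma directional_derivative_limit:
  assumes "(f has_derivative f') (at x)"
  shows "((\<lambda>t. (f (x + t *\<^sub>R h) - f x) / t) \<longlongrightarrow> f' h) (at 0)"
  using directional_derivative[OF assms, of h] by (simp add: DERIV_def)

lemma directional_derivative_bound:
  assumes "(f has_derivative f') (at x)" "\<And>t. \<bar>f (x + t *\<^sub>R h) - f x\<bar> \<le> C * \<bar>t\<bar>"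
  shows "\<bar>f' h\<bar> \<le> C"
proof (rule tendsto_upperbound)
  show "((\<lambda>t. \<bar>(f (x + t *\<^sub>R h) - f x) / t\<bar>) \<longlongrightarrow> \<bar>f' h\<bar>) (at 0)"
    by (intro tendsto_rabs directional_derivative_limit assms(1))
  show "\<forall>\<^sub>F t in at 0. \<bar>(f (x + t *\<^sub>R h) - f x) / t\<bar> \<le> C"
    using assms(2) by (auto simp: eventually_at_filter abs_divide divide_le_eq intro!: always_eventually)
qed simp

text \<open>A functional that vanishes on the kernel of \<open>P\<close> changes nothing. Otherwise
  some \<open>b\<close> in that kernel has \<open>f b = 1\<close>, and adding the
  \<open>b\<close>-component \<open>f (x - P x)\<close> to \<open>P\<close> keeps it idempotent and
  cuts its kernel down by \<open>f\<close>.\<close>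

lemma finite_rank_projection:
  fixes F :: "('a::real_normed_vector \<Rightarrow> real) set"
  assumes "finite F" "\<And>f. f \<in> F \<Longrightarrow> bounded_linear f"
  shows "\<exists>P B. bounded_linear P \<and> (\<forall>x. P (P x) = P x) \<and> (\<forall>x. P x = 0 \<longleftrightarrow> (\<forall>f\<in>F. f x = 0))
    \<and> finite B \<and> range P \<subseteq> span (B :: 'a set)"
  using assms
proof (induction F rule: finite_induct)
  case empty
  show ?case by (intro exI[of _ "\<lambda>_. 0"] exI[of _ "{}"]) auto
next
  case (insert f F)
  then obtain P B where P: "bounded_linear P" "\<And>x. P (P x) = P x" "\<And>x. P x = 0 \<longleftrightarrow> (\<forall>f\<in>F. f x = 0)"
    "finite B" "range P \<subseteq> span (B :: 'a set)" by auto
  interpret P: bounded_linear P by (rule P(1))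
  interpret f: bounded_linear f using insert by blast
  show ?case
  proof (cases "\<forall>x. P x = 0 \<longrightarrow> f x = 0")
    case True
    then show ?thesis using P by (intro exI[of _ P] exI[of _ B]) auto
  next
    case False
    then obtain z where z: "P z = 0" "f z \<noteq> 0" by blast
    define b where "b = (1 / f z) *\<^sub>R z"
    have b: "P b = 0" "f b = 1" "b \<noteq> 0" using z by (auto simp: b_def P.scaleR f.scaleR f.zero)
    define Q where "Q = (\<lambda>x. P x + f (x - P x) *\<^sub>R b)"
    have Q: "bounded_linear Q" unfolding Q_def
      by (intro bounded_linear_add P(1) bounded_linear_compose[OF bounded_linear_scaleR_left]
          bounded_linear_compose[OF f.bounded_linear_axioms] bounded_linear_sub bounded_linear_ident)
    have PQ: "P (Q x) = P x" for x by (simp add: Q_def P.add P.scaleR b P(2))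
    have "Q x - P x = f (x - P x) *\<^sub>R b" for x by (simp add: Q_def)
    then have fQ: "f (Q x - P x) = f (x - P x)" for x by (simp add: f.scaleR b)
    have QQ: "Q (Q x) = Q x" for x
    proof -
      have "Q (Q x) = P (Q x) + f (Q x - P (Q x)) *\<^sub>R b" by (simp only: Q_def)
      also have "\<dots> = Q x" by (simp only: PQ fQ) (simp only: Q_def)
      finally show ?thesis .
    qed
    have ker: "Q x = 0 \<longleftrightarrow> (\<forall>g\<in>insert f F. g x = 0)" for x
    proof
      assume "Q x = 0"
      then have "P x = 0" using PQ[of x] by (simp add: P.zero)
      moreover have "f x = 0" using \<open>Q x = 0\<close> calculation b(3) by (simp add: Q_def)
      ultimately show "\<forall>g\<in>insert f F. g x = 0" using b P(3) by auto
    next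
      assume "\<forall>g\<in>insert f F. g x = 0"
      then have "P x = 0" "f x = 0" using P(3) by auto
      then show "Q x = 0" by (simp add: Q_def)
    qed
    have "range Q \<subseteq> span (insert b B)"
    proof clarify
      fix x
      have "P x \<in> span (insert b B)" using P(5) span_mono[of B "insert b B"] by auto
      moreover have "f (x - P x) *\<^sub>R b \<in> span (insert b B)" by (intro span_scale span_base) auto
      ultimately show "Q x \<in> span (insert b B)" unfolding Q_def by (rule span_add)
    qed
    then show ?thesis using Q QQ ker P(4) by (intro exI[of _ Q] exI[of _ "insert b B"]) auto
  qed
qed

lemma lindelof_sequence:
  fixes Y :: "'a::real_normed_vector set"
  assumes sep: "separable_space (euclidean :: 'a topology)" and "Y \<noteq> {}"
    and W: "\<And>x. x \<in> Y \<Longrightarrow> open (W x)" "\<And>x. x \<in> Y \<Longrightarrow> x \<in> W x"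
  shows "\<exists>c :: nat \<Rightarrow> 'a. range c \<subseteq> Y \<and> Y \<subseteq> (\<Union>n. W (c n))"
proof -
  obtain D :: "'a set" where D: "countable D" "closure D = UNIV"
    using sep unfolding separable_space_def by auto
  \<comment> \<open>One point is chosen for each of the countably many basic balls that fit into
    some \<open>W x\<close>; it may differ from the point whose neighbourhood led to the
    ball.\<close>
  define I where "I = {(d, n). d \<in> D \<and> (\<exists>x\<in>Y. ball d (1 / real (Suc n)) \<subseteq> W x)}"
  define s where "s = (\<lambda>(d, n). SOME x. x \<in> Y \<and> ball d (1 / real (Suc n)) \<subseteq> W x)"
  have "countable (D \<times> (UNIV :: nat set))" using D by auto
  then have cI: "countable (s ` I)" by (intro countable_image countable_subset[of I "D \<times> UNIV"]) (auto simp: I_def)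
  have s: "s i \<in> Y" "ball (fst i) (1 / real (Suc (snd i))) \<subseteq> W (s i)" if "i \<in> I" for i
  proof -
    have "\<exists>x. x \<in> Y \<and> ball (fst i) (1 / real (Suc (snd i))) \<subseteq> W x" using that by (auto simp: I_def)
    from someI_ex[OF this] show "s i \<in> Y" "ball (fst i) (1 / real (Suc (snd i))) \<subseteq> W (s i)"
      by (auto simp: s_def case_prod_beta)
  qed
  have cov: "\<exists>i\<in>I. x \<in> W (s i)" if x: "x \<in> Y" for x
  proof -
    obtain e where e: "e > 0" "ball x e \<subseteq> W x" using W[OF x] open_contains_ball by blast
    obtain n where n: "1 / real (Suc n) < e / 2" using nat_approx_posE[of "e/2"] e by auto
    obtain d where d: "d \<in> D" "dist d x < 1 / real (Suc n)"
      using D(2) closure_approachable[of x D] by (metis UNIV_I of_nat_0_less_iff zero_less_Suc zero_less_divide_1_iff)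
    have "ball d (1 / real (Suc n)) \<subseteq> ball x e"
    proof
      fix y assume "y \<in> ball d (1 / real (Suc n))"
      then have "dist x y < 1 / real (Suc n) + 1 / real (Suc n)"
        using d(2) dist_triangle[of x y d] by (simp add: dist_commute)
      then show "y \<in> ball x e" using n by simp
    qed
    then have i: "(d, n) \<in> I" using x d(1) e(2) by (auto simp: I_def)
    have "x \<in> ball d (1 / real (Suc n))" using d(2) by simp
    then show ?thesis using s(2)[OF i] i by auto
  qed
  obtain y where "y \<in> Y" using \<open>Y \<noteq> {}\<close> by blast
  then have ne: "s ` I \<noteq> {}" using cov by blast
  show ?thesis
  proof (intro exI[of _ "from_nat_into (s ` I)"] conjI)
    have r: "range (from_nat_into (s ` I)) = s ` I" using range_from_nat_into[OF ne cI] .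
    show "range (from_nat_into (s ` I)) \<subseteq> Y" unfolding r using s by auto
    show "Y \<subseteq> (\<Union>n. W (from_nat_into (s ` I) n))"
    proof
      fix x assume "x \<in> Y"
      then obtain i where "i \<in> I" "x \<in> W (s i)" using cov by blast
      moreover then obtain n where "s i = from_nat_into (s ` I) n" using r by (metis image_eqI imageE)
      ultimately show "x \<in> (\<Union>n. W (from_nat_into (s ` I) n))" by auto
    qed
  qed
qed

text \<open>The sum may stop at the first \<open>n\<close> with \<open>\<phi> n x = 1\<close> since all later weights vanish; hence no local
  finiteness of the supports of \<open>\<phi>\<close> is needed.\<close>

definition tele :: "(nat \<Rightarrow> 'a \<Rightarrow> real) \<Rightarrow> (nat \<Rightarrow> real) \<Rightarrow> 'a \<Rightarrow> real" where
  "tele \<phi> a x = (\<Sum>i\<le>(LEAST n. \<phi> n x = 1). a i * (\<phi> i x * (\<Prod>l<i. 1 - \<phi> l x)))"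

lemma tele_eq:
  assumes "\<phi> m x = 1"
  shows "tele \<phi> a x = (\<Sum>i\<le>m. a i * (\<phi> i x * (\<Prod>l<i. 1 - \<phi> l x)))"
proof -
  define n where "n = (LEAST n. \<phi> n x = 1)"
  have n: "\<phi> n x = 1" "n \<le> m" unfolding n_def using assms by (auto intro: LeastI Least_le)
  have "(\<Sum>i\<le>n. a i * (\<phi> i x * (\<Prod>l<i. 1 - \<phi> l x))) = (\<Sum>i\<le>m. a i * (\<phi> i x * (\<Prod>l<i. 1 - \<phi> l x)))"
  proof (rule sum.mono_neutral_left)
    show "\<forall>i\<in>{..m} - {..n}. a i * (\<phi> i x * (\<Prod>l<i. 1 - \<phi> l x)) = 0"
      using n(1) by (auto intro!: prod_zero)
  qed (use n in auto)
  then show ?thesis by (simp add: tele_def n_def)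
qed

text \<open>Each summand is the difference of two consecutive partial products of the factors
  \<open>1 - f l\<close>.\<close>

lemma tele_weights: "(\<Sum>i\<le>m::nat. f i * (\<Prod>l<i. 1 - f l)) = 1 - (\<Prod>l\<le>m. 1 - f l :: real)"
proof (induction m)
  case (Suc m)
  have 1: "(\<Prod>l<Suc m. 1 - f l) = (\<Prod>l\<le>m. 1 - f l)" by (simp only: lessThan_Suc_atMost)
  show ?case unfolding sum.atMost_Suc prod.atMost_Suc Suc 1 by (simp add: algebra_simps)
qed simp

lemma tele_in_convex:
  assumes "\<phi> m x = 1" "\<And>n. 0 \<le> \<phi> n x" "\<And>n. \<phi> n x \<le> 1" "convex S" "\<And>n. \<phi> n x \<noteq> 0 \<Longrightarrow> a n \<in> S"
  shows "tele \<phi> a x \<in> S"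
proof -
  let ?w = "\<lambda>i. \<phi> i x * (\<Prod>l<i. 1 - \<phi> l x)"
  let ?I = "{i\<in>{..m}. \<phi> i x \<noteq> 0}"
  have "(\<Prod>l\<le>m. 1 - \<phi> l x) = 0" using assms(1) by (intro prod_zero) auto
  then have s: "(\<Sum>i\<le>m. ?w i) = 1" using tele_weights[of "\<lambda>i. \<phi> i x" m] by simp
  have "(\<Sum>i\<in>?I. ?w i) = (\<Sum>i\<le>m. ?w i)" by (rule sum.mono_neutral_left) auto
  then have s1: "(\<Sum>i\<in>?I. ?w i) = 1" using s by simp
  have "(\<Sum>i\<in>?I. ?w i *\<^sub>R a i) \<in> S"
    using s1 assms by (intro convex_sum) (auto intro!: mult_nonneg_nonneg prod_nonneg)
  moreover have "(\<Sum>i\<in>?I. ?w i *\<^sub>R a i) = (\<Sum>i\<le>m. ?w i *\<^sub>R a i)" by (rule sum.mono_neutral_left) auto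
  ultimately show ?thesis by (simp add: tele_eq[of \<phi>, OF assms(1)] mult.commute[of "a _"])
qed

lemma smooth_tele:
  assumes "\<And>n. smooth p (\<phi> n) Y" "\<And>x. x \<in> Y \<Longrightarrow> \<exists>n T. open T \<and> x \<in> T \<and> T \<subseteq> Y \<and> (\<forall>y\<in>T. \<phi> n y = 1)"
  shows "smooth p (tele \<phi> a) Y"
proof (rule smooth_local)
  fix x assume "x \<in> Y"
  then obtain n T where T: "open T" "x \<in> T" "T \<subseteq> Y" "\<forall>y\<in>T. \<phi> n y = 1" using assms(2) by blast
  have \<phi>: "smooth p (\<phi> i) T" for i using smooth_subset[OF assms(1) T(1,3)] .
  have "smooth p (\<lambda>x. \<Sum>i\<le>n. a i * (\<phi> i x * (\<Prod>l<i. 1 - \<phi> l x))) T"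
    by (intro smooth_sum smooth_mult smooth_const smooth_prod smooth_diff \<phi> T(1)) auto
  then have "smooth p (tele \<phi> a) T"
    by (rule smooth_cong) (use T(4) in \<open>simp add: tele_eq[of \<phi> n]\<close>)
  then show "\<exists>T. x \<in> T \<and> T \<subseteq> Y \<and> smooth p (tele \<phi> a) T" using T by blast
qed

section \<open>Smooth rotund functions\<close>

locale smooth_LUR =
  fixes p :: enat and N :: "'a::banach \<Rightarrow> real"
  assumes p1: "1 \<le> p"
    and infdim: "\<not> (\<exists>B::'a set. finite B \<and> span B = UNIV)"
    and sep: "separable_space (euclidean :: 'a topology)"
    and eqN: "equivalent_norm N" and LURN: "LUR N" and CN: "C_smooth_on p N (UNIV - {0})"
begin

lemma N_eq_0: "N x = 0 \<longleftrightarrow> x = 0"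
  and N_triangle: "N (x + y) \<le> N x + N y"
  and N_scale: "N (a *\<^sub>R x) = \<bar>a\<bar> * N x"
  using eqN unfolding equivalent_norm_def by blast+

lemma N_0 [simp]: "N 0 = 0"
  by (simp add: N_eq_0)

lemma N_lower: "\<exists>c>0. \<forall>x. c * norm x \<le> N x"
  and N_upper: "\<exists>C>0. \<forall>x. N x \<le> C * norm x"
  using eqN unfolding equivalent_norm_def by blast+

lemma N_nonneg [simp]: "0 \<le> N x"
proof -
  obtain c where "c > 0" "c * norm x \<le> N x" using N_lower by blast
  moreover have "0 \<le> c * norm x" using \<open>c > 0\<close> by simp
  ultimately show ?thesis by linarith
qed

lemma N_pos: "x \<noteq> 0 \<Longrightarrow> 0 < N x"
  using N_nonneg[of x] N_eq_0[of x] by linarith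

lemma N_minus: "N (- x) = N x"
  using N_scale[of "-1" x] by simp

lemma N_diff: "\<bar>N x - N y\<bar> \<le> N (x - y)"
  using N_triangle[of "x - y" y] N_triangle[of "y - x" x] N_minus[of "x - y"] by simp

lemma N_continuous: "continuous_on S N"
proof -
  obtain C where C: "C > 0" "\<forall>x. N x \<le> C * norm x" using N_upper by blast
  have "dist (N x) (N y) \<le> C * dist x y" for x y
    using N_diff[of x y] C(2) by (auto simp: dist_norm intro: order_trans)
  then have "C-lipschitz_on UNIV N" using C(1) by (intro lipschitz_onI) auto
  then have "continuous_on UNIV N" by (rule lipschitz_on_continuous_on)
  then show ?thesis using continuous_on_subset by blast
qed

lemma open_N_ball: "open {x. N (x - z) < r}"
  by (intro open_Collect_less continuous_on_compose2[OF N_continuous] continuous_intros) auto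

lemma smooth_N: "smooth p N (UNIV - {0})"
  using CN by (rule C_smooth_on_imp_smooth)

lemma smooth_N_shift: "smooth p (\<lambda>x. N (x - z)) (UNIV - {z})"
  using smooth_affine[OF smooth_N bounded_linear_ident, of "UNIV - {z}" "- z"] by (simp add: open_Diff)

text \<open>The singularity of \<open>N\<close> at 0 does no harm, since the function is constantly
  1 for \<open>N (x - z) < r\<close>.\<close>

lemma smooth_bump:
  assumes r: "r > 0"
  shows "smooth p (\<lambda>x. step (2 - N (x - z) / r)) UNIV"
proof (rule smooth_local)
  fix x
  show "\<exists>T. x \<in> T \<and> T \<subseteq> UNIV \<and> smooth p (\<lambda>x. step (2 - N (x - z) / r)) T"
  proof (cases "x = z")
    case True
    have "smooth p (\<lambda>x. step (2 - N (x - z) / r)) {x. N (x - z) < r}"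
      by (rule smooth_cong[OF smooth_const[OF open_N_ball, of p 1]]) (rule step_eq_1[symmetric], use r in \<open>simp add: field_simps\<close>)
    then show ?thesis using True r by (intro exI[of _ "{x. N (x - z) < r}"]) auto
  next
    case False
    have "smooth p (\<lambda>x. step (2 - N (x - z) * (1 / r))) (UNIV - {z})"
      by (intro smooth_step smooth_diff smooth_const smooth_mult smooth_N_shift) auto
    then show ?thesis using False by (intro exI[of _ "UNIV - {z}"]) auto
  qed
qed

text \<open>The derivative of \<open>N\<close> at \<open>x\<close> serves: \<open>N\<close> is
  1-Lipschitz with respect to itself, and along its own ray \<open>x\<close> it grows with slope
  \<open>N x\<close>.\<close>

lemma norming_functional:
  assumes "x \<noteq> 0"
  shows "\<exists>\<psi>. bounded_linear \<psi> \<and> (\<forall>h. \<bar>\<psi> h\<bar> \<le> N h) \<and> \<psi> x = N x"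
proof -
  let ?\<psi> = "frechet_derivative N (at x)"
  have d: "(N has_derivative ?\<psi>) (at x)" using smooth_derivative(1)[OF smooth_N p1] assms by simp
  have 1: "\<bar>?\<psi> h\<bar> \<le> N h" for h
  proof (rule directional_derivative_bound[OF d])
    show "\<bar>N (x + t *\<^sub>R h) - N x\<bar> \<le> N h * \<bar>t\<bar>" for t
      using N_diff[of "x + t *\<^sub>R h" x] by (simp add: N_scale mult.commute)
  qed
  have "((\<lambda>t. (1 + t) * N x) has_real_derivative N x) (at 0)" by (auto intro!: derivative_eq_intros)
  then have "((\<lambda>t. N (x + t *\<^sub>R x)) has_real_derivative N x) (at 0)"
  proof (rule has_field_derivative_transform_within_open[of _ _ _ "{-1<..<1}"])
    fix t :: real assume "t \<in> {-1<..<1}"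
    moreover have "x + t *\<^sub>R x = (1 + t) *\<^sub>R x" by (simp add: scaleR_left_distrib)
    ultimately show "(1 + t) * N x = N (x + t *\<^sub>R x)" by (simp add: N_scale)
  qed auto
  with directional_derivative[OF d, of x] have "?\<psi> x = N x" by (rule DERIV_unique)
  then show ?thesis using 1 has_derivative_bounded_linear[OF d] by blast
qed

lemma norming_functional_total:
  "\<exists>\<psi>. bounded_linear \<psi> \<and> (\<forall>h. \<bar>\<psi> h\<bar> \<le> N h) \<and> \<psi> x = N x"
proof (cases "x = 0")
  case True
  then show ?thesis using N_nonneg by (intro exI[of _ "\<lambda>_. 0"]) (simp add: N_0)
next
  case False
  then show ?thesis using norming_functional by blast
qed

lemma dense_sequence:
  "\<exists>D :: nat \<Rightarrow> 'a. \<forall>x e. 0 < e \<longrightarrow> (\<exists>j. D j \<in> ball x e)"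
proof -
  obtain S :: "'a set" where S: "countable S" "closure S = UNIV"
    using sep by (auto simp: separable_space_def)
  have "\<exists>j. from_nat_into S j \<in> ball x e" if pos: "0 < e" for x e
  proof -
    have "x \<in> closure S" using S(2) by simp
    then obtain y where y: "y \<in> S" "dist y x < e" using iffD1[OF closure_approachable, rule_format, of x S e] pos by blast
    then obtain j where "from_nat_into S j = y" using from_nat_into_surj[OF S(1)] by blast
    then show ?thesis using y(2) by (intro exI[of _ j]) (simp add: dist_commute)
  qed
  then show ?thesis by (intro exI[of _ "from_nat_into S"]) blast
qed

text \<open>A projection whose kernel is the common null space has finite-dimensional range, so in
  an infinite-dimensional space it cannot be injective.\<close>

lemma common_null_vector:
  assumes "finite F" "\<And>f. f \<in> F \<Longrightarrow> bounded_linear (f :: 'a \<Rightarrow> real)"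
  shows "\<exists>v. N v = 1 \<and> (\<forall>f\<in>F. f v = 0)"
proof -
  obtain P B where P: "bounded_linear P" "\<And>x. P (P x) = P x" "\<And>x. P x = 0 \<longleftrightarrow> (\<forall>f\<in>F. f x = 0)"
    "finite B" "range P \<subseteq> span (B :: 'a set)"
    using finite_rank_projection[OF assms] by auto
  interpret P: bounded_linear P by (rule P(1))
  have "\<exists>v. v \<noteq> 0 \<and> P v = 0"
  proof (rule ccontr)
    assume a: "\<nexists>v. v \<noteq> 0 \<and> P v = 0"
    have "x = P x" for x using a[unfolded not_ex, rule_format, of "x - P x"] by (simp add: P.diff P(2))
    then have "UNIV \<subseteq> span B" using P(5) by (metis rangeI subset_iff subsetI)
    then show False using infdim P(4) by auto
  qed
  then obtain v where v: "v \<noteq> 0" "P v = 0" by blast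
  show ?thesis
  proof (intro exI[of _ "(1 / N v) *\<^sub>R v"] conjI ballI)
    show "N ((1 / N v) *\<^sub>R v) = 1" using N_pos[OF v(1)] v(1) by (simp add: N_scale)
    show "f ((1 / N v) *\<^sub>R v) = 0" if "f \<in> F" for f
      using assms(2)[OF that] v(2) P(3) that by (simp add: linear_simps)
  qed
qed

text \<open>If the constraint at each point is convex and can be met locally by a constant, the
  constants can be averaged with smooth telescoping weights. This single principle later yields the
  bumps around closed sets as well as the heights of the caps.\<close>

lemma selection:
  fixes Y :: "'a set"
  assumes Y: "open Y" and cv: "\<And>x. x \<in> Y \<Longrightarrow> convex (\<Phi> x)"
    and loc: "\<And>x. x \<in> Y \<Longrightarrow> \<exists>T r. open T \<and> x \<in> T \<and> (\<forall>y\<in>T \<inter> Y. r \<in> \<Phi> y)"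
  obtains \<kappa> where "smooth p \<kappa> Y" "\<And>x. x \<in> Y \<Longrightarrow> \<kappa> x \<in> \<Phi> x"
proof (cases "Y = {}")
  case True
  then show ?thesis using that[of "\<lambda>_. 0"] smooth_const by auto
next
  case False
  obtain T r where T: "\<And>x. x \<in> Y \<Longrightarrow> open (T x) \<and> x \<in> T x \<and> (\<forall>y\<in>T x \<inter> Y. r x \<in> \<Phi> y)"
    using loc by metis
  obtain c where c: "0 < c" "\<forall>x. c * norm x \<le> N x" using N_lower by blast
  \<comment> \<open>The factor 2 leaves room for the cutoff: a weight is 1 on the ball of radius
    \<rho> and lives on that of radius 2\<rho>, where the chosen constant is still
    admissible.\<close>
  have "\<exists>\<rho>>0. \<forall>y. N (y - x) < 2 * \<rho> \<longrightarrow> y \<in> T x" if x: "x \<in> Y" for x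
  proof -
    obtain e where e: "e > 0" "ball x e \<subseteq> T x" using T[OF x] open_contains_ball by blast
    have "y \<in> T x" if "N (y - x) < 2 * (c * e / 2)" for y :: 'a
    proof -
      have "c * norm (y - x) < c * e" using that c(2)[rule_format, of "y - x"] by simp
      then show ?thesis using c e by (auto simp: dist_norm norm_minus_commute)
    qed
    then show ?thesis using c e by (intro exI[of _ "c * e / 2"]) auto
  qed
  then obtain \<rho> where \<rho>: "\<And>x. x \<in> Y \<Longrightarrow> \<rho> x > 0" "\<And>x y. x \<in> Y \<Longrightarrow> N (y - x) < 2 * \<rho> x \<Longrightarrow> y \<in> T x" by metis
  obtain s :: "nat \<Rightarrow> 'a" where s: "range s \<subseteq> Y" "Y \<subseteq> (\<Union>n. {x. N (x - s n) < \<rho> (s n)})"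
  proof -
    have m: "x \<in> {y. N (y - x) < \<rho> x}" if "x \<in> Y" for x using \<rho>(1)[OF that] by simp
    have "\<exists>s :: nat \<Rightarrow> 'a. range s \<subseteq> Y \<and> Y \<subseteq> (\<Union>n. {x. N (x - s n) < \<rho> (s n)})"
    proof (rule lindelof_sequence[OF sep False, where W="\<lambda>z. {x. N (x - z) < \<rho> z}"])
      show "open {y. N (y - x) < \<rho> x}" for x by (rule open_N_ball)
      show "x \<in> {y. N (y - x) < \<rho> x}" if "x \<in> Y" for x by (rule m[OF that])
    qed
    then show thesis using that by blast
  qed
  have sY: "s n \<in> Y" for n using s(1) by auto
  define \<phi> where "\<phi> = (\<lambda>n x. step (2 - N (x - s n) / \<rho> (s n)))"
  have one: "\<phi> n x = 1" if "N (x - s n) < \<rho> (s n)" for n x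
    using that \<rho>(1)[OF sY] unfolding \<phi>_def by (intro step_eq_1) (simp add: field_simps)
  have nz: "N (x - s n) < 2 * \<rho> (s n)" if "\<phi> n x \<noteq> 0" for n x
  proof (rule ccontr)
    assume "\<not> ?thesis"
    then have "2 - N (x - s n) / \<rho> (s n) \<le> 0" using \<rho>(1)[OF sY[of n]] by (simp add: field_simps)
    then show False using that step_eq_0 by (simp add: \<phi>_def)
  qed
  show ?thesis
  proof (rule that[of "tele \<phi> (\<lambda>n. r (s n))"])
    show "smooth p (tele \<phi> (\<lambda>n. r (s n))) Y"
    proof (rule smooth_tele)
      show "smooth p (\<phi> n) Y" for n
        unfolding \<phi>_def using smooth_subset[OF smooth_bump[OF \<rho>(1)[OF sY]] Y] by simp
      fix x assume x: "x \<in> Y"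
      then obtain n where n: "N (x - s n) < \<rho> (s n)" using s(2) by blast
      show "\<exists>n T. open T \<and> x \<in> T \<and> T \<subseteq> Y \<and> (\<forall>y\<in>T. \<phi> n y = 1)"
        by (intro exI[of _ n] exI[of _ "{x. N (x - s n) < \<rho> (s n)} \<inter> Y"])
          (use n x Y one open_N_ball in auto)
    qed
    fix x assume x: "x \<in> Y"
    then obtain n where n: "N (x - s n) < \<rho> (s n)" using s(2) by blast
    show "tele \<phi> (\<lambda>n. r (s n)) x \<in> \<Phi> x"
    proof (rule tele_in_convex[where \<phi>=\<phi> and x=x and m=n])
      show "\<phi> n x = 1" by (rule one[OF n])
      show "convex (\<Phi> x)" by (rule cv[OF x])
      show "r (s m) \<in> \<Phi> x" if "\<phi> m x \<noteq> 0" for m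
        using T[OF sY] \<rho>(2)[OF sY nz[OF that]] x by blast
    qed (simp_all add: \<phi>_def step_bounds)
  qed
qed

end

lemma convex_gradient_ineq:
  fixes \<theta> :: "'a::real_normed_vector \<Rightarrow> real"
  assumes d: "(\<theta> has_derivative \<theta>') (at x)"
    and cv: "\<And>t. 0 \<le> t \<Longrightarrow> t \<le> 1 \<Longrightarrow> \<theta> (x + t *\<^sub>R (y - x)) \<le> (1 - t) * \<theta> x + t * \<theta> y"
  shows "\<theta> x + \<theta>' (y - x) \<le> \<theta> y"
proof -
  have "((\<lambda>t. (\<theta> (x + t *\<^sub>R (y - x)) - \<theta> x) / t) \<longlongrightarrow> \<theta>' (y - x)) (at_right 0)"
    using directional_derivative_limit[OF d] by (rule filterlim_mono) (auto simp: at_within_le_at)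
  then have "\<theta>' (y - x) \<le> \<theta> y - \<theta> x"
  proof (rule tendsto_upperbound)
    have "\<forall>\<^sub>F t::real in at_right 0. t < 1" by (rule eventually_at_rightI[of 0 1]) auto
    then show "\<forall>\<^sub>F t in at_right 0. (\<theta> (x + t *\<^sub>R (y - x)) - \<theta> x) / t \<le> \<theta> y - \<theta> x"
      using eventually_at_right_less[of "0::real"]
    proof eventually_elim
      case (elim t)
      then have "\<theta> (x + t *\<^sub>R (y - x)) - \<theta> x \<le> (\<theta> y - \<theta> x) * t"
        using cv[of t] by (simp add: algebra_simps)
      then show ?case using elim by (simp add: divide_le_eq)
    qed
  qed simp
  then show ?thesis by simp
qed

lemma midpoint_shift:
  "u + (v - u) /\<^sub>R 2 + e = ((v + e) + (u + e)) /\<^sub>R 2"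
  for u :: "'a::real_vector"
proof -
  have "2 *\<^sub>R (u + (v - u) /\<^sub>R 2 + e) = 2 *\<^sub>R (((v + e) + (u + e)) /\<^sub>R 2)"
    by (simp add: scaleR_right_distrib scaleR_2)
  then show ?thesis by (simp only: scaleR_cancel_left) simp
qed

section \<open>A smooth convex locally uniformly rotund function\<close>

context smooth_LUR
begin

lemma norm_le_N: "(\<lambda>j. N (a j)) \<longlonglongrightarrow> 0 \<Longrightarrow> a \<longlonglongrightarrow> 0"
proof -
  assume a: "(\<lambda>j. N (a j)) \<longlonglongrightarrow> 0"
  obtain c where c: "c > 0" "\<forall>x. c * norm x \<le> N x" using N_lower by blast
  have "(\<lambda>j. N (a j) / c) \<longlonglongrightarrow> 0 / c" using a c(1) by (intro tendsto_divide tendsto_const) auto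
  then have "(\<lambda>j. N (a j) / c) \<longlonglongrightarrow> 0" by simp
  moreover have "\<forall>\<^sub>F j in sequentially. norm (a j) \<le> N (a j) / c"
    using c by (intro always_eventually allI) (simp add: pos_le_divide_eq mult.commute)
  ultimately show ?thesis by (rule Lim_null_comparison[rotated])
qed

text \<open>On the hyperplane \<phi> = 1 one has \<open>N \<ge> 1\<close>, so normalising both
  vectors does not increase the defect in the triangle inequality. The definition of LUR then
  applies to the normalised vectors.\<close>

lemma LUR_hyperplane:
  assumes \<phi>: "bounded_linear \<phi>" "\<And>h. \<bar>\<phi> h\<bar> \<le> N h"
    and one: "\<And>j::nat. \<phi> (a j) = 1" "\<phi> z = 1"
    and lim: "(\<lambda>j. N (a j) + N z - N (a j + z)) \<longlonglongrightarrow> 0"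
  shows "a \<longlonglongrightarrow> z"
proof -
  interpret \<phi>: bounded_linear \<phi> by (rule \<phi>(1))
  have N1: "N x \<ge> 1" if "\<phi> x = 1" for x using \<phi>(2)[of x] that by simp
  define b where "b = (\<lambda>j. (1 / N (a j)) *\<^sub>R a j)"
  define w where "w = (1 / N z) *\<^sub>R z"
  have pos: "N (a j) \<ge> 1" "N z \<ge> 1" for j using N1 one by auto
  have unit: "N ((1 / N u) *\<^sub>R u) = 1 \<and> u = N u *\<^sub>R ((1 / N u) *\<^sub>R u)" if "N u \<ge> 1" for u
  proof -
    have "N u > 0" using that by linarith
    then show ?thesis by (simp add: N_scale)
  qed
  have Nb: "N (b j) = 1" "N w = 1" for j unfolding b_def w_def using unit pos by blast+
  have ab: "a j = N (a j) *\<^sub>R b j" "z = N z *\<^sub>R w" for j unfolding b_def w_def using unit pos by blast+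
  have key: "2 - N (b j + w) \<le> N (a j) + N z - N (a j + z)" for j
  proof -
    \<comment> \<open>Subtracting the excess \<open>s - t\<close> of the longer vector leaves
      \<open>t\<close> times the unit defect, and \<open>t \<ge> 1\<close>.\<close>
    have gen: "2 - N (u + v) \<le> s + t - N (s *\<^sub>R u + t *\<^sub>R v)" if "N u = 1" "N v = 1" "1 \<le> t" "t \<le> s" for u v s t
    proof -
      have "s *\<^sub>R u + t *\<^sub>R v = t *\<^sub>R (u + v) + (s - t) *\<^sub>R u" by (simp add: algebra_simps)
      then have "N (s *\<^sub>R u + t *\<^sub>R v) \<le> t * N (u + v) + (s - t)"
        using N_triangle[of "t *\<^sub>R (u + v)" "(s - t) *\<^sub>R u"] that by (simp add: N_scale)
      moreover have "2 - N (u + v) \<le> t * (2 - N (u + v))"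
      proof -
        have "N (u + v) \<le> 2" using N_triangle[of u v] that by simp
        then show ?thesis using that mult_right_mono[of 1 t "2 - N (u + v)"] by simp
      qed
      ultimately show ?thesis by (simp add: algebra_simps)
    qed
    show ?thesis
    proof (cases "N z \<le> N (a j)")
      case True
      then show ?thesis using gen[OF Nb(1)[of j] Nb(2) pos(2)] ab by metis
    next
      case False
      then have "2 - N (w + b j) \<le> N z + N (a j) - N (N z *\<^sub>R w + N (a j) *\<^sub>R b j)"
        using gen[OF Nb(2) Nb(1)[of j] pos(1)] by simp
      then show ?thesis using ab(1)[of j] ab(2) by (simp add: add.commute)
    qed
  qed
  have le2: "N (b j + w) \<le> 2" for j using N_triangle[of "b j" w] Nb by simp
  have "(\<lambda>j. 2 - N (b j + w)) \<longlonglongrightarrow> 0"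
    by (rule tendsto_sandwich[OF _ _ tendsto_const lim]) (use le2 key in auto)
  then have "(\<lambda>j. 2 - (2 - N (b j + w))) \<longlonglongrightarrow> 2 - 0" by (intro tendsto_diff tendsto_const)
  then have l2: "(\<lambda>j. N (b j + w)) \<longlonglongrightarrow> 2" by simp
  have "(\<lambda>j. N (b j - w)) \<longlonglongrightarrow> 0"
    using LURN Nb l2 unfolding LUR_def by blast
  then have "(\<lambda>j. b j - w) \<longlonglongrightarrow> 0" by (rule norm_le_N)
  then have bw: "b \<longlonglongrightarrow> w" by (rule LIM_zero_cancel)
  \<comment> \<open>The lengths lost by normalisation are recovered from \<phi>, so convergence of
    \<open>b\<close> gives convergence of \<open>a\<close>.\<close>
  have \<phi>b: "\<phi> (b j) = 1 / N (a j)" "\<phi> w = 1 / N z" for j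
    by (simp_all add: b_def w_def \<phi>.scaleR one)
  have "(\<lambda>j. (1 / \<phi> (b j)) *\<^sub>R b j) \<longlonglongrightarrow> (1 / \<phi> w) *\<^sub>R w"
    using pos(2) by (intro tendsto_scaleR tendsto_divide tendsto_const \<phi>.tendsto bw) (auto simp: \<phi>b)
  moreover have "(1 / \<phi> (b j)) *\<^sub>R b j = a j" "(1 / \<phi> w) *\<^sub>R w = z" for j
    by (simp_all add: \<phi>b ab[symmetric])
  ultimately show ?thesis by simp
qed

text \<open>The norm is evaluated on the hyperplane \<open>\<phi> = 1\<close> only: there it is smooth, and convexity gaps
  tending to \<open>0\<close> force convergence without normalization. The second summand controls \<open>\<phi>\<close>.\<close>

lemma exists_LUR_convex:
  obtains \<theta> :: "'a \<Rightarrow> real" and L where "smooth p \<theta> UNIV" "L > 0" "\<And>x y. \<bar>\<theta> x - \<theta> y\<bar> \<le> L * norm (x - y)"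
    "\<And>x y t. 0 \<le> t \<Longrightarrow> t \<le> 1 \<Longrightarrow> \<theta> (x + t *\<^sub>R (y - x)) \<le> (1 - t) * \<theta> x + t * \<theta> y"
    "\<And>y x. (\<lambda>j::nat. \<theta> (y j) / 2 + \<theta> x / 2 - \<theta> (x + (1/2) *\<^sub>R (y j - x))) \<longlonglongrightarrow> 0 \<Longrightarrow> y \<longlonglongrightarrow> x"
proof -
  obtain e where e: "N e = 1" using common_null_vector[of "{}"] by auto
  then have "e \<noteq> 0" by auto
  from norming_functional[OF this] obtain \<phi> where \<phi>: "bounded_linear \<phi>" "\<And>h. \<bar>\<phi> h\<bar> \<le> N h" "\<phi> e = 1"
    using e by auto
  interpret \<phi>: bounded_linear \<phi> by (rule \<phi>(1))
  obtain b where b: "N b = 1" "\<phi> b = 0" using common_null_vector[of "{\<phi>}"] \<phi>(1) by auto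
  then have "b \<noteq> 0" by auto
  \<comment> \<open>\<open>A\<close> projects onto the kernel of \<phi> along \<open>e\<close>, and
    \<open>B\<close> records the lost value \<open>\<phi> x\<close> on a line inside that kernel.
    Both \<open>A x + e\<close> and \<open>B x + e\<close> stay on the hyperplane \<phi> = 1, away
    from the singularity of \<open>N\<close>.\<close>
  define A where "A = (\<lambda>x. x - \<phi> x *\<^sub>R e)"
  define B where "B = (\<lambda>x. \<phi> x *\<^sub>R b)"
  have A: "bounded_linear A" unfolding A_def
    by (intro bounded_linear_sub bounded_linear_ident bounded_linear_compose[OF bounded_linear_scaleR_left \<phi>(1)])
  have B: "bounded_linear B" unfolding B_def
    by (intro bounded_linear_compose[OF bounded_linear_scaleR_left \<phi>(1)])
  interpret A: bounded_linear A by (rule A)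
  interpret B: bounded_linear B by (rule B)
  have \<phi>1: "\<phi> (A x + e) = 1" "\<phi> (B x + e) = 1" for x
    by (simp_all add: A_def B_def \<phi>.add \<phi>.diff \<phi>.scaleR \<phi> b)
  then have ne: "A x + e \<noteq> 0" "B x + e \<noteq> 0" for x by (metis \<phi>.zero zero_neq_one)+
  define \<theta> where "\<theta> = (\<lambda>x. N (A x + e) + N (B x + e))"
  obtain C where C: "C > 0" "\<forall>x. N x \<le> C * norm x" using N_upper by blast
  obtain a where a: "a \<ge> 0" "\<And>x. norm (A x) \<le> norm x * a" using A.nonneg_bounded by blast
  obtain b' where b': "b' \<ge> 0" "\<And>x. norm (B x) \<le> norm x * b'" using B.nonneg_bounded by blast
  show ?thesis
  proof (rule that[of \<theta> "C * a + C * b' + 1"])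
    have "smooth p (\<lambda>x. N (A x + e)) UNIV" "smooth p (\<lambda>x. N (B x + e)) UNIV"
      by (rule smooth_affine[OF smooth_N A], simp, simp add: ne)
        (rule smooth_affine[OF smooth_N B], simp, simp add: ne)
    then show "smooth p \<theta> UNIV" unfolding \<theta>_def by (rule smooth_add)
    show "C * a + C * b' + 1 > 0" using C a b' by (simp add: add_nonneg_pos)
    fix x y :: 'a
    have "\<bar>N (A x + e) - N (A y + e)\<bar> \<le> N (A (x - y))" using N_diff[of "A x + e" "A y + e"] by (simp add: A.diff)
    also have "\<dots> \<le> C * norm (A (x - y))" using C by blast
    also have "\<dots> \<le> C * (norm (x - y) * a)" using C a by (intro mult_left_mono) auto
    finally have 1: "\<bar>N (A x + e) - N (A y + e)\<bar> \<le> (C * a) * norm (x - y)" by (simp add: ac_simps)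
    have "\<bar>N (B x + e) - N (B y + e)\<bar> \<le> N (B (x - y))" using N_diff[of "B x + e" "B y + e"] by (simp add: B.diff)
    also have "\<dots> \<le> C * norm (B (x - y))" using C by blast
    also have "\<dots> \<le> C * (norm (x - y) * b')" using C b' by (intro mult_left_mono) auto
    finally have 2: "\<bar>N (B x + e) - N (B y + e)\<bar> \<le> (C * b') * norm (x - y)" by (simp add: ac_simps)
    show "\<bar>\<theta> x - \<theta> y\<bar> \<le> (C * a + C * b' + 1) * norm (x - y)"
      using 1 2 norm_ge_zero[of "x - y"] unfolding \<theta>_def distrib_right by linarith
    fix t :: real assume t: "0 \<le> t" "t \<le> 1"
    have cvN: "N ((1 - t) *\<^sub>R u + t *\<^sub>R v) \<le> (1 - t) * N u + t * N v" for u v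
      using N_triangle[of "(1 - t) *\<^sub>R u" "t *\<^sub>R v"] t by (simp add: N_scale)
    have "A (x + t *\<^sub>R (y - x)) + e = (1 - t) *\<^sub>R (A x + e) + t *\<^sub>R (A y + e)"
      "B (x + t *\<^sub>R (y - x)) + e = (1 - t) *\<^sub>R (B x + e) + t *\<^sub>R (B y + e)"
      by (simp_all add: A.add A.scaleR A.diff B.add B.scaleR B.diff algebra_simps)
    then show "\<theta> (x + t *\<^sub>R (y - x)) \<le> (1 - t) * \<theta> x + t * \<theta> y"
      using cvN[of "A x + e" "A y + e"] cvN[of "B x + e" "B y + e"] unfolding \<theta>_def
      by (simp add: distrib_left)
  next
    fix y :: "nat \<Rightarrow> 'a" and x :: 'a
    assume lim: "(\<lambda>j. \<theta> (y j) / 2 + \<theta> x / 2 - \<theta> (x + (1/2) *\<^sub>R (y j - x))) \<longlonglongrightarrow> 0"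
    define s where "s = (\<lambda>j. N (A (y j) + e) + N (A x + e) - N ((A (y j) + e) + (A x + e)))"
    define r where "r = (\<lambda>j. N (B (y j) + e) + N (B x + e) - N ((B (y j) + e) + (B x + e)))"
    have half: "N ((1/2) *\<^sub>R u) = N u / 2" for u by (simp add: N_scale)
    have "A (x + (1/2) *\<^sub>R (y j - x)) + e = (1/2) *\<^sub>R ((A (y j) + e) + (A x + e))"
      "B (x + (1/2) *\<^sub>R (y j - x)) + e = (1/2) *\<^sub>R ((B (y j) + e) + (B x + e))" for j
    by (simp_all add: A.add A.scaleR A.diff B.add B.scaleR B.diff midpoint_shift[unfolded inverse_eq_divide])
    then have eq: "2 * (\<theta> (y j) / 2 + \<theta> x / 2 - \<theta> (x + (1/2) *\<^sub>R (y j - x))) = s j + r j" for j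
      unfolding \<theta>_def s_def r_def by (simp only: half) (simp add: field_simps)
    have nn: "s j \<ge> 0" "r j \<ge> 0" for j
      using N_triangle[of "A (y j) + e" "A x + e"] N_triangle[of "B (y j) + e" "B x + e"] by (simp_all add: s_def r_def)
    have "(\<lambda>j. 2 * (\<theta> (y j) / 2 + \<theta> x / 2 - \<theta> (x + (1/2) *\<^sub>R (y j - x)))) \<longlonglongrightarrow> 2 * 0"
      by (intro tendsto_mult tendsto_const lim)
    then have sr: "(\<lambda>j. s j + r j) \<longlonglongrightarrow> 0" by (simp only: eq mult_zero_right)
    have "s \<longlonglongrightarrow> 0" by (rule tendsto_sandwich[OF _ _ tendsto_const sr]) (use nn in auto)
    then have "(\<lambda>j. A (y j) + e) \<longlonglongrightarrow> A x + e"
      unfolding s_def by (intro LUR_hyperplane[OF \<phi>(1,2)] \<phi>1)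
    then have Al: "(\<lambda>j. A (y j)) \<longlonglongrightarrow> A x" using tendsto_diff[OF _ tendsto_const[of e]] by fastforce
    have "r \<longlonglongrightarrow> 0" by (rule tendsto_sandwich[OF _ _ tendsto_const sr]) (use nn in auto)
    then have "(\<lambda>j. B (y j) + e) \<longlonglongrightarrow> B x + e"
      unfolding r_def by (intro LUR_hyperplane[OF \<phi>(1,2)] \<phi>1)
    then have Bl: "(\<lambda>j. B (y j)) \<longlonglongrightarrow> B x" using tendsto_diff[OF _ tendsto_const[of e]] by fastforce
    \<comment> \<open>Since \<open>N b = 1\<close>, the functional \<psi> reads
      \<open>\<phi> z\<close> off \<open>B z\<close>; together with \<open>A\<close> this restores
      the vector.\<close>
    obtain \<psi> where \<psi>: "bounded_linear \<psi>" "\<psi> b = N b" using norming_functional[OF \<open>b \<noteq> 0\<close>] by blast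
    interpret \<psi>: bounded_linear \<psi> by (rule \<psi>(1))
    have "\<psi> (B z) = \<phi> z" for z by (simp add: B_def \<psi>.scaleR \<psi>(2) b)
    then have "(\<lambda>j. \<phi> (y j)) \<longlonglongrightarrow> \<phi> x" using \<psi>.tendsto[OF Bl] by simp
    then have "(\<lambda>j. A (y j) + \<phi> (y j) *\<^sub>R e) \<longlonglongrightarrow> A x + \<phi> x *\<^sub>R e"
      by (intro tendsto_add Al tendsto_scaleR tendsto_const)
    then show "y \<longlonglongrightarrow> x" by (simp add: A_def)
  qed
qed

end

text \<open>Turns the failure of a uniform smallness claim into a sequence, to which the convergence
  criteria for \<theta> apply.\<close>

lemma seq_counterexample:
  fixes Q :: "real \<Rightarrow> 'b \<Rightarrow> bool"
  assumes "\<not> (\<exists>\<eta>>0. \<forall>x. Q \<eta> x)"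
  shows "\<exists>x. \<forall>j::nat. \<not> Q (1 / real (Suc j)) (x j)"
proof (rule choice, rule allI)
  fix j :: nat
  have "1 / real (Suc j) > 0" by simp
  then show "\<exists>x. \<not> Q (1 / real (Suc j)) x" using assms by blast
qed

lemma tendsto_of_norm_less:
  fixes z :: "'a::real_normed_vector"
  assumes "\<And>j. norm (x j - z) < 1 / real (Suc j)"
  shows "x \<longlonglongrightarrow> z"
proof -
  have "(\<lambda>j. x j - z) \<longlonglongrightarrow> 0"
    by (rule Lim_null_comparison[OF _ LIMSEQ_Suc[OF lim_1_over_n]])
      (use assms in \<open>auto intro!: always_eventually less_imp_le\<close>)
  then show ?thesis by (rule LIM_zero_cancel)
qed

lemma inverse_Suc_tendsto: "(\<lambda>j. 1 / real (Suc j)) \<longlonglongrightarrow> 0"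
  by (rule LIMSEQ_Suc[OF lim_1_over_n])

locale lur_convex = smooth_LUR p N for p and N :: "'a::banach \<Rightarrow> real" +
  fixes \<theta> :: "'a \<Rightarrow> real" and L :: real
  assumes smooth_\<theta>: "smooth p \<theta> UNIV" and L_pos: "L > 0"
    and \<theta>_Lipschitz: "\<And>x y. \<bar>\<theta> x - \<theta> y\<bar> \<le> L * norm (x - y)"
    and \<theta>_convex: "\<And>x y t. 0 \<le> t \<Longrightarrow> t \<le> 1 \<Longrightarrow> \<theta> (x + t *\<^sub>R (y - x)) \<le> (1 - t) * \<theta> x + t * \<theta> y"
    and \<theta>_LUR: "\<And>(y :: nat \<Rightarrow> 'a) x. (\<lambda>j. \<theta> (y j) / 2 + \<theta> x / 2 - \<theta> (x + (1/2) *\<^sub>R (y j - x))) \<longlonglongrightarrow> 0 \<Longrightarrow> y \<longlonglongrightarrow> x"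
begin

definition grad :: "'a \<Rightarrow> 'a \<Rightarrow> real" where
  "grad x = frechet_derivative \<theta> (at x)"

lemma has_derivative_\<theta>: "(\<theta> has_derivative grad x) (at x)"
  unfolding grad_def using smooth_derivative(1)[OF smooth_\<theta> p1] by simp

lemma grad_continuous: "e > 0 \<Longrightarrow> \<forall>\<^sub>F y in nhds x. \<forall>h. \<bar>grad y h - grad x h\<bar> \<le> e * norm h"
  unfolding grad_def using smooth_derivative(2)[OF smooth_\<theta> p1] by simp

lemma bounded_linear_grad: "bounded_linear (grad x)"
  using has_derivative_\<theta> by (rule has_derivative_bounded_linear)

lemmas grad_add = linear_add[OF bounded_linear.linear[OF bounded_linear_grad]]
  and grad_diff = linear_diff[OF bounded_linear.linear[OF bounded_linear_grad]]
  and grad_scale = linear_scale[OF bounded_linear.linear[OF bounded_linear_grad]]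
  and grad_0 = linear_0[OF bounded_linear.linear[OF bounded_linear_grad]]

lemma grad_bound: "\<bar>grad x h\<bar> \<le> L * norm h"
proof (rule directional_derivative_bound[OF has_derivative_\<theta>])
  show "\<bar>\<theta> (x + t *\<^sub>R h) - \<theta> x\<bar> \<le> L * norm h * \<bar>t\<bar>" for t
    using \<theta>_Lipschitz[of "x + t *\<^sub>R h" x] by (simp add: ac_simps)
qed

lemma grad_ineq: "\<theta> x + grad x (y - x) \<le> \<theta> y"
  by (rule convex_gradient_ineq[OF has_derivative_\<theta> \<theta>_convex])

text \<open>The tangent at \<open>x\<close> bounds \<theta> from below at the midpoint too, so the
  midpoint gap in \<open>\<theta>_LUR\<close> is at most half the distance of
  \<open>\<theta> (y j)\<close> from that tangent.\<close>

lemma tendsto_by_gap: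
  assumes "\<alpha> \<longlonglongrightarrow> 0" "\<And>j. \<theta> (y j) - \<theta> x - grad x (y j - x) \<le> \<alpha> j"
  shows "y \<longlonglongrightarrow> x"
proof (rule \<theta>_LUR, rule tendsto_sandwich)
  show "\<forall>\<^sub>F j in sequentially. 0 \<le> \<theta> (y j) / 2 + \<theta> x / 2 - \<theta> (x + (1/2) *\<^sub>R (y j - x))"
    using \<theta>_convex[of "1/2" x "y _"] by (intro always_eventually allI) (simp add: algebra_simps)
  show "\<forall>\<^sub>F j in sequentially. \<theta> (y j) / 2 + \<theta> x / 2 - \<theta> (x + (1/2) *\<^sub>R (y j - x)) \<le> \<alpha> j / 2"
  proof (intro always_eventually allI)
    fix j
    have "\<theta> x + grad x (y j - x) / 2 \<le> \<theta> (x + (1/2) *\<^sub>R (y j - x))"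
      using grad_ineq[of x "x + (1/2) *\<^sub>R (y j - x)"] by (simp add: grad_scale)
    then show "\<theta> (y j) / 2 + \<theta> x / 2 - \<theta> (x + (1/2) *\<^sub>R (y j - x)) \<le> \<alpha> j / 2"
      using assms(2)[of j] by linarith
  qed
  show "(\<lambda>j. \<alpha> j / 2) \<longlonglongrightarrow> 0" using tendsto_divide[OF assms(1) tendsto_const[of 2]] by simp
qed (rule tendsto_const)

lemma tendsto_by_value_and_slope:
  assumes "\<alpha> \<longlonglongrightarrow> 0" "\<And>j. \<theta> (y j) \<le> \<theta> x + \<alpha> j" "(\<lambda>j. grad x (y j - x)) \<longlonglongrightarrow> 0"
  shows "y \<longlonglongrightarrow> x"
proof (rule tendsto_by_gap)
  show "(\<lambda>j. \<alpha> j - grad x (y j - x)) \<longlonglongrightarrow> 0" using tendsto_diff[OF assms(1,3)] by simp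
  show "\<theta> (y j) - \<theta> x - grad x (y j - x) \<le> \<alpha> j - grad x (y j - x)" for j using assms(2)[of j] by simp
qed

end

section \<open>Pushing the space off a flat set\<close>

locale flat_critical_set = lur_convex p N \<theta> L for p and N :: "'a::banach \<Rightarrow> real" and \<theta> L +
  fixes P :: "'a \<Rightarrow> 'a" and K :: "'a set"
  assumes P: "bounded_linear P" and PP: "\<And>x. P (P x) = P x"
    and K_closed: "closed K" and K_bounded: "bounded K"
    and K_flat: "\<And>c v. c \<in> K \<Longrightarrow> P v = 0 \<Longrightarrow> grad c v = 0"
begin

sublocale P: bounded_linear P by (rule P)

lemma grad_P: "c \<in> K \<Longrightarrow> grad c v = grad c (P v)"
  using K_flat[of c "v - P v"] by (simp add: P.diff PP grad_diff)

lemma tendsto_cap: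
  assumes "c \<in> K" "(\<lambda>j. P (x j)) \<longlonglongrightarrow> P c" "\<alpha> \<longlonglongrightarrow> 0" "\<And>j. \<theta> (x j) \<le> \<theta> c + \<alpha> j"
  shows "x \<longlonglongrightarrow> c"
proof (rule tendsto_by_value_and_slope[OF assms(3,4)])
  have "(\<lambda>j. grad c (P (x j) - P c)) \<longlonglongrightarrow> grad c (P c - P c)"
    by (intro bounded_linear.tendsto[OF bounded_linear_grad] tendsto_diff assms(2) tendsto_const)
  moreover have "grad c (P (x j) - P c) = grad c (x j - c)" for j
    using grad_P[OF assms(1), of "x j - c"] by (simp add: P.diff)
  ultimately show "(\<lambda>j. grad c (x j - c)) \<longlonglongrightarrow> 0" by (simp add: grad_0)
qed

text \<open>As \<open>grad c\<close> vanishes on the kernel of \<open>P\<close>, the point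
  \<open>c\<close> minimises \<theta> on its own fibre; between different fibres only the distance
  of the base points enters.\<close>

lemma value_le:
  assumes "c \<in> K" shows "\<theta> c \<le> \<theta> x + L * norm (P x - P c)"
  using grad_ineq[of c x] grad_P[OF assms, of "x - c"] grad_bound[of c "P x - P c"]
  by (simp add: P.diff)

text \<open>By \<open>value_le\<close> the values of \<theta> along the sequence are controlled by
  the base points, so rotundity applies at \<open>z\<close>. Hence \<open>P\<close> is injective on
  \<open>K\<close> with continuous inverse: \<open>K\<close> is a graph over its projection.\<close>

lemma tendsto_K:
  assumes "\<And>j. c j \<in> K" "z \<in> K" "(\<lambda>j. P (c j)) \<longlonglongrightarrow> P z"
  shows "c \<longlonglongrightarrow> z"
proof (rule tendsto_cap[OF assms(2,3)])
  show "\<theta> (c j) \<le> \<theta> z + L * norm (P z - P (c j))" for j using value_le[OF assms(1)] .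
  have "(\<lambda>j. L * norm (P z - P (c j))) \<longlonglongrightarrow> L * norm (P z - P z)"
    by (intro tendsto_intros assms(3))
  then show "(\<lambda>j. L * norm (P z - P (c j))) \<longlonglongrightarrow> 0" by simp
qed

text \<open>The sequence \<open>c\<close> need not be near \<open>x\<close>; the shift only has to
  be invisible to \<open>P\<close> and to \<open>grad z\<close> in the limit. This is the situation
  for shifts along the \<open>e k\<close> with \<open>k\<close> growing.\<close>

lemma tendsto_K_shift:
  assumes "\<And>j. c j \<in> K" "x \<longlonglongrightarrow> z" "(\<lambda>j. P (x j - c j)) \<longlonglongrightarrow> 0" "(\<lambda>j. grad z (x j - c j)) \<longlonglongrightarrow> 0"
  shows "c \<longlonglongrightarrow> z"
proof (rule tendsto_by_value_and_slope)
  show "\<theta> (c j) \<le> \<theta> z + L * norm (P z - P (c j))" for j using value_le[OF assms(1)] .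
  have "(\<lambda>j. L * norm (P (z - x j) + P (x j - c j))) \<longlonglongrightarrow> L * norm (P (z - z) + 0)"
    by (intro tendsto_intros P.tendsto assms(2,3))
  then show "(\<lambda>j. L * norm (P z - P (c j))) \<longlonglongrightarrow> 0" by (simp add: P.diff P.zero)
  have "(\<lambda>j. grad z (x j - z) - grad z (x j - c j)) \<longlonglongrightarrow> grad z (z - z) - 0"
    by (intro tendsto_intros bounded_linear.tendsto[OF bounded_linear_grad] assms(2,4))
  then show "(\<lambda>j. grad z (c j - z)) \<longlonglongrightarrow> 0" by (simp add: grad_diff grad_0)
qed

lemma cap_small:
  assumes "c \<in> K" "\<rho> > 0"
  shows "\<exists>\<eta>>0. \<forall>x. norm (P x - P c) < \<eta> \<and> \<theta> x < \<theta> c + \<eta> \<longrightarrow> x \<in> ball c \<rho>"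
proof (rule ccontr)
  assume "\<not> ?thesis"
  from seq_counterexample[OF this] obtain x where
    x: "\<forall>j::nat. \<not> (norm (P (x j) - P c) < 1 / real (Suc j) \<and> \<theta> (x j) < \<theta> c + 1 / real (Suc j) \<longrightarrow> x j \<in> ball c \<rho>)" ..
  then have 1: "norm (P (x j) - P c) < 1 / real (Suc j)" "\<theta> (x j) \<le> \<theta> c + 1 / real (Suc j)" "x j \<notin> ball c \<rho>" for j
    by (meson less_imp_le)+
  have "x \<longlonglongrightarrow> c"
    by (rule tendsto_cap[OF assms(1) tendsto_of_norm_less[OF 1(1)] inverse_Suc_tendsto 1(2)])
  then have "\<forall>\<^sub>F j in sequentially. dist (x j) c < \<rho>" using assms(2) by (rule tendstoD)
  then obtain j where "dist (x j) c < \<rho>" using eventually_happens' sequentially_bot by blast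
  then show False using 1(3)[of j] by (simp add: dist_commute)
qed

text \<open>Points of \<open>Z0\<close> whose projections approach \<open>P c\<close> would converge
  to \<open>c\<close> by \<open>tendsto_K\<close>, but \<open>c\<close> lies outside the closed
  \<open>Z0\<close>. The factor 2 keeps base points within \<eta> of \<open>P c\<close> at distance
  at least \<eta> from the projection of \<open>Z0\<close>.\<close>

lemma K_separated:
  assumes "closed Z0" "Z0 \<subseteq> K" "c \<in> K - Z0"
  shows "\<exists>\<eta>>0. \<forall>z. z \<in> Z0 \<longrightarrow> 2 * \<eta> \<le> norm (P c - P z)"
proof (rule ccontr)
  assume "\<not> ?thesis"
  from seq_counterexample[OF this] obtain z where
    "\<forall>j::nat. \<not> (z j \<in> Z0 \<longrightarrow> 2 * (1 / real (Suc j)) \<le> norm (P c - P (z j)))" ..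
  then have z: "z j \<in> Z0" "norm (P c - P (z j)) < 2 * (1 / real (Suc j))" for j by (meson not_le)+
  have "(\<lambda>j. 2 * (1 / real (Suc j))) \<longlonglongrightarrow> 2 * 0" by (intro tendsto_mult tendsto_const inverse_Suc_tendsto)
  then have l: "(\<lambda>j. 2 * (1 / real (Suc j))) \<longlonglongrightarrow> 0" by simp
  have "(\<lambda>j. P (z j) - P c) \<longlonglongrightarrow> 0"
    by (rule Lim_null_comparison[OF _ l]) (use z(2) in \<open>auto intro!: always_eventually less_imp_le simp: norm_minus_commute\<close>)
  then have Pz: "(\<lambda>j. P (z j)) \<longlonglongrightarrow> P c" by (rule LIM_zero_cancel)
  have zK: "z j \<in> K" for j using z(1) assms(2) by blast
  have "c \<in> K" using assms(3) by blast
  from tendsto_K[OF zK this Pz] have "z \<longlonglongrightarrow> c" .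
  with assms(1) z(1) have "c \<in> Z0" by (rule closed_sequentially)
  then show False using assms(3) by blast
qed

lemma K_values_near:
  assumes "c \<in> K" "e > 0"
  shows "\<exists>\<eta>>0. \<forall>z. z \<in> K \<and> norm (P z - P c) < \<eta> \<longrightarrow> \<theta> z < \<theta> c + e"
proof (intro exI[of _ "e / L"] conjI allI impI)
  show "e / L > 0" using assms L_pos by simp
  fix z assume "z \<in> K \<and> norm (P z - P c) < e / L"
  then have "\<theta> z \<le> \<theta> c + L * norm (P c - P z)" "norm (P c - P z) < e / L"
    using value_le[of z c] by (simp_all add: norm_minus_commute)
  moreover have "L * norm (P c - P z) < e" using calculation(2) L_pos by (simp add: pos_less_divide_eq mult.commute)
  ultimately show "\<theta> z < \<theta> c + e" by linarith
qed

end

text \<open>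
  \<open>Z0\<close> is the part of \<open>K\<close> already dealt with. Over the base \<open>V\<close>, the set \<open>\<theta> x < \<beta> (P x) + 2 g (P x)\<close>
  is the cap inside which everything happens; \<open>\<kappa> g\<close> is the length of the paths \<open>c + s e\<^sub>k\<close>, and
  \<open>t k\<close> is the width of the neighbourhood in which the \<open>k\<close>-th shear acts.
\<close>

locale extraction = flat_critical_set p N \<theta> L P K
  for p and N :: "'a::banach \<Rightarrow> real" and \<theta> L P K +
  fixes Z0 :: "'a set" and r \<eta> :: "'a \<Rightarrow> real" and V :: "'a set" and \<beta> g :: "'a \<Rightarrow> real"
    and \<kappa> C B :: real and e :: "nat \<Rightarrow> 'a" and f :: "nat \<Rightarrow> 'a \<Rightarrow> real" and t :: "nat \<Rightarrow> 'a \<Rightarrow> real"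
  assumes Z0: "closed Z0" "Z0 \<subseteq> K"
    and r: "\<And>c. c \<in> K - Z0 \<Longrightarrow> ball c (r c) \<inter> Z0 = {}"
    and V_open: "open V" and V_Z0: "\<And>z. z \<in> Z0 \<Longrightarrow> P z \<notin> V" and V_K: "\<And>c. c \<in> K - Z0 \<Longrightarrow> P c \<in> V"
    and \<beta>: "smooth p \<beta> V" and \<beta>_K: "\<And>c. c \<in> K - Z0 \<Longrightarrow> \<theta> c < \<beta> (P c)"
    and g: "smooth p g V" and g_pos: "\<And>q. q \<in> V \<Longrightarrow> 0 < g q" and g_le: "\<And>q. q \<in> V \<Longrightarrow> g q \<le> 1"
    and cap: "\<And>q. q \<in> V \<Longrightarrow> \<exists>c\<in>K - Z0. norm (q - P c) < \<eta> c \<and>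
       (\<forall>x. P x = q \<and> \<theta> x < \<beta> q + 2 * g q \<longrightarrow> x \<in> ball c (r c))"
    and \<eta>: "\<And>c z. c \<in> K - Z0 \<Longrightarrow> z \<in> Z0 \<Longrightarrow> 2 * \<eta> c \<le> norm (P c - P z)"
    and e_0: "e 0 = 0" and P_e: "\<And>k. P (e k) = 0" and N_e: "\<And>k. N (e k) \<le> 1"
    and e_null: "\<And>x. (\<lambda>k. grad x (e k)) \<longlonglongrightarrow> 0"
    and N_d: "\<And>k. 1 \<le> N (e (Suc k) - e k)"
    and N_segment: "\<And>k s. 1 \<le> k \<Longrightarrow> 1/3 \<le> N (e k + s *\<^sub>R (e (Suc k) - e k))"
    and f: "\<And>k. bounded_linear (f k)" "\<And>k h. \<bar>f k h\<bar> \<le> N h" "\<And>k. f k (e (Suc k) - e k) = 1"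
    and C: "C \<ge> 0" "\<And>s u. \<bar>step s - step u\<bar> \<le> C * \<bar>s - u\<bar>"
    and \<kappa>_pos: "\<kappa> > 0" and \<kappa>_path: "\<And>k. \<kappa> * (L * norm (e k)) \<le> 1"
    and \<kappa>_slope: "\<And>k. \<kappa> * (C * (L * norm (e (Suc k) - e k))) \<le> 1/2"
    and B: "B \<ge> 0" "\<And>x. norm (P x) \<le> B * norm x"
    and t: "\<And>k c. c \<in> K - Z0 \<Longrightarrow> 0 < t k c" "\<And>k c. c \<in> K - Z0 \<Longrightarrow> t k c \<le> (1/2) ^ k"
      "\<And>k c. c \<in> K - Z0 \<Longrightarrow> ball (P c) (2 * (B + 1) * t k c) \<subseteq> V"
begin

definition d where "d k = e (Suc k) - e k"
text \<open>The projection along \<open>d k\<close> onto the kernel of \<open>f k\<close>: functions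
  of \<open>proj k x\<close> are constant in the direction of the shear.\<close>

definition proj where "proj k x = x - f k x *\<^sub>R d k"
definition A where "A x = \<kappa> * g (P x)"
definition cutoff where "cutoff x = step ((\<beta> (P x) + 2 * g (P x) - \<theta> x) / g (P x))"
text \<open>Under \<open>proj k\<close> the segment from \<open>c + A c *\<^sub>R e k\<close> to
  \<open>c + A c *\<^sub>R e (Suc k)\<close> collapses to one point. These are the points over which
  the shear needs its full amplitude.\<close>

definition core where "core k = (\<lambda>c. proj k (c + A c *\<^sub>R e k)) ` (K - Z0)"
definition nbhd where "nbhd k = (\<Union>c\<in>K - Z0. ball (proj k (c + A c *\<^sub>R e k)) (t k c))"
definition cylinder where "cylinder = {x. P x \<in> V}"

sublocale f: bounded_linear "f k" for k by (rule f)

lemma f_d: "f k (d k) = 1" using f(3) by (simp add: d_def)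
lemma P_d: "P (d k) = 0" by (simp add: d_def P.diff P_e)
lemma P_proj: "P (proj k x) = P x" by (simp add: proj_def P.diff P.scaleR P_d)
lemma P_add_e: "P (x + s *\<^sub>R e k) = P x" by (simp add: P.add P.scaleR P_e)
lemma P_add_d: "P (x + s *\<^sub>R d k) = P x" by (simp add: P.add P.scaleR P_d)
lemma f_proj: "f k (proj k x) = 0" by (simp add: proj_def f.diff f.scaleR f_d)
lemma proj_proj: "proj k (proj k x) = proj k x" by (simp add: proj_def[of k "proj k x"] f_proj)
lemma proj_add_d: "proj k (x + s *\<^sub>R d k) = proj k x"
  by (simp add: proj_def f.add f.scaleR f_d algebra_simps)
lemma bounded_linear_proj: "bounded_linear (proj k)"
  unfolding proj_def by (intro bounded_linear_sub bounded_linear_ident bounded_linear_compose[OF bounded_linear_scaleR_left f(1)])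

lemma open_cylinder: "open cylinder"
  unfolding cylinder_def using open_vimage[OF V_open linear_continuous_on[OF P]] by (simp add: vimage_def)

lemma smooth_comp_P: "smooth p h V \<Longrightarrow> smooth p (\<lambda>x. h (P x)) cylinder"
  using smooth_affine[OF _ P open_cylinder, of p h V 0] by (simp add: cylinder_def)

lemma A_bounds: "x \<in> cylinder \<Longrightarrow> 0 < A x" "x \<in> cylinder \<Longrightarrow> A x \<le> \<kappa>"
  using g_pos g_le \<kappa>_pos by (auto simp: A_def cylinder_def mult_le_cancel_left1)

lemma K_cylinder: "c \<in> K - Z0 \<Longrightarrow> c \<in> cylinder"
  using V_K by (simp add: cylinder_def)

lemma A_isCont: "x \<in> cylinder \<Longrightarrow> isCont A x"
  unfolding A_def using smooth_isCont[OF smooth_comp_P[OF g]] by (intro continuous_intros) auto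

text \<open>Compactness is available only for scalars. The bound is uniform in \<open>k\<close> as
  well, so that it serves both a fixed shear and a sequence of shears.\<close>

lemma bounded_shift_coefficient:
  fixes c x :: "nat \<Rightarrow> 'a"
  assumes "\<And>j::nat. c j \<in> K - Z0" "convergent x"
  shows "\<exists>T. \<forall>j k. \<bar>f k (x j - c j - A (c j) *\<^sub>R e k)\<bar> \<le> T"
proof -
  obtain R where R: "\<And>z. z \<in> K \<Longrightarrow> norm z \<le> R" using K_bounded unfolding bounded_iff by blast
  obtain X where X: "\<And>j. norm (x j) \<le> X" using convergent_imp_Bseq[OF assms(2)] unfolding Bseq_def by blast
  obtain D where D: "D > 0" "\<forall>x. N x \<le> D * norm x" using N_upper by blast
  have "\<bar>f k (x j - c j - A (c j) *\<^sub>R e k)\<bar> \<le> D * (X + R) + \<kappa>" for j k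
  proof -
    have "\<bar>f k (x j - c j - A (c j) *\<^sub>R e k)\<bar> \<le> N (x j - c j - A (c j) *\<^sub>R e k)" by (rule f(2))
    also have "\<dots> \<le> N (x j - c j) + N (A (c j) *\<^sub>R e k)"
      using N_triangle[of "x j - c j" "- (A (c j) *\<^sub>R e k)"] N_minus by simp
    also have "N (x j - c j) \<le> D * norm (x j - c j)" using D by blast
    also have "D * norm (x j - c j) \<le> D * (X + R)"
      using X[of j] R[of "c j"] assms(1)[of j] D(1) norm_triangle_ineq4[of "x j" "c j"]
      by (intro mult_left_mono) auto
    also have "N (A (c j) *\<^sub>R e k) \<le> \<kappa> * 1"
    proof -
      have a: "0 < A (c j)" "A (c j) \<le> \<kappa>" using A_bounds K_cylinder[OF assms(1)[of j]] by auto
      then show ?thesis unfolding N_scale using N_e[of k] by (intro mult_mono) auto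
    qed
    finally show ?thesis by simp
  qed
  then show ?thesis by blast
qed

text \<open>Up to a null sequence, \<open>x j - c j\<close> is a combination of the two fixed
  vectors \<open>e k\<close> and \<open>d k\<close> with bounded coefficients. A subsequence of the
  coefficients converges, and with it \<open>c\<close>.\<close>

lemma line_limit:
  fixes c x :: "nat \<Rightarrow> 'a"
  assumes c: "\<And>j::nat. c j \<in> K - Z0" and x: "x \<longlonglongrightarrow> z"
    and lim: "(\<lambda>j. proj k (x j) - proj k (c j + A (c j) *\<^sub>R e k)) \<longlonglongrightarrow> 0"
  shows "\<exists>(s :: nat \<Rightarrow> nat) a z'. strict_mono s \<and> (\<lambda>j. A (c (s j))) \<longlonglongrightarrow> a \<and> z' \<in> K \<and>
    (\<lambda>j. c (s j)) \<longlonglongrightarrow> z' \<and> P z' = P z \<and> proj k z = proj k (z' + a *\<^sub>R e k)"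
proof -
  define \<tau> where "\<tau> j = f k (x j - c j - A (c j) *\<^sub>R e k)" for j
  have "convergent x" using x by (rule convergentI)
  from bounded_shift_coefficient[OF c this] obtain T where "\<forall>j k. \<bar>f k (x j - c j - A (c j) *\<^sub>R e k)\<bar> \<le> T" ..
  then have T: "\<bar>\<tau> j\<bar> \<le> T" for j unfolding \<tau>_def by simp
  have "norm (A (c j), \<tau> j) \<le> \<kappa> + T" for j
    using norm_Pair_le[of "A (c j)" "\<tau> j"] T[of j] A_bounds[OF K_cylinder[OF c[of j]]] by auto
  then have "bounded (range (\<lambda>j. (A (c j), \<tau> j)))" by (auto simp: bounded_iff)
  from bounded_imp_convergent_subsequence[OF this] obtain ab s where
    s: "strict_mono s" "((\<lambda>j. (A (c j), \<tau> j)) \<circ> s) \<longlonglongrightarrow> ab" by auto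
  define a where "a = fst ab"
  define b where "b = snd ab"
  have al: "(\<lambda>j. A (c (s j))) \<longlonglongrightarrow> a" and bl: "(\<lambda>j. \<tau> (s j)) \<longlonglongrightarrow> b"
    using tendsto_fst[OF s(2)] tendsto_snd[OF s(2)] by (simp_all add: a_def b_def o_def)
  have eq: "c j = x j - A (c j) *\<^sub>R e k - \<tau> j *\<^sub>R d k - (proj k (x j) - proj k (c j + A (c j) *\<^sub>R e k))" for j
    by (simp add: proj_def \<tau>_def f.diff f.add algebra_simps)
  define z' where "z' = z - a *\<^sub>R e k - b *\<^sub>R d k"
  have "(\<lambda>j. x (s j) - A (c (s j)) *\<^sub>R e k - \<tau> (s j) *\<^sub>R d k - (proj k (x (s j)) - proj k (c (s j) + A (c (s j)) *\<^sub>R e k)))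
     \<longlonglongrightarrow> z - a *\<^sub>R e k - b *\<^sub>R d k - 0"
    by (intro tendsto_intros al bl LIMSEQ_subseq_LIMSEQ[OF x s(1), unfolded o_def] LIMSEQ_subseq_LIMSEQ[OF lim s(1), unfolded o_def])
  then have cl: "(\<lambda>j. c (s j)) \<longlonglongrightarrow> z'" by (simp only: eq[symmetric] z'_def diff_0_right)
  have "z' \<in> K" by (rule closed_sequentially[OF K_closed _ cl]) (use c in blast)
  moreover have "P z' = P z" by (simp add: z'_def P.diff P.scaleR P_e P_d)
  moreover have "proj k z = proj k (z' + a *\<^sub>R e k)"
  proof -
    have "z = (z' + a *\<^sub>R e k) + b *\<^sub>R d k" by (simp add: z'_def)
    then show ?thesis using proj_add_d by metis
  qed
  ultimately show ?thesis using s(1) al cl by (intro exI[of _ s] exI[of _ a] exI[of _ z']) simp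
qed

text \<open>By \<open>line_limit\<close> a limit of core points comes from a point of
  \<open>K\<close> over the same base point; over \<open>V\<close> this point cannot lie in
  \<open>Z0\<close>, so it belongs to the core again.\<close>

lemma core_closed:
  assumes y: "y \<in> cylinder" "y \<notin> core k"
  shows "\<exists>T. open T \<and> y \<in> T \<and> T \<inter> core k = {}"
proof (rule ccontr)
  assume a: "\<not> ?thesis"
  have "\<exists>c. c \<in> K - Z0 \<and> norm (proj k (c + A c *\<^sub>R e k) - y) < 1 / real (Suc j)" for j :: nat
  proof -
    have "ball y (1 / real (Suc j)) \<inter> core k \<noteq> {}"
      using a[unfolded not_ex, rule_format, of "ball y (1 / real (Suc j))"] by simp
    then show ?thesis by (auto simp: core_def dist_norm norm_minus_commute)
  qed
  then obtain c where c: "\<And>j. c j \<in> K - Z0" "\<And>j::nat. norm (proj k (c j + A (c j) *\<^sub>R e k) - y) < 1 / real (Suc j)"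
    by metis
  define x where "x j = proj k (c j + A (c j) *\<^sub>R e k)" for j
  have x: "x \<longlonglongrightarrow> y" using c(2) unfolding x_def by (rule tendsto_of_norm_less)
  have "(\<lambda>j. proj k (x j) - proj k (c j + A (c j) *\<^sub>R e k)) \<longlonglongrightarrow> 0" by (simp add: x_def proj_proj)
  from line_limit[OF c(1) x this] obtain s and b :: real and z' where s: "strict_mono s" "(\<lambda>j. A (c (s j))) \<longlonglongrightarrow> b"
    "z' \<in> K" "(\<lambda>j. c (s j)) \<longlonglongrightarrow> z'" "P z' = P y" "proj k y = proj k (z' + b *\<^sub>R e k)" by metis
  have z': "z' \<in> K - Z0" using s(3,5) V_Z0[of z'] y(1) by (auto simp: cylinder_def)
  have "(\<lambda>j. A (c (s j))) \<longlonglongrightarrow> A z'" using isCont_tendsto_compose[OF A_isCont[OF K_cylinder[OF z']] s(4)] .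
  then have "b = A z'" using s(2) LIMSEQ_unique by blast
  moreover have "proj k y = y"
  proof -
    have "(\<lambda>j. f k (x j)) \<longlonglongrightarrow> f k y" by (rule f.tendsto[OF x])
    then have "(\<lambda>j::nat. 0::real) \<longlonglongrightarrow> f k y" by (simp add: x_def f_proj)
    then have "f k y = 0" using LIMSEQ_unique tendsto_const by blast
    then show ?thesis by (simp add: proj_def)
  qed
  ultimately show False using s(6) z' y(2) by (auto simp: core_def)
qed

definition bump where
  "bump k = (SOME \<alpha>. smooth p \<alpha> cylinder \<and> (\<forall>y\<in>cylinder. 0 \<le> \<alpha> y \<and> \<alpha> y \<le> 1 \<and>
     (y \<in> core k \<longrightarrow> \<alpha> y = 1) \<and> (y \<notin> nbhd k \<longrightarrow> \<alpha> y = 0)))"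

text \<open>An instance of \<open>selection\<close>: near the core the constant 1 is admissible
  because \<open>nbhd k\<close> is open, off the core the constant 0 is, by
  \<open>core_closed\<close>.\<close>

lemma bump: "smooth p (bump k) cylinder"
  "y \<in> cylinder \<Longrightarrow> 0 \<le> bump k y" "y \<in> cylinder \<Longrightarrow> bump k y \<le> 1"
  "y \<in> cylinder \<Longrightarrow> y \<in> core k \<Longrightarrow> bump k y = 1"
  "y \<in> cylinder \<Longrightarrow> y \<notin> nbhd k \<Longrightarrow> bump k y = 0"
proof -
  define \<Phi> where "\<Phi> y = {u::real. 0 \<le> u \<and> u \<le> 1 \<and> (y \<in> core k \<longrightarrow> u = 1) \<and> (y \<notin> nbhd k \<longrightarrow> u = 0)}" for y
  have cn: "core k \<subseteq> nbhd k" using t(1) by (auto simp: core_def nbhd_def)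
  have on: "open (nbhd k)" by (auto simp: nbhd_def)
  have "\<exists>\<alpha>. smooth p \<alpha> cylinder \<and> (\<forall>y\<in>cylinder. \<alpha> y \<in> \<Phi> y)"
  proof -
    have cv: "convex (\<Phi> y)" for y
      unfolding is_interval_convex_1[symmetric] is_interval_1 \<Phi>_def by auto
    have lc: "\<exists>T u. open T \<and> y \<in> T \<and> (\<forall>z\<in>T \<inter> cylinder. u \<in> \<Phi> z)" if y: "y \<in> cylinder" for y
    proof (cases "y \<in> core k")
      case True
      then show ?thesis using on cn by (intro exI[of _ "nbhd k"] exI[of _ 1]) (auto simp: \<Phi>_def)
    next
      case False
      then obtain T where "open T" "y \<in> T" "T \<inter> core k = {}" using core_closed[OF y] by blast
      then show ?thesis by (intro exI[of _ T] exI[of _ 0]) (auto simp: \<Phi>_def)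
    qed
    obtain \<alpha> where "smooth p \<alpha> cylinder" "\<And>y. y \<in> cylinder \<Longrightarrow> \<alpha> y \<in> \<Phi> y"
      using selection[where Y = cylinder and \<Phi> = \<Phi>, OF open_cylinder cv lc] by blast
    then show ?thesis by blast
  qed
  then have "\<exists>\<alpha>. smooth p \<alpha> cylinder \<and> (\<forall>y\<in>cylinder. 0 \<le> \<alpha> y \<and> \<alpha> y \<le> 1 \<and>
     (y \<in> core k \<longrightarrow> \<alpha> y = 1) \<and> (y \<notin> nbhd k \<longrightarrow> \<alpha> y = 0))" by (simp add: \<Phi>_def)
  from someI_ex[OF this, folded bump_def]
  show "smooth p (bump k) cylinder" "y \<in> cylinder \<Longrightarrow> 0 \<le> bump k y" "y \<in> cylinder \<Longrightarrow> bump k y \<le> 1"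
    "y \<in> cylinder \<Longrightarrow> y \<in> core k \<Longrightarrow> bump k y = 1" "y \<in> cylinder \<Longrightarrow> y \<notin> nbhd k \<Longrightarrow> bump k y = 0"
    by blast+
qed

section \<open>The amplitude of the shears and the limits of its supports\<close>

definition a where "a k x = (if x \<in> cylinder then A x * bump k (proj k x) * cutoff x else 0)"
definition trap where "trap = {x \<in> cylinder. \<theta> x < \<beta> (P x) + 2 * g (P x)}"

lemma proj_cylinder: "proj k x \<in> cylinder \<longleftrightarrow> x \<in> cylinder"
  by (simp add: cylinder_def P_proj)

lemma a_nonzero:
  assumes "a k x \<noteq> 0"
  shows "x \<in> trap" "\<exists>c\<in>K - Z0. norm (proj k x - proj k (c + A c *\<^sub>R e k)) < t k c"
proof -
  have x: "x \<in> cylinder" "bump k (proj k x) \<noteq> 0" "cutoff x \<noteq> 0" using assms by (auto simp: a_def split: if_splits)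
  have gp: "g (P x) > 0" using x(1) g_pos by (simp add: cylinder_def)
  have "\<not> (\<beta> (P x) + 2 * g (P x) - \<theta> x) / g (P x) \<le> 0"
    using x(3) step_eq_0 by (auto simp: cutoff_def)
  then show "x \<in> trap" using x(1) gp by (simp add: trap_def divide_le_eq zero_less_divide_iff not_le)
  have "proj k x \<in> nbhd k" using bump(5) x(1,2) proj_cylinder by blast
  then show "\<exists>c\<in>K - Z0. norm (proj k x - proj k (c + A c *\<^sub>R e k)) < t k c"
    by (auto simp: nbhd_def dist_norm norm_minus_commute)
qed

lemma trap_ball: "q \<in> V \<Longrightarrow> \<exists>c\<in>K - Z0. norm (q - P c) < \<eta> c \<and> (\<forall>x\<in>trap. P x = q \<longrightarrow> x \<in> ball c (r c))"
  using cap[of q] by (auto simp: trap_def)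

lemma trap_not_Z0: "x \<in> trap \<Longrightarrow> x \<notin> Z0"
  using V_Z0 by (auto simp: trap_def cylinder_def)

text \<open>Over a boundary point of \<open>V\<close>, \<open>line_limit\<close> yields a point
  \<open>z'\<close> of \<open>K\<close>, necessarily in \<open>Z0\<close>. The caps that contain the
  \<open>x j\<close> lie in balls missing \<open>Z0\<close>; as their centres tend to
  \<open>z'\<close>, so do the \<open>x j\<close>, and \<open>z\<close> would be in
  \<open>Z0\<close>.\<close>

lemma a_support_limit_const:
  assumes x: "x \<longlonglongrightarrow> z" and nz: "\<And>j::nat. a k (x j) \<noteq> 0" and z: "z \<notin> Z0"
  shows "z \<in> cylinder"
proof (rule ccontr)
  assume "z \<notin> cylinder"
  then have Pz: "P z \<notin> V" by (simp add: cylinder_def)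
  obtain c where c: "\<And>j. c j \<in> K - Z0" "\<And>j. norm (proj k (x j) - proj k (c j + A (c j) *\<^sub>R e k)) < t k (c j)"
    using a_nonzero(2)[OF nz] by metis
  have Px: "(\<lambda>j. P (x j)) \<longlonglongrightarrow> P z" by (rule P.tendsto[OF x])
  \<comment> \<open>\<open>P z\<close> is at distance at least \<open>2 * (B + 1) * t\<close> from
    \<open>P (c j)\<close>, while \<open>P (x j)\<close> is within \<open>B * t\<close> of it. The
    remaining \<open>(B + 2) * t\<close> bounds the width by a null sequence.\<close>
  have tb: "t k (c j) \<le> norm (P (x j) - P z)" for j
  proof -
    have "norm (P (x j) - P (c j)) = norm (P (proj k (x j) - proj k (c j + A (c j) *\<^sub>R e k)))"
      by (simp add: P.diff P_proj P_add_e)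
    also have "\<dots> \<le> B * t k (c j)"
      using B order_trans[OF B(2) mult_left_mono[OF less_imp_le[OF c(2)[of j]] B(1)]] by blast
    finally have 1: "norm (P (x j) - P (c j)) \<le> B * t k (c j)" .
    have "P z \<notin> ball (P (c j)) (2 * (B + 1) * t k (c j))" using t(3)[OF c(1)] Pz by blast
    then have "2 * (B + 1) * t k (c j) \<le> norm (P (c j) - P z)" by (simp add: dist_norm)
    also have "\<dots> \<le> norm (P (x j) - P (c j)) + norm (P (x j) - P z)"
      using norm_triangle_ineq4[of "P (x j) - P z" "P (x j) - P (c j)"] by simp
    finally have "2 * (B + 1) * t k (c j) \<le> B * t k (c j) + norm (P (x j) - P z)" using 1 by linarith
    then have "(B + 2) * t k (c j) \<le> norm (P (x j) - P z)" by (simp add: algebra_simps)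
    moreover have "1 * t k (c j) \<le> (B + 2) * t k (c j)" using B(1) t(1)[OF c(1)[of j], of k] by (intro mult_right_mono) auto
    ultimately show ?thesis by simp
  qed
  have n0: "(\<lambda>j. norm (P (x j) - P z)) \<longlonglongrightarrow> 0" using Px by (simp add: LIM_zero_iff tendsto_norm_zero_iff)
  have "(\<lambda>j. proj k (x j) - proj k (c j + A (c j) *\<^sub>R e k)) \<longlonglongrightarrow> 0"
    by (rule Lim_null_comparison[OF _ n0]) (intro always_eventually allI order_trans[OF less_imp_le[OF c(2)] tb])
  from line_limit[OF c(1) x this] obtain z' where z': "z' \<in> K" "P z' = P z" by metis
  then have zZ: "z' \<in> Z0" using V_K[of z'] Pz by auto
  have "P (x j) \<in> V" for j using a_nonzero(1)[OF nz] by (simp add: trap_def cylinder_def)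
  then have "\<exists>c. c \<in> K - Z0 \<and> norm (P (x j) - P c) < \<eta> c \<and> (\<forall>y\<in>trap. P y = P (x j) \<longrightarrow> y \<in> ball c (r c))" for j
    using trap_ball by blast
  then obtain w where w': "\<And>j. w j \<in> K - Z0 \<and> norm (P (x j) - P (w j)) < \<eta> (w j) \<and>
      (\<forall>y\<in>trap. P y = P (x j) \<longrightarrow> y \<in> ball (w j) (r (w j)))" by metis
  then have w: "w j \<in> K - Z0" "norm (P (x j) - P (w j)) < \<eta> (w j)"
    "y \<in> trap \<Longrightarrow> P y = P (x j) \<Longrightarrow> y \<in> ball (w j) (r (w j))" for j y by blast+
  \<comment> \<open>The tolerance \<open>\<eta> (w j)\<close> is at most half the distance on the
    left, so the triangle inequality can absorb it.\<close>
  have wb: "norm (P (w j) - P z) \<le> 2 * norm (P (x j) - P z)" for j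
  proof -
    have "2 * \<eta> (w j) \<le> norm (P (w j) - P z)" using \<eta>[OF w(1) zZ] z'(2) by simp
    moreover have "norm (P (w j) - P z) \<le> norm (P (x j) - P (w j)) + norm (P (x j) - P z)"
      using norm_triangle_ineq4[of "P (x j) - P z" "P (x j) - P (w j)"] by simp
    ultimately show ?thesis using w(2)[of j] by linarith
  qed
  have n2: "(\<lambda>j. 2 * norm (P (x j) - P z)) \<longlonglongrightarrow> 0" using tendsto_mult_right_zero[OF n0] .
  have "(\<lambda>j. P (w j) - P z) \<longlonglongrightarrow> 0"
    by (rule Lim_null_comparison[OF _ n2]) (intro always_eventually allI wb)
  then have Pw: "(\<lambda>j. P (w j)) \<longlonglongrightarrow> P z'" unfolding z'(2) by (rule LIM_zero_cancel)
  have wK: "w j \<in> K" for j using w(1) by blast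
  have wl: "w \<longlonglongrightarrow> z'" by (rule tendsto_K[OF wK z'(1) Pw])
  have xb: "norm (x j - w j) \<le> norm (w j - z')" for j
  proof -
    have "x j \<in> ball (w j) (r (w j))" using w(3)[OF a_nonzero(1)[OF nz]] by blast
    moreover have "z' \<notin> ball (w j) (r (w j))" using r[OF w(1)] zZ by blast
    ultimately show ?thesis by (simp add: dist_norm norm_minus_commute)
  qed
  have "(\<lambda>j. norm (w j - z')) \<longlonglongrightarrow> 0" using wl by (simp add: LIM_zero_iff tendsto_norm_zero_iff)
  then have "(\<lambda>j. x j - w j) \<longlonglongrightarrow> 0"
    by (rule Lim_null_comparison[rotated]) (intro always_eventually allI xb)
  from tendsto_add[OF this wl] have "x \<longlonglongrightarrow> z'" by simp
  then have "z = z'" using x LIMSEQ_unique by blast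
  then show False using z zZ by blast
qed

text \<open>Along \<open>e (k j)\<close> and \<open>d (k j)\<close> the functional
  \<open>grad z\<close> tends to 0, so the centres \<open>c j\<close> converge to \<open>z\<close>
  by \<open>tendsto_K_shift\<close>. Then \<open>v j\<close> tends to 0, although the lines through
  consecutive \<open>e k\<close> stay away from the origin.\<close>

lemma a_support_limit_infinity:
  assumes x: "x \<longlonglongrightarrow> z" and nz: "\<And>j::nat. a (k j) (x j) \<noteq> 0" and k: "\<And>j. j < k j" and z: "z \<notin> Z0"
  shows False
proof -
  obtain c where c: "\<And>j. c j \<in> K - Z0" "\<And>j. norm (proj (k j) (x j) - proj (k j) (c j + A (c j) *\<^sub>R e (k j))) < t (k j) (c j)"
    using a_nonzero(2)[OF nz] by metis
  define \<rho> where "\<rho> j = proj (k j) (x j) - proj (k j) (c j + A (c j) *\<^sub>R e (k j))" for j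
  define \<tau> where "\<tau> j = f (k j) (x j - c j - A (c j) *\<^sub>R e (k j))" for j
  define v where "v j = A (c j) *\<^sub>R e (k j) + \<tau> j *\<^sub>R d (k j)" for j
  have eq: "x j - c j = \<rho> j + v j" for j
    by (simp add: \<rho>_def v_def \<tau>_def proj_def f.diff f.add algebra_simps)
  have "norm (\<rho> j) \<le> (1/2) ^ j" for j
  proof -
    have "norm (\<rho> j) \<le> (1/2) ^ k j" using c(2)[of j] t(2)[OF c(1)[of j], of "k j"] unfolding \<rho>_def by linarith
    also have "\<dots> \<le> (1/2) ^ j" using k[of j] by (intro power_decreasing) auto
    finally show ?thesis .
  qed
  then have \<rho>: "\<rho> \<longlonglongrightarrow> 0"
    by (intro Lim_null_comparison[OF _ LIMSEQ_power_zero[of "1/2::real"]]) auto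
  have "convergent x" using x by (rule convergentI)
  from bounded_shift_coefficient[where c = c and x = x, OF c(1) this] obtain T where
    "\<forall>j k. \<bar>f k (x j - c j - A (c j) *\<^sub>R e k)\<bar> \<le> T" ..
  then have T: "\<bar>\<tau> j\<bar> \<le> T" for j unfolding \<tau>_def by simp
  have kl: "filterlim k at_top sequentially"
    by (rule filterlim_at_top_mono[OF filterlim_ident]) (use k in \<open>auto intro!: always_eventually less_imp_le\<close>)
  have ek: "(\<lambda>j. grad z (e (k j))) \<longlonglongrightarrow> 0" using filterlim_compose[OF e_null kl] .
  have "filterlim (\<lambda>j. Suc (k j)) at_top sequentially" by (rule filterlim_compose[OF filterlim_Suc kl])
  from filterlim_compose[OF e_null this] have ek1: "(\<lambda>j. grad z (e (Suc (k j)))) \<longlonglongrightarrow> 0" .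
  have dk: "(\<lambda>j. grad z (d (k j))) \<longlonglongrightarrow> 0" using tendsto_diff[OF ek1 ek] by (simp add: d_def grad_diff)
  have "(\<lambda>j. A (c j) * grad z (e (k j))) \<longlonglongrightarrow> 0"
  proof (rule Lim_null_comparison)
    show "(\<lambda>j. \<kappa> * \<bar>grad z (e (k j))\<bar>) \<longlonglongrightarrow> 0" using tendsto_mult_right_zero[OF tendsto_rabs_zero[OF ek]] .
    show "\<forall>\<^sub>F j in sequentially. norm (A (c j) * grad z (e (k j))) \<le> \<kappa> * \<bar>grad z (e (k j))\<bar>"
    proof (intro always_eventually allI)
      fix j show "norm (A (c j) * grad z (e (k j))) \<le> \<kappa> * \<bar>grad z (e (k j))\<bar>"
        using A_bounds[OF K_cylinder[OF c(1)[of j]]] by (simp add: abs_mult mult_right_mono)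
    qed
  qed
  moreover have "(\<lambda>j. \<tau> j * grad z (d (k j))) \<longlonglongrightarrow> 0"
  proof (rule Lim_null_comparison)
    show "(\<lambda>j. T * \<bar>grad z (d (k j))\<bar>) \<longlonglongrightarrow> 0" using tendsto_mult_right_zero[OF tendsto_rabs_zero[OF dk]] .
    show "\<forall>\<^sub>F j in sequentially. norm (\<tau> j * grad z (d (k j))) \<le> T * \<bar>grad z (d (k j))\<bar>"
      using T by (intro always_eventually allI) (simp add: abs_mult mult_right_mono)
  qed
  ultimately have "(\<lambda>j. grad z (\<rho> j) + (A (c j) * grad z (e (k j)) + \<tau> j * grad z (d (k j)))) \<longlonglongrightarrow> grad z 0 + (0 + 0)"
    by (intro tendsto_add bounded_linear.tendsto[OF bounded_linear_grad \<rho>])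
  then have g1: "(\<lambda>j. grad z (x j - c j)) \<longlonglongrightarrow> 0" by (simp add: eq v_def grad_add grad_scale grad_0)
  have "P (v j) = 0" for j by (simp add: v_def P.add P.scaleR P_e P_d)
  then have "P (x j - c j) = P (\<rho> j)" for j by (simp only: eq P.add) simp
  then have g2: "(\<lambda>j. P (x j - c j)) \<longlonglongrightarrow> 0" using P.tendsto[OF \<rho>] by (simp add: P.zero)
  have cK: "c j \<in> K" for j using c(1) by blast
  have cz: "c \<longlonglongrightarrow> z" by (rule tendsto_K_shift[OF cK x g2 g1])
  have "z \<in> K" by (rule closed_sequentially[OF K_closed _ cz]) (rule cK)
  then have zK: "z \<in> K - Z0" using z by blast
  have Al: "(\<lambda>j. A (c j)) \<longlonglongrightarrow> A z" using isCont_tendsto_compose[OF A_isCont[OF K_cylinder[OF zK]] cz] .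
  have "(\<lambda>j. x j - c j - \<rho> j) \<longlonglongrightarrow> z - z - 0" by (intro tendsto_diff x cz \<rho>)
  then have "v \<longlonglongrightarrow> 0" by (simp add: eq)
  obtain D where D: "D > 0" "\<forall>x. N x \<le> D * norm x" using N_upper by blast
  have "(\<lambda>j. D * norm (v j)) \<longlonglongrightarrow> 0"
    using tendsto_mult_right_zero[OF tendsto_norm_zero[OF \<open>v \<longlonglongrightarrow> 0\<close>]] .
  moreover have "(\<lambda>j. A (c j) / 3) \<longlonglongrightarrow> A z / 3" by (intro tendsto_divide Al tendsto_const) auto
  \<comment> \<open>Divided by \<open>A (c j)\<close>, the vector \<open>v j\<close> is a point of
    the line through \<open>e (k j)\<close> and \<open>e (Suc (k j))\<close>, where
    \<open>N_segment\<close> applies because \<open>k j \<ge> 1\<close>.\<close>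
  moreover have "A (c j) / 3 \<le> D * norm (v j)" for j
  proof -
    have pos: "A (c j) > 0" using A_bounds K_cylinder[OF c(1)] by blast
    have "v j = A (c j) *\<^sub>R (e (k j) + (\<tau> j / A (c j)) *\<^sub>R d (k j))" using pos by (simp add: v_def scaleR_right_distrib)
    then have "N (v j) = A (c j) * N (e (k j) + (\<tau> j / A (c j)) *\<^sub>R d (k j))" using pos by (simp add: N_scale)
    also have "\<dots> \<ge> A (c j) * (1/3)"
      using pos N_segment[of "k j"] k[of j] unfolding d_def by (intro mult_left_mono) auto
    finally show ?thesis using D(2)[rule_format, of "v j"] by simp
  qed
  ultimately have "A z / 3 \<le> 0" by (intro LIMSEQ_le) auto
  then show False using A_bounds(1)[OF K_cylinder[OF zK]] by simp
qed

lemma a_locally_zero: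
  assumes z: "z \<notin> Z0" "z \<notin> cylinder"
  shows "\<exists>T. open T \<and> z \<in> T \<and> (\<forall>y\<in>T. a k y = 0)"
proof (rule ccontr)
  assume n: "\<not> ?thesis"
  have "\<exists>y. a k y \<noteq> 0 \<and> norm (y - z) < 1 / real (Suc j)" for j :: nat
    using n[unfolded not_ex, rule_format, of "ball z (1 / real (Suc j))"] by (auto simp: dist_norm norm_minus_commute)
  then obtain x where x: "\<And>j::nat. a k (x j) \<noteq> 0 \<and> norm (x j - z) < 1 / real (Suc j)" by metis
  then have "x \<longlonglongrightarrow> z" by (intro tendsto_of_norm_less) blast
  then show False using a_support_limit_const[of x z k] x z by blast
qed

lemma a_locally_finite:
  assumes z: "z \<notin> Z0"
  shows "\<exists>T n. open T \<and> z \<in> T \<and> (\<forall>k\<ge>n. \<forall>y\<in>T. a k y = 0)"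
proof (rule ccontr)
  assume n: "\<not> ?thesis"
  have "\<exists>k y. j < k \<and> a k y \<noteq> 0 \<and> norm (y - z) < 1 / real (Suc j)" for j :: nat
  proof -
    have "\<not> (\<forall>k\<ge>Suc j. \<forall>y\<in>ball z (1 / real (Suc j)). a k y = 0)"
      using n[unfolded not_ex, rule_format, of "ball z (1 / real (Suc j))" "Suc j"] by simp
    then obtain k y where "Suc j \<le> k" "y \<in> ball z (1 / real (Suc j))" "a k y \<noteq> 0" by blast
    then show ?thesis by (intro exI[of _ k] exI[of _ y]) (simp add: dist_norm norm_minus_commute)
  qed
  then obtain k x where x: "\<And>j::nat. j < k j \<and> a (k j) (x j) \<noteq> 0 \<and> norm (x j - z) < 1 / real (Suc j)" by metis
  then have "x \<longlonglongrightarrow> z" by (intro tendsto_of_norm_less) blast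
  then show False using a_support_limit_infinity[of x z k] x z by blast
qed

lemma open_compl_Z0: "open (- Z0)" using Z0(1) by (rule open_Compl)

lemma smooth_a: "smooth p (a k) (- Z0)"
proof (rule smooth_local)
  fix z assume z: "z \<in> - Z0"
  show "\<exists>T. z \<in> T \<and> T \<subseteq> - Z0 \<and> smooth p (a k) T"
  proof (cases "z \<in> cylinder")
    case True
    let ?T = "cylinder \<inter> - Z0"
    have oT: "open ?T" using open_cylinder open_compl_Z0 by blast
    have gnz: "g (P x) \<noteq> 0" if "x \<in> cylinder" for x using that g_pos[of "P x"] by (auto simp: cylinder_def)
    have c: "smooth p cutoff cylinder"
      unfolding cutoff_def
      by (intro smooth_step smooth_divide smooth_diff smooth_add smooth_mult smooth_const smooth_comp_P
          \<beta> g open_cylinder smooth_subset[OF smooth_\<theta> open_cylinder] gnz subset_UNIV)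
    have b: "smooth p (\<lambda>x. bump k (proj k x)) cylinder"
      using smooth_affine[where b = 0, OF bump(1) bounded_linear_proj open_cylinder, of k k] by (simp add: proj_cylinder)
    have "smooth p (\<lambda>x. A x * bump k (proj k x) * cutoff x) cylinder"
      unfolding A_def by (intro smooth_mult c b smooth_const open_cylinder smooth_comp_P g)
    from smooth_subset[OF this oT] have "smooth p (\<lambda>x. A x * bump k (proj k x) * cutoff x) ?T" by simp
    then have "smooth p (a k) ?T" by (rule smooth_cong) (simp add: a_def)
    then show ?thesis using True z by (intro exI[of _ ?T]) simp
  next
    case False
    obtain T where T: "open T" "z \<in> T" "\<forall>y\<in>T. a k y = 0" using a_locally_zero[OF _ False] z by blast
    have o: "open (T \<inter> - Z0)" using T(1) open_compl_Z0 by blast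
    have "smooth p (a k) (T \<inter> - Z0)" by (rule smooth_cong[OF smooth_const[OF o, of p 0]]) (use T(3) in simp)
    then show ?thesis using T(2) z by (intro exI[of _ "T \<inter> - Z0"]) simp
  qed
qed

text \<open>Along \<open>d k\<close> only the cutoff varies. Its slope contains
  \<open>1 / g (P x)\<close>, which the factor \<open>g (P x)\<close> of \<open>A x\<close> cancels,
  so the bound does not deteriorate where the caps become thin.\<close>

lemma a_slope: "\<bar>a k (x + s *\<^sub>R d k) - a k x\<bar> \<le> 1/2 * \<bar>s\<bar>"
proof (cases "x \<in> cylinder")
  case False
  then show ?thesis by (simp add: a_def cylinder_def P_add_d)
next
  case True
  let ?y = "x + s *\<^sub>R d k"
  have y: "?y \<in> cylinder" using True by (simp add: cylinder_def P_add_d)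
  have Ay: "A ?y = A x" by (simp add: A_def P_add_d)
  have gp: "g (P x) > 0" using True g_pos by (simp add: cylinder_def)
  have b: "0 \<le> bump k (proj k x)" "bump k (proj k x) \<le> 1" using bump(2,3) True proj_cylinder by blast+
  have "\<bar>cutoff ?y - cutoff x\<bar> \<le> C * \<bar>(\<beta> (P x) + 2 * g (P x) - \<theta> ?y) / g (P x) - (\<beta> (P x) + 2 * g (P x) - \<theta> x) / g (P x)\<bar>"
    unfolding cutoff_def P_add_d by (rule C(2))
  also have "(\<beta> (P x) + 2 * g (P x) - \<theta> ?y) / g (P x) - (\<beta> (P x) + 2 * g (P x) - \<theta> x) / g (P x) = (\<theta> x - \<theta> ?y) / g (P x)"
    by (simp add: diff_divide_distrib[symmetric])
  also have "\<bar>(\<theta> x - \<theta> ?y) / g (P x)\<bar> \<le> L * norm (s *\<^sub>R d k) / g (P x)"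
    using \<theta>_Lipschitz[of x ?y] gp by (simp add: abs_divide divide_right_mono)
  finally have c: "\<bar>cutoff ?y - cutoff x\<bar> \<le> C * (L * norm (s *\<^sub>R d k) / g (P x))"
    using C(1) by (simp add: mult_left_mono)
  have "\<bar>a k ?y - a k x\<bar> = A x * (bump k (proj k x) * \<bar>cutoff ?y - cutoff x\<bar>)"
    using True y A_bounds(1)[OF True] b
    by (simp add: a_def Ay proj_add_d abs_mult right_diff_distrib[symmetric] mult.assoc)
  also have "\<dots> \<le> A x * (1 * (C * (L * norm (s *\<^sub>R d k) / g (P x))))"
    using A_bounds(1)[OF True] b c C(1) by (intro mult_left_mono mult_mono) auto
  also have "\<dots> = \<kappa> * (C * (L * norm (e (Suc k) - e k))) * \<bar>s\<bar>"
    using gp by (simp add: A_def d_def)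
  also have "\<dots> \<le> 1/2 * \<bar>s\<bar>" using \<kappa>_slope by (intro mult_right_mono) auto
  finally show ?thesis .
qed

section \<open>The shears and their infinite composition\<close>

definition u where "u k x = x - a k x *\<^sub>R d k"

lemma P_u: "P (u k x) = P x" by (simp add: u_def P.diff P.scaleR P_d)

text \<open>Points with equal image differ by a multiple of \<open>d k\<close>, and along
  \<open>d k\<close> the amplitude is a contraction with factor 1/2.\<close>

lemma inj_u: "u k x = u k y \<Longrightarrow> x = y"
proof -
  assume "u k x = u k y"
  then have y: "y = x + (a k y - a k x) *\<^sub>R d k" by (simp add: u_def algebra_simps)
  have "\<bar>a k y - a k x\<bar> \<le> 1/2 * \<bar>a k y - a k x\<bar>" using a_slope[of k x "a k y - a k x"] y by simp
  moreover have "w = 0" if "\<bar>w\<bar> \<le> 1/2 * \<bar>w\<bar>" for w :: real using that by simp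
  ultimately have "a k y - a k x = 0" by blast
  then show ?thesis using y by simp
qed

lemma submersive_u: "submersive p (u k) (- Z0)"
  unfolding u_def by (rule submersive_shear[OF smooth_a p1 a_slope])

text \<open>A point leaving the trap would land on a fixed point of the injective map \<open>u k\<close>.\<close>

lemma u_trap: "u k x = x \<or> x \<in> trap \<and> u k x \<in> trap"
proof (cases "a k x = 0")
  case True
  then show ?thesis by (simp add: u_def)
next
  case False
  have "u k x \<in> trap"
  proof (rule ccontr)
    assume n: "u k x \<notin> trap"
    then have "a k (u k x) = 0" using a_nonzero(1) by blast
    then have "u k (u k x) = u k x" by (simp add: u_def)
    then have "u k x = x" by (rule inj_u)
    then show False using n a_nonzero(1)[OF False] by simp
  qed
  then show ?thesis using a_nonzero(1)[OF False] by blast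
qed

lemma u_Z0: "x \<notin> Z0 \<Longrightarrow> u k x \<notin> Z0"
  using u_trap[of k x] trap_not_Z0 by auto

lemma u_path:
  assumes c: "c \<in> K - Z0"
  shows "u k (c + A c *\<^sub>R e (Suc k)) = c + A c *\<^sub>R e k"
proof -
  let ?x = "c + A c *\<^sub>R e (Suc k)"
  have cc: "c \<in> cylinder" using K_cylinder[OF c] .
  then have x: "?x \<in> cylinder" by (simp add: cylinder_def P_add_e)
  have gp: "g (P c) > 0" using cc g_pos by (simp add: cylinder_def)
  have Ax: "A ?x = A c" by (simp add: A_def P_add_e)
  have "?x = (c + A c *\<^sub>R e k) + A c *\<^sub>R d k" by (simp add: d_def algebra_simps)
  then have "proj k ?x = proj k (c + A c *\<^sub>R e k)" by (simp only: proj_add_d)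
  then have "proj k ?x \<in> core k" using c by (auto simp: core_def)
  then have b: "bump k (proj k ?x) = 1" using bump(4) x proj_cylinder by blast
  \<comment> \<open>By \<open>\<kappa>_path\<close> the path raises \<theta> by at most
    \<open>g (P c)\<close>, so it stays below the level \<open>\<beta> + g\<close> up to which the
    cutoff equals 1.\<close>
  have "\<theta> ?x \<le> \<theta> c + L * norm (A c *\<^sub>R e (Suc k))" using \<theta>_Lipschitz[of ?x c] by (simp add: abs_le_iff)
  also have "L * norm (A c *\<^sub>R e (Suc k)) = \<kappa> * (L * norm (e (Suc k))) * g (P c)"
    using gp \<kappa>_pos by (simp add: A_def)
  also have "\<dots> \<le> 1 * g (P c)" using gp by (intro mult_right_mono \<kappa>_path) simp
  finally have "\<theta> ?x \<le> \<beta> (P c) + g (P c)" using \<beta>_K[OF c] by simp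
  then have "(\<beta> (P c) + 2 * g (P c) - \<theta> ?x) / g (P c) \<ge> 1" using gp by (simp add: le_divide_eq)
  then have "cutoff ?x = 1" unfolding cutoff_def P_add_e by (rule step_eq_1)
  then have "a k ?x = A c" using x b Ax by (simp add: a_def)
  then show ?thesis by (simp add: u_def d_def algebra_simps)
qed

text \<open>The newest shear acts first. Near a given point the later shears are the identity, so
  the composition is eventually constant there, and an equation \<open>U n x = c\<close> can be
  solved backwards from \<open>u 0\<close>.\<close>

primrec U where
  "U 0 x = x"
| "U (Suc n) x = U n (u n x)"

lemma U_Z0: "x \<notin> Z0 \<Longrightarrow> U n x \<notin> Z0"
proof (induction n arbitrary: x)
  case (Suc n)
  show ?case using Suc.IH[OF u_Z0[OF Suc.prems]] by simp
qed simp

lemma submersive_U: "submersive p (U n) (- Z0)"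
proof (induction n)
  case 0
  have "U 0 = (\<lambda>x. x)" by (rule ext) simp
  then show ?case using submersive_id[OF open_compl_Z0] by simp
next
  case (Suc n)
  have "U (Suc n) = (\<lambda>x. U n (u n x))" by (rule ext) simp
  moreover have "u n ` (- Z0) \<subseteq> - Z0" using u_Z0 by blast
  ultimately show ?case using submersive_compose[OF submersive_u Suc] by simp
qed

lemma U_trap: "P (U n x) = P x \<and> (U n x = x \<or> x \<in> trap \<and> U n x \<in> trap)"
proof (induction n arbitrary: x)
  case (Suc n)
  show ?case using Suc[of "u n x"] u_trap[of n x] P_u[of n x] by auto
qed simp

lemma U_inverse_path: "c \<in> K - Z0 \<Longrightarrow> U n x = c \<Longrightarrow> x = c + A c *\<^sub>R e n"
proof (induction n arbitrary: x)
  case (Suc n)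
  then have "u n x = c + A c *\<^sub>R e n" by simp
  also have "\<dots> = u n (c + A c *\<^sub>R e (Suc n))" using u_path[OF Suc.prems(1)] by simp
  finally show ?case by (rule inj_u)
qed (simp add: e_0)

lemma U_stable:
  assumes "\<And>k. k \<ge> n \<Longrightarrow> a k x = 0" "n \<le> m"
  shows "U m x = U n x"
  using assms(2)
proof (induction m rule: dec_induct)
  case (step m)
  then show ?case using assms(1)[of m] by (simp add: u_def)
qed simp

definition extraction_map where "extraction_map x = lim (\<lambda>n. U n x)"

lemma extraction_map_eq:
  assumes "\<And>k. k \<ge> n \<Longrightarrow> a k x = 0"
  shows "extraction_map x = U n x"
proof -
  have "\<forall>\<^sub>F m in sequentially. U m x = U n x"
    unfolding eventually_sequentially using U_stable[OF assms] by blast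
  then show ?thesis unfolding extraction_map_def by (intro limI tendsto_eventually)
qed

theorem extraction:
  shows "submersive p extraction_map (- Z0)"
  "x \<notin> Z0 \<Longrightarrow> extraction_map x \<notin> K"
  "x \<notin> Z0 \<Longrightarrow> extraction_map x = x \<or> (\<exists>c\<in>K - Z0. x \<in> ball c (r c) \<and> extraction_map x \<in> ball c (r c))"
proof -
  show "submersive p extraction_map (- Z0)"
  proof (rule submersive_local[OF open_compl_Z0])
    fix z assume z: "z \<in> - Z0"
    then obtain T n where T: "open T" "z \<in> T" "\<forall>k\<ge>n. \<forall>y\<in>T. a k y = 0" using a_locally_finite by blast
    have "\<forall>y\<in>T. extraction_map y = U n y" using T(3) by (intro ballI extraction_map_eq) simp
    then show "\<exists>S v Z. open S \<and> z \<in> S \<and> S \<subseteq> - Z0 \<and> S \<subseteq> Z \<and> submersive p v Z \<and> (\<forall>y\<in>S. extraction_map y = v y)"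
      using T(1,2) z open_compl_Z0 submersive_U[of n]
      by (intro exI[of _ "T \<inter> - Z0"] exI[of _ "U n"] exI[of _ "- Z0"]) auto
  qed
  assume x: "x \<notin> Z0"
  then obtain T n where "x \<in> T" "\<forall>k\<ge>n. \<forall>y\<in>T. a k y = 0" using a_locally_finite by blast
  then have n: "\<And>k. k \<ge> n \<Longrightarrow> a k x = 0" by simp
  then have ex: "extraction_map x = U n x" by (rule extraction_map_eq)
  show "extraction_map x \<notin> K"
  proof
    assume "extraction_map x \<in> K"
    then have c: "U n x \<in> K - Z0" using U_Z0[OF x] ex by simp
    \<comment> \<open>After stabilisation both \<open>U n\<close> and \<open>U (Suc n)\<close> send
      \<open>x\<close> to the same point of \<open>K\<close>; inverting both paths identifies
      \<open>e n\<close> with \<open>e (Suc n)\<close>.\<close>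
    have "x = U n x + A (U n x) *\<^sub>R e n" "x = U n x + A (U n x) *\<^sub>R e (Suc n)"
      using U_inverse_path[OF c] U_stable[OF n, of n "Suc n"] by simp_all
    then have "A (U n x) *\<^sub>R e n = A (U n x) *\<^sub>R e (Suc n)" by (metis add_left_imp_eq)
    moreover have "A (U n x) > 0" using A_bounds(1) K_cylinder[OF c] by blast
    ultimately have "e (Suc n) - e n = 0" by simp
    then show False using N_d[of n] N_0 by simp
  qed
  show "extraction_map x = x \<or> (\<exists>c\<in>K - Z0. x \<in> ball c (r c) \<and> extraction_map x \<in> ball c (r c))"
  proof (cases "U n x = x")
    case False
    \<comment> \<open>A moved point and its image share the fibre and the trap, and the trap over
      one base point fits into a single ball.\<close>
    then have t: "P (U n x) = P x" "x \<in> trap" "U n x \<in> trap" using U_trap[of n x] by auto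
    then have "P x \<in> V" by (simp add: trap_def cylinder_def)
    then obtain c where "c \<in> K - Z0" "\<forall>y\<in>trap. P y = P x \<longrightarrow> y \<in> ball c (r c)" using trap_ball by blast
    then show ?thesis using t ex by (intro disjI2 bexI[of _ c]) simp_all
  qed (simp add: ex)
qed

end

section \<open>Construction of the directions, caps and widths\<close>

context flat_critical_set
begin

text \<open>Each new unit vector is annihilated by \<open>P\<close>, by a functional norming its
  predecessor, and by the gradients at an initial part of a dense sequence. Hence consecutive
  vectors are separated, and continuity of \<open>grad\<close> extends the decay from the dense
  sequence to all points.\<close>

lemma null_sequence:
  assumes null: "\<And>F. finite F \<Longrightarrow> (\<And>f. f \<in> F \<Longrightarrow> bounded_linear f) \<Longrightarrow>
    \<exists>v. N v = 1 \<and> P v = 0 \<and> (\<forall>f\<in>F. f v = (0::real))"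
  shows "\<exists>(e :: nat \<Rightarrow> 'a) f. e 0 = 0 \<and> (\<forall>k. P (e k) = 0) \<and> (\<forall>k. N (e k) \<le> 1) \<and> (\<forall>x. (\<lambda>k. grad x (e k)) \<longlonglongrightarrow> 0) \<and>
     (\<forall>k. 1 \<le> N (e (Suc k) - e k)) \<and> (\<forall>k s. 1 \<le> k \<longrightarrow> 1/3 \<le> N (e k + s *\<^sub>R (e (Suc k) - e k))) \<and>
     (\<forall>k. bounded_linear (f k)) \<and> (\<forall>k h. \<bar>f k h\<bar> \<le> N h) \<and> (\<forall>k. f k (e (Suc k) - e k) = 1)"
proof -
  obtain \<Psi> where \<Psi>: "\<And>x. bounded_linear (\<Psi> x)" "\<And>x h. \<bar>\<Psi> x h\<bar> \<le> N h" "\<And>x. \<Psi> x x = N x"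
    using norming_functional_total by metis
  obtain D :: "nat \<Rightarrow> 'a" where D: "\<forall>x e. 0 < e \<longrightarrow> (\<exists>j. D j \<in> ball x e)" using dense_sequence by blast
  have "\<exists>e. \<forall>n. (N (e n) = (if n = 0 then 0 else 1) \<and> P (e n) = 0) \<and>
      (\<Psi> (e n) (e (Suc n)) = 0 \<and> (\<forall>j\<le>n. grad (D j) (e (Suc n)) = 0))"
  proof (rule dependent_nat_choice)
    show "\<exists>x. N x = (if (0::nat) = 0 then 0 else 1) \<and> P x = 0" using N_0 P.zero by (intro exI[of _ 0]) simp
    fix x n
    let ?F = "insert (\<Psi> x) ((\<lambda>j. grad (D j)) ` {..n})"
    have "\<exists>v. N v = 1 \<and> P v = 0 \<and> (\<forall>f\<in>?F. f v = 0)"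
      by (rule null) (auto intro: \<Psi>(1) bounded_linear_grad)
    then show "\<exists>y. (N y = (if Suc n = 0 then 0 else 1) \<and> P y = 0) \<and> (\<Psi> x y = 0 \<and> (\<forall>j\<le>n. grad (D j) y = 0))"
      by auto
  qed
  then obtain e where e: "\<And>n. N (e n) = (if n = 0 then 0 else 1)" "\<And>n. P (e n) = 0"
    "\<And>n. \<Psi> (e n) (e (Suc n)) = 0" "\<And>n j. j \<le> n \<Longrightarrow> grad (D j) (e (Suc n)) = 0" by blast
  have e0: "e 0 = 0" using e(1)[of 0] N_eq_0 by simp
  have lin: "\<Psi> x (y - z) = \<Psi> x y - \<Psi> x z" "\<Psi> x (s *\<^sub>R y) = s * \<Psi> x y" "\<Psi> x (y + z) = \<Psi> x y + \<Psi> x z" for x y z s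
    using \<Psi>(1)[of x] by (simp_all add: linear_diff linear_add linear_scale bounded_linear.linear)
  have Nd: "1 \<le> N (e (Suc k) - e k)" for k
  proof (cases "k = 0")
    case True
    then show ?thesis using e(1)[of "Suc 0"] e0 by simp
  next
    case False
    then have "\<Psi> (e k) (e (Suc k) - e k) = - 1" using e(1,3)[of k] \<Psi>(3)[of "e k"] by (simp add: lin)
    then show ?thesis using \<Psi>(2)[of "e k" "e (Suc k) - e k"] by simp
  qed
  have Ns: "1/3 \<le> N (e k + s *\<^sub>R (e (Suc k) - e k))" if "1 \<le> k" for k s
  proof -
    let ?y = "e k + s *\<^sub>R (e (Suc k) - e k)"
    have N1: "N (e k) = 1" "N (e (Suc k)) = 1" using e(1) that by auto
    have "\<Psi> (e k) ?y = 1 - s" using e(3)[of k] N1 \<Psi>(3)[of "e k"] by (simp add: lin algebra_simps)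
    then have 1: "\<bar>1 - s\<bar> \<le> N ?y" using \<Psi>(2)[of "e k" ?y] by simp
    have "s *\<^sub>R e (Suc k) = ?y - (1 - s) *\<^sub>R e k" by (simp add: algebra_simps)
    then have "N (s *\<^sub>R e (Suc k)) \<le> N ?y + N (- ((1 - s) *\<^sub>R e k))"
      using N_triangle[of ?y "- ((1 - s) *\<^sub>R e k)"] by simp
    then have 2: "\<bar>s\<bar> \<le> N ?y + \<bar>1 - s\<bar>" by (simp add: N_minus N_scale N1)
    \<comment> \<open>One of the scalars satisfies
      \<open>1 \<le> \<bar>s\<bar> + \<bar>1 - s\<bar>\<close>, and the two estimates bound this sum
      by \<open>3 * N ?y\<close>; hence the constant 1/3.\<close>
    show ?thesis using 1 2 by (simp add: abs_if split: if_splits)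
  qed
  have en: "(\<lambda>k. grad x (e k)) \<longlonglongrightarrow> 0" for x
  proof -
    obtain c where c: "0 < c" "\<forall>x. c * norm x \<le> N x" using N_lower by blast
    have ne: "norm (e k) \<le> 1 / c" for k
      using c(2)[rule_format, of "e k"] c(1) e(1)[of k] by (auto simp: field_simps split: if_splits)
    show ?thesis
    proof (rule LIMSEQ_I)
      fix \<epsilon> :: real assume \<epsilon>: "0 < \<epsilon>"
      have "\<forall>\<^sub>F y in nhds x. \<forall>h. \<bar>grad y h - grad x h\<bar> \<le> (\<epsilon> * c / 2) * norm h"
        using \<epsilon> c(1) by (intro grad_continuous) simp
      then obtain \<delta> where \<delta>: "0 < \<delta>" "\<forall>y. dist y x < \<delta> \<longrightarrow> (\<forall>h. \<bar>grad y h - grad x h\<bar> \<le> (\<epsilon> * c / 2) * norm h)"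
        by (auto simp: eventually_nhds_metric)
      obtain j where j: "D j \<in> ball x \<delta>" using D \<delta>(1) by blast
      have "norm (grad x (e n) - 0) < \<epsilon>" if n: "Suc j \<le> n" for n
      proof -
        obtain m where m: "n = Suc m" "j \<le> m" using n by (cases n) auto
        have "\<bar>grad (D j) (e n) - grad x (e n)\<bar> \<le> (\<epsilon> * c / 2) * norm (e n)"
          using \<delta>(2) j by (simp add: dist_commute)
        also have "\<dots> \<le> (\<epsilon> * c / 2) * (1 / c)" using \<epsilon> c(1) ne by (intro mult_left_mono) auto
        finally have "\<bar>grad x (e n)\<bar> \<le> \<epsilon> / 2" using e(4)[OF m(2)] m(1) c(1) by simp
        then show ?thesis using \<epsilon> by simp
      qed
      then show "\<exists>no. \<forall>n\<ge>no. norm (grad x (e n) - 0) < \<epsilon>" by blast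
    qed
  qed
  define f where "f k h = \<Psi> (e (Suc k) - e k) h / N (e (Suc k) - e k)" for k h
  have "bounded_linear (f k)" for k
    unfolding f_def by (rule bounded_linear_compose[OF bounded_linear_divide \<Psi>(1)])
  moreover have "\<bar>f k h\<bar> \<le> N h" for k h
  proof -
    have "\<bar>f k h\<bar> \<le> N h / N (e (Suc k) - e k)"
      unfolding f_def using Nd[of k] \<Psi>(2) by (simp add: abs_divide divide_right_mono)
    also have "\<dots> \<le> N h / 1" using Nd[of k] N_nonneg by (intro divide_left_mono) auto
    finally show ?thesis by simp
  qed
  moreover have "f k (e (Suc k) - e k) = 1" for k unfolding f_def using \<Psi>(3) Nd[of k] by simp
  moreover have "N (e k) \<le> 1" for k using e(1) by simp
  ultimately show ?thesis using e0 e(2) Nd Ns en by (intro exI[of _ e] exI[of _ f]) simp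
qed

text \<open>\<open>\<eta> c\<close> bounds base and height of a cap. Over the narrower base
  \<open>\<eta>' c\<close> all of \<open>K\<close> stays below half of that height, which leaves the
  upper half for \<beta> and its margin.\<close>

lemma caps:
  assumes Z0: "closed Z0" "Z0 \<subseteq> K" and r: "\<And>c. c \<in> K - Z0 \<Longrightarrow> 0 < r c"
  shows "\<exists>\<eta> \<eta>'. \<forall>c\<in>K - Z0. 0 < \<eta>' c \<and> \<eta>' c \<le> \<eta> c \<and> (\<forall>z\<in>Z0. 2 * \<eta> c \<le> norm (P c - P z)) \<and>
    (\<forall>x. norm (P x - P c) < \<eta> c \<and> \<theta> x < \<theta> c + \<eta> c \<longrightarrow> x \<in> ball c (r c)) \<and>
    (\<forall>z\<in>K. norm (P z - P c) < \<eta>' c \<longrightarrow> \<theta> z < \<theta> c + \<eta> c / 2)"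
proof -
  have "\<exists>\<eta> \<eta>'. 0 < \<eta>' \<and> \<eta>' \<le> \<eta> \<and> (\<forall>z\<in>Z0. 2 * \<eta> \<le> norm (P c - P z)) \<and>
    (\<forall>x. norm (P x - P c) < \<eta> \<and> \<theta> x < \<theta> c + \<eta> \<longrightarrow> x \<in> ball c (r c)) \<and>
    (\<forall>z\<in>K. norm (P z - P c) < \<eta>' \<longrightarrow> \<theta> z < \<theta> c + \<eta> / 2)" if c: "c \<in> K - Z0" for c
  proof -
    have cK: "c \<in> K" using c by blast
    obtain a where a: "0 < a" "\<forall>x. norm (P x - P c) < a \<and> \<theta> x < \<theta> c + a \<longrightarrow> x \<in> ball c (r c)"
      using cap_small[OF cK r[OF c]] by blast
    obtain b where b: "0 < b" "\<forall>z. z \<in> Z0 \<longrightarrow> 2 * b \<le> norm (P c - P z)"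
      using K_separated[OF Z0 c] by blast
    have m: "0 < min a b / 2" using a b by simp
    obtain h where h: "0 < h" "\<forall>z. z \<in> K \<and> norm (P z - P c) < h \<longrightarrow> \<theta> z < \<theta> c + min a b / 2"
      using K_values_near[OF cK m] by blast
    have "2 * min a b \<le> norm (P c - P z)" if "z \<in> Z0" for z using b(2) that by fastforce
    then show ?thesis using a b h by (intro exI[of _ "min a b"] exI[of _ "min h (min a b)"]) auto
  qed
  then show ?thesis by metis
qed

theorem avoid_flat_critical_set:
  assumes null: "\<And>F. finite F \<Longrightarrow> (\<And>f. f \<in> F \<Longrightarrow> bounded_linear f) \<Longrightarrow>
      \<exists>v. N v = 1 \<and> P v = 0 \<and> (\<forall>f\<in>F. f v = (0::real))"
    and Z0: "closed Z0" "Z0 \<subseteq> K"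
    and r: "\<And>c. c \<in> K - Z0 \<Longrightarrow> 0 < r c" "\<And>c. c \<in> K - Z0 \<Longrightarrow> ball c (r c) \<inter> Z0 = {}"
  shows "\<exists>U. submersive p U (- Z0) \<and> (\<forall>x. x \<notin> Z0 \<longrightarrow> U x \<notin> K \<and>
    (U x = x \<or> (\<exists>c\<in>K - Z0. x \<in> ball c (r c) \<and> U x \<in> ball c (r c))))"
proof -
  obtain e :: "nat \<Rightarrow> 'a" and f where ef: "e 0 = 0 \<and> (\<forall>k. P (e k) = 0) \<and> (\<forall>k. N (e k) \<le> 1) \<and> (\<forall>x. (\<lambda>k. grad x (e k)) \<longlonglongrightarrow> 0) \<and>
     (\<forall>k. 1 \<le> N (e (Suc k) - e k)) \<and> (\<forall>k s. 1 \<le> k \<longrightarrow> 1/3 \<le> N (e k + s *\<^sub>R (e (Suc k) - e k))) \<and>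
     (\<forall>k. bounded_linear (f k)) \<and> (\<forall>k h. \<bar>f k h\<bar> \<le> N h) \<and> (\<forall>k. f k (e (Suc k) - e k) = 1)"
    using null_sequence[OF null] by blast
  obtain \<eta> \<eta>' where "\<forall>c\<in>K - Z0. 0 < \<eta>' c \<and> \<eta>' c \<le> \<eta> c \<and> (\<forall>z\<in>Z0. 2 * \<eta> c \<le> norm (P c - P z)) \<and>
    (\<forall>x. norm (P x - P c) < \<eta> c \<and> \<theta> x < \<theta> c + \<eta> c \<longrightarrow> x \<in> ball c (r c)) \<and>
    (\<forall>z\<in>K. norm (P z - P c) < \<eta>' c \<longrightarrow> \<theta> z < \<theta> c + \<eta> c / 2)"
    using caps[where r = r, OF Z0 r(1)] by blast
  then have \<eta>: "0 < \<eta>' c" "\<eta>' c \<le> \<eta> c" "z \<in> Z0 \<Longrightarrow> 2 * \<eta> c \<le> norm (P c - P z)"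
    "norm (P x - P c) < \<eta> c \<Longrightarrow> \<theta> x < \<theta> c + \<eta> c \<Longrightarrow> x \<in> ball c (r c)"
    "y \<in> K \<Longrightarrow> norm (P y - P c) < \<eta>' c \<Longrightarrow> \<theta> y < \<theta> c + \<eta> c / 2" if "c \<in> K - Z0" for c z x y
    using that by blast+
  define V where "V = (\<Union>c\<in>K - Z0. ball (P c) (\<eta>' c))"
  have V_open: "open V" unfolding V_def by blast
  have V_K: "P c \<in> V" if "c \<in> K - Z0" for c
    unfolding V_def by (rule UN_I[OF that]) (use \<eta>(1)[OF that] in simp)
  have VE: "\<exists>c\<in>K - Z0. norm (q - P c) < \<eta>' c" if "q \<in> V" for q
    using that by (auto simp: V_def dist_norm norm_minus_commute)
  have V_Z0: "P z \<notin> V" if z: "z \<in> Z0" for z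
  proof
    assume "P z \<in> V"
    then obtain c where c: "c \<in> K - Z0" "norm (P z - P c) < \<eta>' c" using VE by blast
    then show False using \<eta>(1,2)[OF c(1)] \<eta>(3)[OF c(1) z] by (simp add: norm_minus_commute)
  qed
  \<comment> \<open>A height over \<open>q\<close> has to pass above all of \<open>K - Z0\<close>
    and below the top of at least one cap. This is an interval, and
    \<open>\<theta> c + \<eta> c / 2\<close> meets the condition for all base points near
    \<open>P c\<close>.\<close>
  define \<Phi> where "\<Phi> q = {b::real. (\<forall>c\<in>K - Z0. P c = q \<longrightarrow> \<theta> c < b) \<and> (\<exists>c\<in>K - Z0. norm (q - P c) < \<eta> c \<and> b < \<theta> c + \<eta> c)}" for q
  have "\<exists>\<beta>. smooth p \<beta> V \<and> (\<forall>q\<in>V. \<beta> q \<in> \<Phi> q)"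
  proof -
    have cv: "convex (\<Phi> q)" for q
      unfolding is_interval_convex_1[symmetric] is_interval_1 \<Phi>_def by (auto dest: less_le_trans le_less_trans)
    have lc: "\<exists>T u. open T \<and> q \<in> T \<and> (\<forall>y\<in>T \<inter> V. u \<in> \<Phi> y)" if q: "q \<in> V" for q
    proof -
      obtain c where c: "c \<in> K - Z0" "norm (q - P c) < \<eta>' c" using VE[OF q] by blast
      have "\<theta> c + \<eta> c / 2 \<in> \<Phi> y" if y: "y \<in> ball (P c) (\<eta>' c)" for y
      proof -
        have n: "norm (y - P c) < \<eta>' c" using y by (simp add: dist_norm norm_minus_commute)
        have "\<theta> b < \<theta> c + \<eta> c / 2" if "b \<in> K - Z0" "P b = y" for b
          using \<eta>(5)[OF c(1), of b] that n by simp
        moreover have "norm (y - P c) < \<eta> c" "\<theta> c + \<eta> c / 2 < \<theta> c + \<eta> c" using n \<eta>(1,2)[OF c(1)] by simp_all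
        ultimately show ?thesis using c(1) unfolding \<Phi>_def by blast
      qed
      then show ?thesis using c(2)
        by (intro exI[of _ "ball (P c) (\<eta>' c)"] exI[of _ "\<theta> c + \<eta> c / 2"]) (simp add: dist_norm norm_minus_commute)
    qed
    show ?thesis by (rule selection[where Y = V and \<Phi> = \<Phi>, OF V_open cv lc]) (assumption, blast)
  qed
  then obtain \<beta> where \<beta>: "smooth p \<beta> V" "\<And>q. q \<in> V \<Longrightarrow> \<beta> q \<in> \<Phi> q" by blast
  have \<beta>_K: "\<theta> c < \<beta> (P c)" if "c \<in> K - Z0" for c using \<beta>(2)[OF V_K[OF that]] that by (simp add: \<Phi>_def)
  have \<beta>_up: "\<exists>c\<in>K - Z0. norm (q - P c) < \<eta> c \<and> \<beta> q < \<theta> c + \<eta> c" if "q \<in> V" for q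
    using \<beta>(2)[OF that] by (simp add: \<Phi>_def)
  \<comment> \<open>The margin \<open>g\<close> is used twice: up to \<open>\<beta> + g\<close> the
    paths run, between there and \<open>\<beta> + 2 g\<close> the cutoff decays, and all of it must
    remain inside one cap.\<close>
  define \<Gamma> where "\<Gamma> q = {g::real. 0 < g \<and> g \<le> 1 \<and> (\<exists>c\<in>K - Z0. norm (q - P c) < \<eta> c \<and> \<beta> q + 2 * g < \<theta> c + \<eta> c)}" for q
  have "\<exists>g. smooth p g V \<and> (\<forall>q\<in>V. g q \<in> \<Gamma> q)"
  proof -
    have cv: "convex (\<Gamma> q)" for q
      unfolding is_interval_convex_1[symmetric] is_interval_1 \<Gamma>_def by fastforce
    have lc: "\<exists>T u. open T \<and> q \<in> T \<and> (\<forall>y\<in>T \<inter> V. u \<in> \<Gamma> y)" if q: "q \<in> V" for q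
    proof -
      obtain c where c: "c \<in> K - Z0" "norm (q - P c) < \<eta> c" "\<beta> q < \<theta> c + \<eta> c" using \<beta>_up[OF q] by blast
      \<comment> \<open>With a quarter of the free height, \<open>2 * u\<close> takes at most half
        of it, and the strict inequality persists near \<open>q\<close>.\<close>
      define u where "u = min 1 ((\<theta> c + \<eta> c - \<beta> q) / 4)"
      have u: "0 < u" "u \<le> 1" using c(3) by (simp_all add: u_def)
      have "u \<le> (\<theta> c + \<eta> c - \<beta> q) / 4" unfolding u_def by (rule min.cobounded2)
      then have "\<beta> q + 2 * u < \<theta> c + \<eta> c" using c(3) by argo
      note u = u this
      define T where "T = ball (P c) (\<eta> c) \<inter> (V \<inter> \<beta> -` {..<\<theta> c + \<eta> c - 2 * u})"
      have "open T" unfolding T_def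
        by (intro open_Int open_ball continuous_open_preimage smooth_continuous_on[OF \<beta>(1)] V_open open_lessThan)
      moreover have "q \<in> T" using q c(2) u(3) by (simp add: T_def dist_norm norm_minus_commute)
      moreover have "u \<in> \<Gamma> y" if "y \<in> T" for y
      proof -
        have "norm (y - P c) < \<eta> c" "\<beta> y + 2 * u < \<theta> c + \<eta> c" 
          using that by (auto simp: T_def dist_norm norm_minus_commute)
        then show ?thesis using u(1,2) c(1) unfolding \<Gamma>_def by blast
      qed
      ultimately show ?thesis by (intro exI[of _ T] exI[of _ u]) simp
    qed
    show ?thesis by (rule selection[where Y = V and \<Phi> = \<Gamma>, OF V_open cv lc]) (assumption, blast)
  qed
  then obtain g where g: "smooth p g V" "\<And>q. q \<in> V \<Longrightarrow> g q \<in> \<Gamma> q" by blast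
  have g_pos: "0 < g q" "g q \<le> 1" if "q \<in> V" for q using g(2)[OF that] by (simp_all add: \<Gamma>_def)
  have cap: "\<exists>c\<in>K - Z0. norm (q - P c) < \<eta> c \<and> (\<forall>x. P x = q \<and> \<theta> x < \<beta> q + 2 * g q \<longrightarrow> x \<in> ball c (r c))"
    if q: "q \<in> V" for q
  proof -
    obtain c where c: "c \<in> K - Z0" "norm (q - P c) < \<eta> c" "\<beta> q + 2 * g q < \<theta> c + \<eta> c"
      using g(2)[OF q] by (auto simp: \<Gamma>_def)
    have "x \<in> ball c (r c)" if "P x = q" "\<theta> x < \<beta> q + 2 * g q" for x
      using \<eta>(4)[OF c(1), of x] that c(2,3) by simp
    then show ?thesis using c by blast
  qed
  obtain c0 where c0: "0 < c0" "\<forall>x. c0 * norm x \<le> N x" using N_lower by blast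
  have ne: "norm (e k) \<le> 1 / c0" for k
    using c0(2)[rule_format, of "e k"] c0(1) ef by (simp add: field_simps order_trans)
  have nd: "norm (e (Suc k) - e k) \<le> 2 / c0" for k
    using norm_triangle_ineq4[of "e (Suc k)" "e k"] ne[of k] ne[of "Suc k"] by simp
  obtain C where C: "C > 0" "\<And>s t. \<bar>step s - step t\<bar> \<le> C * \<bar>s - t\<bar>" using step_Lipschitz by blast
  \<comment> \<open>One constant for two purposes: the first summand is the slope of the shears,
    with \<open>2 / c0\<close> bounding the differences of the \<open>e k\<close>, the second the
    rise of \<theta> along the paths.\<close>
  obtain \<kappa> where \<kappa>: "\<kappa> > 0" "\<kappa> * (C * (L * (2 / c0)) + L * (1 / c0)) \<le> 1/2"
    by (rule small_multiplier[of "1/2" "C * (L * (2 / c0)) + L * (1 / c0)"]) (use C L_pos c0 in \<open>auto intro: add_pos_pos\<close>)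
  have k1: "0 < \<kappa> * (C * (L * (2 / c0)))" "0 < \<kappa> * (L * (1 / c0))" using \<kappa>(1) C(1) L_pos c0(1) by simp_all
  have k2: "\<kappa> * (C * (L * (2 / c0))) + \<kappa> * (L * (1 / c0)) \<le> 1/2" using \<kappa>(2) by (simp only: distrib_left)
  have \<kappa>_path: "\<kappa> * (L * norm (e k)) \<le> 1" for k
  proof -
    have "\<kappa> * (L * norm (e k)) \<le> \<kappa> * (L * (1 / c0))" using \<kappa>(1) L_pos ne by (intro mult_left_mono) auto
    then show ?thesis using k1 k2 by linarith
  qed
  have \<kappa>_slope: "\<kappa> * (C * (L * norm (e (Suc k) - e k))) \<le> 1/2" for k
  proof -
    have "\<kappa> * (C * (L * norm (e (Suc k) - e k))) \<le> \<kappa> * (C * (L * (2 / c0)))"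
      using \<kappa>(1) L_pos C(1) nd by (intro mult_left_mono) auto
    then show ?thesis using k1 k2 by linarith
  qed
  obtain B where B: "0 \<le> B" "\<And>x. norm (P x) \<le> B * norm x"
    using P.nonneg_bounded by (auto simp: mult.commute)
  \<comment> \<open>The power makes the neighbourhoods shrink as \<open>k\<close> grows; the other
    term keeps a multiple of their projections, which \<open>P\<close> stretches by at most
    \<open>B\<close>, inside \<open>V\<close>.\<close>
  define t where "t k c = min ((1/2)^k) (\<eta>' c / (2 * (B + 1)))" for k :: nat and c
  have t: "0 < t k c" "t k c \<le> (1/2)^k" "ball (P c) (2 * (B + 1) * t k c) \<subseteq> V" if c: "c \<in> K - Z0" for k c
  proof -
    show "0 < t k c" "t k c \<le> (1/2)^k" using \<eta>(1)[OF c] B(1) by (auto simp: t_def)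
    have "2 * (B + 1) * t k c \<le> 2 * (B + 1) * (\<eta>' c / (2 * (B + 1)))"
      using B(1) by (intro mult_left_mono) (auto simp: t_def)
    also have "\<dots> = \<eta>' c" using B(1) by simp
    finally have "ball (P c) (2 * (B + 1) * t k c) \<subseteq> ball (P c) (\<eta>' c)" by (rule subset_ball)
    then show "ball (P c) (2 * (B + 1) * t k c) \<subseteq> V" using c unfolding V_def by blast
  qed
  have e: "e 0 = 0" "\<And>k. P (e k) = 0" "\<And>k. N (e k) \<le> 1" "\<And>x. (\<lambda>k. grad x (e k)) \<longlonglongrightarrow> 0"
    "\<And>k. 1 \<le> N (e (Suc k) - e k)" "\<And>k s. 1 \<le> k \<Longrightarrow> 1/3 \<le> N (e k + s *\<^sub>R (e (Suc k) - e k))"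
    "\<And>k. bounded_linear (f k)" "\<And>k h. \<bar>f k h\<bar> \<le> N h" "\<And>k. f k (e (Suc k) - e k) = 1"
    using ef by simp_all
  have C0: "0 \<le> C" using C(1) by simp
  interpret extraction p N \<theta> L P K Z0 r \<eta> V \<beta> g \<kappa> C B e f t
    by (rule extraction.intro[OF flat_critical_set_axioms], rule extraction_axioms.intro)
      (fact Z0 r(2) V_open V_Z0 V_K \<beta>(1) \<beta>_K g(1) g_pos cap \<eta>(3) e C0 C(2) \<kappa>(1) \<kappa>_path \<kappa>_slope B t)+
  show ?thesis using extraction by (intro exI[of _ extraction_map]) blast
qed

end

section \<open>The approximation\<close>

text \<open>Continuity at \<open>c\<close> gives bounds in terms of \<open>\<epsilon> c\<close>.
  Within a quarter of it \<epsilon> cannot drop below \<open>\<epsilon> c / 2\<close>, so the bounds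
  can be restated with \<open>\<epsilon> x\<close> at any point \<open>x\<close> of the
  ball.\<close>

lemma small_oscillation_radius:
  fixes f \<epsilon> :: "'a::real_normed_vector \<Rightarrow> real"
  assumes f: "continuous_on UNIV f" "continuous_on UNIV \<epsilon>" "\<And>x. 0 < \<epsilon> x"
    and S: "open S" "c \<in> S" and k: "0 < \<kappa>" "\<kappa> \<le> 1" and \<rho>: "0 < \<rho>"
  shows "\<exists>r>0. r \<le> \<rho> \<and> ball c r \<subseteq> S \<and> (\<forall>x\<in>ball c r. \<forall>y\<in>ball c r. \<bar>f y - f x\<bar> \<le> \<kappa> * \<epsilon> x \<and> \<bar>\<epsilon> y - \<epsilon> x\<bar> \<le> \<kappa> * \<epsilon> x)"
proof -
  have pos: "0 < \<kappa> * \<epsilon> c / 4" using k f(3) by simp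
  have "isCont f c" "isCont \<epsilon> c" using f(1,2) by (simp_all add: continuous_on_eq_continuous_at)
  then have "(f \<longlongrightarrow> f c) (nhds c)" "(\<epsilon> \<longlongrightarrow> \<epsilon> c) (nhds c)"
    by (simp_all add: continuous_at tendsto_at_iff_tendsto_nhds)
  from this[THEN tendstoD, OF pos] have "\<forall>\<^sub>F x in nhds c. dist (f x) (f c) < \<kappa> * \<epsilon> c / 4"
    "\<forall>\<^sub>F x in nhds c. dist (\<epsilon> x) (\<epsilon> c) < \<kappa> * \<epsilon> c / 4" .
  moreover have "\<forall>\<^sub>F x in nhds c. x \<in> S" using S by (rule eventually_nhds_in_open)
  ultimately have "\<forall>\<^sub>F x in nhds c. dist (f x) (f c) < \<kappa> * \<epsilon> c / 4 \<and> dist (\<epsilon> x) (\<epsilon> c) < \<kappa> * \<epsilon> c / 4 \<and> x \<in> S"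
    by eventually_elim simp
  then obtain d where d: "0 < d" "\<forall>x. dist x c < d \<longrightarrow> dist (f x) (f c) < \<kappa> * \<epsilon> c / 4 \<and> dist (\<epsilon> x) (\<epsilon> c) < \<kappa> * \<epsilon> c / 4 \<and> x \<in> S"
    unfolding eventually_nhds_metric by blast
  have "\<bar>f y - f x\<bar> \<le> \<kappa> * \<epsilon> x \<and> \<bar>\<epsilon> y - \<epsilon> x\<bar> \<le> \<kappa> * \<epsilon> x" if xy: "x \<in> ball c d" "y \<in> ball c d" for x y
  proof -
    have b: "\<bar>f x - f c\<bar> < \<kappa> * \<epsilon> c / 4" "\<bar>f y - f c\<bar> < \<kappa> * \<epsilon> c / 4"
      "\<bar>\<epsilon> x - \<epsilon> c\<bar> < \<kappa> * \<epsilon> c / 4" "\<bar>\<epsilon> y - \<epsilon> c\<bar> < \<kappa> * \<epsilon> c / 4"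
      using d(2) xy by (simp_all add: dist_real_def dist_commute)
    have "\<kappa> * \<epsilon> c \<le> \<epsilon> c" using k f(3)[of c] by (simp add: mult_le_cancel_right1)
    then have "\<epsilon> c / 2 \<le> \<epsilon> x" using b(3)[unfolded abs_less_iff] f(3)[of c] by argo
    then have "\<kappa> * (\<epsilon> c / 2) \<le> \<kappa> * \<epsilon> x" using k by (intro mult_left_mono) auto
    then have m: "\<kappa> * \<epsilon> c / 2 \<le> \<kappa> * \<epsilon> x" by simp
    have "\<bar>f y - f x\<bar> \<le> \<kappa> * \<epsilon> c / 2" "\<bar>\<epsilon> y - \<epsilon> x\<bar> \<le> \<kappa> * \<epsilon> c / 2" using b by linarith+
    then show ?thesis using m by linarith
  qed
  moreover have "ball c d \<subseteq> S" using d(2) by (auto simp: dist_commute)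
  ultimately show ?thesis using d(1) \<rho> by (intro exI[of _ "min d \<rho>"]) auto
qed

text \<open>Each point is moved by finitely many stages only: the stages move it by less and less, so it
  converges, and once it is inside some \<open>O j\<close> it is out of reach of all later stages.\<close>

lemma avoid_closed_set:
  fixes C :: "'a::banach set" and H O' :: "nat \<Rightarrow> 'a set" and f \<epsilon> :: "'a \<Rightarrow> real"
  assumes C: "closed C" and H: "\<And>i. closed (H i)" and O': "\<And>j. open (O' j)" "\<And>j. O' j \<subseteq> H j" "(\<Union>j. O' j) = UNIV"
    and f: "continuous_on UNIV f" "continuous_on UNIV \<epsilon>" "\<And>x. 0 < \<epsilon> x"
    and stage: "\<And>i r. (\<And>c. c \<in> C \<inter> H i - (\<Union>l<i. H l) \<Longrightarrow> 0 < r c \<and> ball c (r c) \<inter> (\<Union>l<i. H l) = {}) \<Longrightarrow>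
      \<exists>U. submersive p U (- (C \<inter> H i \<inter> (\<Union>l<i. H l))) \<and> (\<forall>x. x \<notin> C \<inter> H i \<inter> (\<Union>l<i. H l) \<longrightarrow> U x \<notin> C \<inter> H i \<and>
        (U x = x \<or> (\<exists>c\<in>C \<inter> H i - (\<Union>l<i. H l). x \<in> ball c (r c) \<and> U x \<in> ball c (r c))))"
  shows "\<exists>R. submersive p R UNIV \<and> (\<forall>x. R x \<notin> C \<and> \<bar>f (R x) - f x\<bar> \<le> \<epsilon> x / 2)"
proof -
  define Z where "Z i = C \<inter> H i \<inter> (\<Union>l<i. H l)" for i
  \<comment> \<open>The displacement of stage \<open>i\<close> is summable in \<open>i\<close>; the
    exponent \<open>i + 3\<close> leaves room for the growth of \<epsilon> along the orbit.\<close>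
  define near where "near i c \<rho> \<longleftrightarrow> 0 < \<rho> \<and> \<rho> \<le> (1/2)^i \<and> ball c \<rho> \<subseteq> - (\<Union>l<i. H l) \<and>
      (\<forall>x\<in>ball c \<rho>. \<forall>y\<in>ball c \<rho>. \<bar>f y - f x\<bar> \<le> (1/2)^(i+3) * \<epsilon> x \<and> \<bar>\<epsilon> y - \<epsilon> x\<bar> \<le> (1/2)^(i+3) * \<epsilon> x)" for i :: nat and c \<rho>
  have "\<exists>\<rho>. near i c \<rho>" if c: "c \<in> C \<inter> H i - (\<Union>l<i. H l)" for i c
  proof -
    have o: "open (- (\<Union>l<i. H l))" using H by (intro open_Compl closed_UN) auto
    have "c \<in> - (\<Union>l<i. H l)" using c by blast
    from small_oscillation_radius[OF f o this, of "(1/2)^(i+3)" "(1/2)^i"] show ?thesis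
      unfolding near_def by (simp add: power_le_one)
  qed
  then have "\<forall>i c. \<exists>\<rho>. c \<in> C \<inter> H i - (\<Union>l<i. H l) \<longrightarrow> near i c \<rho>" by blast
  then obtain r where near: "\<And>i c. c \<in> C \<inter> H i - (\<Union>l<i. H l) \<Longrightarrow> near i c (r i c)" by metis
  have r: "0 < r i c \<and> r i c \<le> (1/2)^i \<and> ball c (r i c) \<inter> (\<Union>l<i. H l) = {} \<and>
      (\<forall>x\<in>ball c (r i c). \<forall>y\<in>ball c (r i c). \<bar>f y - f x\<bar> \<le> (1/2)^(i+3) * \<epsilon> x \<and> \<bar>\<epsilon> y - \<epsilon> x\<bar> \<le> (1/2)^(i+3) * \<epsilon> x)"
    if "c \<in> C \<inter> H i - (\<Union>l<i. H l)" for i c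
    using near[OF that] unfolding near_def disjoint_eq_subset_Compl .
  have "\<exists>U. submersive p U (- Z i) \<and> (\<forall>x. x \<notin> Z i \<longrightarrow> U x \<notin> C \<inter> H i \<and>
        (U x = x \<or> (\<exists>c\<in>C \<inter> H i - (\<Union>l<i. H l). x \<in> ball c (r i c) \<and> U x \<in> ball c (r i c))))" for i
    unfolding Z_def by (rule stage) (use r in blast)
  then obtain U where U: "\<And>i. submersive p (U i) (- Z i)" "\<And>i x. x \<notin> Z i \<Longrightarrow> U i x \<notin> C \<inter> H i"
    "\<And>i x. x \<notin> Z i \<Longrightarrow> U i x = x \<or> (\<exists>c\<in>C \<inter> H i - (\<Union>l<i. H l). x \<in> ball c (r i c) \<and> U i x \<in> ball c (r i c))"
    by metis
  define R where "R = rec_nat (\<lambda>x. x) (\<lambda>i R x. U i (R x))"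
  have R: "R 0 = (\<lambda>x. x)" "R (Suc i) = (\<lambda>x. U i (R i x))" for i by (simp_all add: R_def)
  \<comment> \<open>Stage \<open>i\<close> moves points only inside balls that miss all
    \<open>H l\<close> with \<open>l < i\<close>, so it cannot undo earlier stages; the same fact
    keeps its argument out of \<open>Z i\<close>.\<close>
  have avoid: "R i x \<notin> C \<inter> H l" if "l < i" for i x l
    using that
  proof (induction i arbitrary: l)
    case (Suc i)
    have z: "R i x \<notin> Z i" using Suc.IH by (auto simp: Z_def)
    show ?case
    proof (cases "l = i")
      case True
      then show ?thesis using U(2)[OF z] by (simp add: R)
    next
      case False
      then have l: "l < i" using Suc.prems by simp
      consider "U i (R i x) = R i x" | c where "c \<in> C \<inter> H i - (\<Union>l<i. H l)" "U i (R i x) \<in> ball c (r i c)"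
        using U(3)[OF z] by blast
      then show ?thesis
      proof cases
        case 1
        then show ?thesis using Suc.IH[OF l] by (simp add: R)
      next
        case 2
        then have "U i (R i x) \<notin> (\<Union>l<i. H l)" using r[OF 2(1)] by blast
        then show ?thesis using l by (auto simp: R)
      qed
    qed
  qed simp
  have RZ: "R i x \<notin> Z i" for i x using avoid by (auto simp: Z_def)
  have sub: "submersive p (R i) UNIV" for i
  proof (induction i)
    case 0
    then show ?case using submersive_id[of UNIV p] by (simp add: R)
  next
    case (Suc i)
    have "R i ` UNIV \<subseteq> - Z i" using RZ by blast
    then show ?case using submersive_compose[OF Suc U(1)[of i]] by (simp add: R)
  qed
  have move: "R (Suc i) x = R i x \<or> (\<exists>c\<in>C \<inter> H i - (\<Union>l<i. H l). R i x \<in> ball c (r i c) \<and> R (Suc i) x \<in> ball c (r i c))" for i x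
    using U(3)[OF RZ[of i x]] by (simp add: R)
  have small: "norm (R (Suc i) x - R i x) \<le> 2 * (1/2)^i" "\<bar>f (R (Suc i) x) - f (R i x)\<bar> \<le> (1/2)^(i+3) * \<epsilon> (R i x)"
    "\<bar>\<epsilon> (R (Suc i) x) - \<epsilon> (R i x)\<bar> \<le> (1/2)^(i+3) * \<epsilon> (R i x)" for i x
  proof -
    have "norm (R (Suc i) x - R i x) \<le> 2 * (1/2)^i \<and> \<bar>f (R (Suc i) x) - f (R i x)\<bar> \<le> (1/2)^(i+3) * \<epsilon> (R i x) \<and>
      \<bar>\<epsilon> (R (Suc i) x) - \<epsilon> (R i x)\<bar> \<le> (1/2)^(i+3) * \<epsilon> (R i x)"
    proof (cases "R (Suc i) x = R i x")
      case True
      then show ?thesis using f(3)[of "R i x"] by simp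
    next
      case False
      then obtain c where c: "c \<in> C \<inter> H i - (\<Union>l<i. H l)" "R i x \<in> ball c (r i c)" "R (Suc i) x \<in> ball c (r i c)"
        using move[of i x] by blast
      have "dist (R (Suc i) x) (R i x) \<le> dist c (R (Suc i) x) + dist c (R i x)" using dist_triangle3 by blast
      also have "\<dots> \<le> 2 * (1/2)^i" using c(2,3) r[OF c(1)] by simp
      finally show ?thesis using r[OF c(1)] c(2,3) by (simp add: dist_norm)
    qed
    then show "norm (R (Suc i) x - R i x) \<le> 2 * (1/2)^i" "\<bar>f (R (Suc i) x) - f (R i x)\<bar> \<le> (1/2)^(i+3) * \<epsilon> (R i x)"
      "\<bar>\<epsilon> (R (Suc i) x) - \<epsilon> (R i x)\<bar> \<le> (1/2)^(i+3) * \<epsilon> (R i x)" by blast+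
  qed
  have p3: "(1/2::real)^(i+3) = (1/2)^i / 8" for i by (simp add: power_add power3_eq_cube)
  \<comment> \<open>The tolerance is measured at the current point, so its growth has to be bounded:
    the factors \<open>1 + (1/2)^i / 8\<close> never carry it beyond twice the initial
    value.\<close>
  have \<epsilon>_le: "\<epsilon> (R i x) \<le> (2 - (1/2)^i) * \<epsilon> x" for i x
  proof (induction i)
    case (Suc i)
    have h: "0 < (1/2::real)^i" "(1/2::real)^i \<le> 1" by (simp_all add: power_le_one)
    have "\<epsilon> (R (Suc i) x) \<le> (1 + (1/2)^i / 8) * \<epsilon> (R i x)"
      using small(3)[of i x, unfolded p3 abs_le_iff distrib_right[symmetric]] unfolding distrib_right by argo
    also have "\<dots> \<le> (1 + (1/2)^i / 8) * ((2 - (1/2)^i) * \<epsilon> x)" using Suc h by (intro mult_left_mono) auto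
    also have "\<dots> = ((1 + (1/2)^i / 8) * (2 - (1/2)^i)) * \<epsilon> x" by simp
    also have "\<dots> \<le> (2 - (1/2)^Suc i) * \<epsilon> x"
    proof (intro mult_right_mono)
      have "0 \<le> (1/2::real)^i * (1/2)^i" by simp
      then show "(1 + (1/2)^i / 8) * (2 - (1/2)^i) \<le> 2 - (1/2::real)^Suc i"
        using h by (simp add: algebra_simps)
    qed (use f(3)[of x] in simp)
    finally show ?case .
  qed (simp add: R)
  \<comment> \<open>With \<open>\<epsilon> (R i x) \<le> 2 * \<epsilon> x\<close> the step is at
    most \<open>(1/2)^(i+1)\<close> times \<open>\<epsilon> x / 2\<close>, the increment of the
    claimed bound.\<close>
  have f_le: "\<bar>f (R i x) - f x\<bar> \<le> (1 - (1/2)^i) * (\<epsilon> x / 2)" for i x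
  proof (induction i)
    case (Suc i)
    have "\<bar>f (R (Suc i) x) - f (R i x)\<bar> \<le> (1/2)^(i+3) * (2 * \<epsilon> x)"
    proof (rule order_trans[OF small(2)], rule mult_left_mono)
      have "(2 - (1/2)^i) * \<epsilon> x \<le> 2 * \<epsilon> x" using f(3)[of x] by (intro mult_right_mono) auto
      then show "\<epsilon> (R i x) \<le> 2 * \<epsilon> x" using \<epsilon>_le[of i x] by linarith
    qed simp
    moreover have "(1/2)^(i+3) * (2 * \<epsilon> x) \<le> (1/2)^Suc i * (\<epsilon> x / 2)" 
      using f(3)[of x] by (simp add: p3)
    moreover have "(1 - (1/2)^Suc i) * (\<epsilon> x / 2) = (1 - (1/2)^i) * (\<epsilon> x / 2) + (1/2)^Suc i * (\<epsilon> x / 2)"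
      by (simp add: algebra_simps)
    ultimately show ?case using Suc by linarith
  qed (simp add: R)
  have stable: "R m y = R n y" if "n \<le> m" "j < n" "R n y \<in> O' j" for n m j y
    using that(1)
  proof (induction m rule: dec_induct)
    case (step m)
    have "R m y \<in> H j" using step.IH that(3) O'(2) by auto
    moreover have "j < m" using that(2) step.hyps by simp
    ultimately have "R m y \<in> (\<Union>l<m. H l)" by blast
    then have "R (Suc m) y = R m y" using move[of m y] r by blast
    then show ?case using step.IH by simp
  qed simp
  \<comment> \<open>The steps are summable, so by completeness the orbit converges; its limit lies
    in some \<open>O' j\<close>, and the index eventually exceeds \<open>j\<close>.\<close>
  have enter: "\<exists>n j. j < n \<and> R n x \<in> O' j" for x
  proof -
    have "summable (\<lambda>i. 2 * (1/2::real)^i)" by (intro summable_mult summable_geometric) simp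
    then have "summable (\<lambda>i. R (Suc i) x - R i x)" by (rule summable_comparison_test'[of _ 0]) (use small(1) in simp)
    from summable_LIMSEQ[OF this]
    have "(\<lambda>n. R n x - R 0 x) \<longlonglongrightarrow> (\<Sum>i. R (Suc i) x - R i x)"
      by (simp only: sum_lessThan_telescope[of "\<lambda>i. R i x"])
    from tendsto_add[OF this tendsto_const[of "R 0 x"]]
    obtain z where z: "(\<lambda>i. R i x) \<longlonglongrightarrow> z" by simp
    obtain j where "z \<in> O' j" using O'(3) by blast
    then have "\<forall>\<^sub>F i in sequentially. R i x \<in> O' j" using z O'(1) topological_tendstoD by blast
    moreover have "\<forall>\<^sub>F i in sequentially. j < i" by (rule eventually_gt_at_top)
    ultimately have "\<forall>\<^sub>F i in sequentially. j < i \<and> R i x \<in> O' j" by eventually_elim simp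
    then show ?thesis using eventually_happens' sequentially_bot by blast
  qed
  define R' where "R' x = lim (\<lambda>n. R n x)" for x
  have R'_eq: "R' y = R n y" if "j < n" "R n y \<in> O' j" for n j y
  proof -
    have "\<forall>\<^sub>F m in sequentially. R m y = R n y"
      unfolding eventually_sequentially using stable[OF _ that] by blast
    then show ?thesis unfolding R'_def by (intro limI tendsto_eventually)
  qed
  have "submersive p R' UNIV"
  proof (rule submersive_local)
    fix x
    obtain n j where nj: "j < n" "R n x \<in> O' j" using enter by blast
    have "continuous_on UNIV (R n)" using submersive_isCont[OF sub] by (simp add: continuous_at_imp_continuous_on)
    then have "open (R n -` O' j)" using O'(1) by (simp add: open_vimage)
    moreover have "\<forall>y\<in>R n -` O' j. R' y = R n y" using R'_eq[OF nj(1)] by simp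
    ultimately show "\<exists>T v Z. open T \<and> x \<in> T \<and> T \<subseteq> UNIV \<and> T \<subseteq> Z \<and> submersive p v Z \<and> (\<forall>y\<in>T. R' y = v y)"
      using nj(2) sub[of n] by (intro exI[of _ "R n -` O' j"] exI[of _ "R n"] exI[of _ UNIV]) simp
  qed simp
  moreover have "R' x \<notin> C \<and> \<bar>f (R' x) - f x\<bar> \<le> \<epsilon> x / 2" for x
  proof -
    obtain n j where nj: "j < n" "R n x \<in> O' j" using enter by blast
    have "R' x \<notin> C" using R'_eq[OF nj] avoid[OF nj(1), of x] O'(2) nj(2) by auto
    moreover have "(1 - (1/2)^n) * (\<epsilon> x / 2) \<le> 1 * (\<epsilon> x / 2)" using f(3)[of x] by (intro mult_right_mono) auto
    then have "\<bar>f (R' x) - f x\<bar> \<le> \<epsilon> x / 2" using f_le[of n x] unfolding R'_eq[OF nj] by linarith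
    ultimately show ?thesis by blast
  qed
  ultimately show ?thesis by (intro exI[of _ R']) simp
qed

text \<open>Vanishing of the derivative on a set of directions is inherited by sums, products and
  cutoffs. This spares the explicit derivative of the weights, which are long products.\<close>

definition stationary :: "'a::real_normed_vector \<Rightarrow> 'a set \<Rightarrow> ('a \<Rightarrow> real) \<Rightarrow> bool" where
  "stationary c T f \<longleftrightarrow> (\<exists>D. (f has_derivative D) (at c) \<and> (\<forall>h\<in>T. D h = 0))"

lemma stationary_const: "stationary c T (\<lambda>_. k)"
  unfolding stationary_def by (intro exI[of _ "\<lambda>_. 0"]) simp

lemma stationary_add:
  assumes "stationary c T f" "stationary c T g" shows "stationary c T (\<lambda>x. f x + g x)"
proof -
  obtain D E where "(f has_derivative D) (at c)" "\<forall>h\<in>T. D h = 0" "(g has_derivative E) (at c)" "\<forall>h\<in>T. E h = 0"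
    using assms unfolding stationary_def by blast
  then show ?thesis unfolding stationary_def by (intro exI[of _ "\<lambda>h. D h + E h"]) (simp add: has_derivative_add)
qed

lemma stationary_mult:
  assumes "stationary c T f" "stationary c T g" shows "stationary c T (\<lambda>x. f x * g x)"
proof -
  obtain D E where "(f has_derivative D) (at c)" "\<forall>h\<in>T. D h = 0" "(g has_derivative E) (at c)" "\<forall>h\<in>T. E h = 0"
    using assms unfolding stationary_def by blast
  then show ?thesis unfolding stationary_def
    by (intro exI[of _ "\<lambda>h. f c * E h + D h * g c"]) (simp add: has_derivative_mult)
qed

lemma stationary_diff: "stationary c T f \<Longrightarrow> stationary c T g \<Longrightarrow> stationary c T (\<lambda>x. f x - g x)"
  using stationary_add[of c T f "\<lambda>x. (-1) * g x"] stationary_mult[OF stationary_const[of c T "-1"], of g] by simp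

lemma stationary_sum: "finite I \<Longrightarrow> (\<And>i. i \<in> I \<Longrightarrow> stationary c T (f i)) \<Longrightarrow> stationary c T (\<lambda>x. \<Sum>i\<in>I. f i x)"
  by (induction I rule: finite_induct) (auto intro: stationary_const stationary_add)

lemma stationary_prod: "finite I \<Longrightarrow> (\<And>i. i \<in> I \<Longrightarrow> stationary c T (f i)) \<Longrightarrow> stationary c T (\<lambda>x. \<Prod>i\<in>I. f i x)"
  by (induction I rule: finite_induct) (auto intro: stationary_const stationary_mult)

lemma stationary_step:
  assumes "stationary c T f" shows "stationary c T (\<lambda>x. step (f x))"
proof -
  obtain D where D: "(f has_derivative D) (at c)" "\<forall>h\<in>T. D h = 0" using assms unfolding stationary_def by blast
  have "smooth 1 (\<lambda>x::real. step x) UNIV" by (intro smooth_step smooth_linear bounded_linear_ident) simp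
  from smooth_derivative(1)[OF this, of "f c"] obtain E where E: "(step has_derivative E) (at (f c))" by auto
  have "E 0 = 0" using has_derivative_bounded_linear[OF E] bounded_linear.linear linear_0 by blast
  then show ?thesis unfolding stationary_def using has_derivative_compose[OF D(1) E] D(2)
    by (intro exI[of _ "\<lambda>h. E (D h)"]) simp
qed

section \<open>A functional outside countably many finite-dimensional spans\<close>

context smooth_LUR
begin

text \<open>\<Phi> is the series of the functionals norming the \<open>e j\<close>, with weights
  \<open>(1/4)^j\<close>. At \<open>e k\<close> the terms before \<open>k\<close> vanish, the
  \<open>k\<close>-th is \<open>(1/4)^k\<close>, and the tail is at most a third of that. Since
  \<open>e i\<close> annihilates \<open>w 0, ..., w i\<close>, it witnesses the claim for
  \<open>i\<close>.\<close>

lemma functional_outside_finite_spans: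
  fixes w :: "nat \<Rightarrow> 'a \<Rightarrow> real"
  assumes w: "\<And>l. bounded_linear (w l)"
  shows "\<exists>\<Phi>. bounded_linear \<Phi> \<and> (\<forall>i. \<exists>v. (\<forall>l\<le>i. w l v = 0) \<and> \<Phi> v \<noteq> (0::real))"
proof -
  obtain \<Psi> where \<Psi>: "\<And>x. bounded_linear (\<Psi> x)" "\<And>x h. \<bar>\<Psi> x h\<bar> \<le> N h" "\<And>x. \<Psi> x x = N x"
    using norming_functional_total by metis
  have "\<exists>e. \<forall>n::nat. N (e n) = 1 \<and> (\<forall>l\<le>n. w l (e n) = 0) \<and> (\<forall>j<n. \<Psi> (e j) (e n) = 0)"
  proof (rule dependent_wellorder_choice)
    fix n :: nat and e :: "nat \<Rightarrow> 'a"
    show "\<exists>v. N v = 1 \<and> (\<forall>l\<le>n. w l v = 0) \<and> (\<forall>j<n. \<Psi> (e j) v = 0)"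
    proof -
      have "\<exists>v. N v = 1 \<and> (\<forall>f\<in>w ` {..n} \<union> (\<lambda>j. \<Psi> (e j)) ` {..<n}. f v = 0)"
        by (rule common_null_vector) (use w \<Psi>(1) in auto)
      then show ?thesis by auto
    qed
  qed simp
  then obtain e where e: "\<And>n. N (e n) = 1" "\<And>n l. l \<le> n \<Longrightarrow> w l (e n) = 0" "\<And>n j. j < n \<Longrightarrow> \<Psi> (e j) (e n) = 0"
    by blast
  define \<Phi> where "\<Phi> h = (\<Sum>j. (1/4)^j * \<Psi> (e j) h)" for h
  have sg: "summable (\<lambda>j. (1/4::real)^j)" by (simp add: summable_geometric)
  have bd: "\<bar>(1/4)^j * \<Psi> (e j) h\<bar> \<le> (1/4)^j * N h" for j h
    using \<Psi>(2) by (simp add: abs_mult mult_left_mono)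
  have sN: "summable (\<lambda>j. (1/4)^j * N h)" for h using sg by (rule summable_mult2)
  have sm: "summable (\<lambda>j. (1/4)^j * \<Psi> (e j) h)" for h
    by (rule summable_comparison_test'[OF sN, of 0]) (use bd in simp)
  have lin: "\<Psi> x (y + z) = \<Psi> x y + \<Psi> x z" "\<Psi> x (s *\<^sub>R y) = s * \<Psi> x y" for x y z s
    using \<Psi>(1)[of x] by (simp_all add: linear_add linear_scale bounded_linear.linear)
  obtain D where D: "D > 0" "\<forall>x. N x \<le> D * norm x" using N_upper by blast
  have "bounded_linear \<Phi>"
  proof (rule bounded_linear_intro)
    show "\<Phi> (x + y) = \<Phi> x + \<Phi> y" for x y
      unfolding \<Phi>_def using suminf_add[OF sm[of x] sm[of y]] by (simp add: lin distrib_left)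
    show "\<Phi> (s *\<^sub>R x) = s *\<^sub>R \<Phi> x" for s x
      unfolding \<Phi>_def using suminf_mult[OF sm[of x], of s] by (simp add: lin mult.left_commute)
    show "norm (\<Phi> x) \<le> norm x * (2 * D)" for x
    proof -
      have s: "summable (\<lambda>j. norm ((1/4)^j * \<Psi> (e j) x))"
        by (rule summable_comparison_test'[OF sN[of x], of 0]) (use bd in simp)
      have "norm (\<Phi> x) \<le> (\<Sum>j. norm ((1/4)^j * \<Psi> (e j) x))" unfolding \<Phi>_def by (rule summable_norm[OF s])
      also have "\<dots> \<le> (\<Sum>j. (1/4)^j * N x)" by (rule suminf_le[OF _ s sN]) (use bd in simp)
      also have "\<dots> = (4/3) * N x" using suminf_mult2[OF sg, of "N x"] suminf_geometric[of "1/4::real"] by simp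
      also have "\<dots> \<le> 2 * (D * norm x)" using D N_nonneg[of x] by (intro mult_mono) auto
      finally show ?thesis by (simp add: ac_simps)
    qed
  qed
  moreover have "\<Phi> (e k) \<noteq> 0" for k
  proof -
    let ?t = "\<lambda>j. (1/4)^j * \<Psi> (e j) (e k)"
    have "\<Phi> (e k) = (\<Sum>j. ?t (j + Suc k)) + (\<Sum>j<Suc k. ?t j)"
      unfolding \<Phi>_def by (rule suminf_split_initial_segment[OF sm])
    moreover have "(\<Sum>j<Suc k. ?t j) = (1/4)^k" using e(1,3) \<Psi>(3) by simp
    moreover have "\<bar>\<Sum>j. ?t (j + Suc k)\<bar> \<le> (1/4)^k / 3"
    proof -
      have sk: "summable (\<lambda>j. (1/4)^Suc k * (1/4::real)^j)" using sg by (rule summable_mult)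
      have b: "norm (?t (j + Suc k)) \<le> (1/4)^Suc k * (1/4)^j" for j
        using bd[of "j + Suc k" "e k"] e(1)[of k] by (simp add: power_add mult.commute)
      have s: "summable (\<lambda>j. norm (?t (j + Suc k)))"
        by (rule summable_comparison_test'[OF sk, of 0]) (use b in simp)
      have "norm (\<Sum>j. ?t (j + Suc k)) \<le> (\<Sum>j. norm (?t (j + Suc k)))" by (rule summable_norm[OF s])
      also have "\<dots> \<le> (\<Sum>j. (1/4)^Suc k * (1/4::real)^j)" by (rule suminf_le[OF b s sk])
      also have "\<dots> = (1/4)^k / 3" using suminf_mult[OF sg, of "(1/4)^Suc k"] suminf_geometric[of "1/4::real"] by simp
      finally show ?thesis by simp
    qed
    moreover have "(0::real) < (1/4)^k" by simp
    ultimately show ?thesis by linarith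
  qed
  ultimately show ?thesis using e(2) by (intro exI[of _ \<Phi>]) blast
qed

end

section \<open>Slices, critical points and the approximating function\<close>

context lur_convex
begin

text \<open>The Bregman divergence of \<theta>.\<close>

definition slice where "slice x y = \<theta> y - \<theta> x - grad x (y - x)"

lemma slice_self: "slice x x = 0" by (simp add: slice_def grad_0)

lemma smooth_slice: "smooth p (slice x) UNIV"
  unfolding slice_def grad_diff
  by (intro smooth_diff smooth_\<theta> smooth_const smooth_linear bounded_linear_grad open_UNIV)

lemma slice_derivative: "(slice x has_derivative (\<lambda>h. grad c h - grad x h)) (at c)"
proof -
  have "((\<lambda>y. \<theta> y - \<theta> x - (grad x y - grad x x)) has_derivative (\<lambda>h. grad c h - 0 - (grad x h - 0))) (at c)"
    by (intro has_derivative_diff has_derivative_\<theta> has_derivative_const bounded_linear_imp_has_derivative bounded_linear_grad)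
  then show ?thesis by (simp add: slice_def[abs_def] grad_diff)
qed

lemma slice_small:
  assumes "0 < \<rho>"
  shows "\<exists>s>0. \<forall>y. slice x y < 4 * s \<longrightarrow> y \<in> ball x \<rho>"
proof (rule ccontr)
  assume "\<not> ?thesis"
  from seq_counterexample[OF this] obtain y where
    "\<forall>j::nat. \<not> (slice x (y j) < 4 * (1 / real (Suc j)) \<longrightarrow> y j \<in> ball x \<rho>)" ..
  then have y: "slice x (y j) \<le> 4 * (1 / real (Suc j))" "y j \<notin> ball x \<rho>" for j by (meson less_imp_le)+
  have "(\<lambda>j. 4 * (1 / real (Suc j))) \<longlonglongrightarrow> 0" using tendsto_mult_right_zero[OF inverse_Suc_tendsto] .
  then have "y \<longlonglongrightarrow> x" by (rule tendsto_by_gap) (use y(1) in \<open>simp add: slice_def\<close>)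
  then have "\<forall>\<^sub>F j in sequentially. dist (y j) x < \<rho>" using assms by (rule tendstoD)
  then obtain j where "dist (y j) x < \<rho>" using eventually_happens' sequentially_bot by blast
  then show False using y(2)[of j] by (simp add: dist_commute)
qed

text \<open>Modulo the differentials of the slices, the derivative of \<open>F\<close> at \<open>c\<close> is a positive multiple
  of \<open>\<Phi>\<close>; it vanishes only if \<open>grad c\<close> is a combination of \<open>grad (X 0), \<dots>, grad (X i)\<close> and \<open>\<Phi>\<close>.\<close>

lemma critical_point_flat:
  fixes X :: "nat \<Rightarrow> 'a" and \<Phi> :: "'a \<Rightarrow> real"
  assumes \<Phi>: "bounded_linear \<Phi>"
    and \<phi>: "\<phi> = (\<lambda>l y. step (3 - slice (X l) y / S l))"
    and b: "\<And>l. 0 < b l" and S: "0 < S i" and c: "slice (X i) c \<le> 3/2 * S i"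
    and crit: "((\<lambda>y. tele \<phi> a y + \<Phi> y * tele \<phi> b y) has_derivative (\<lambda>_. 0)) (at c)"
    and v: "\<And>l. l \<le> i \<Longrightarrow> grad (X l) v = 0" "\<Phi> v = 0"
    and w: "\<And>l. l \<le> i \<Longrightarrow> grad (X l) w = 0" "\<Phi> w \<noteq> 0"
  shows "grad c v = 0"
proof (rule ccontr)
  assume n: "grad c v \<noteq> 0"
  \<comment> \<open>The directions in which all slices up to the \<open>i\<close>-th have zero
    derivative at \<open>c\<close>; there the weights contribute nothing.\<close>
  define T where "T = {h. \<forall>l\<le>i. grad (X l) h = grad c h}"
  define W where "W a y = (\<Sum>l\<le>i. a l * (\<phi> l y * (\<Prod>m<l. 1 - \<phi> m y)))" for a :: "nat \<Rightarrow> real" and y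
  \<comment> \<open>On this neighbourhood of \<open>c\<close> the \<open>i\<close>-th cutoff is 1,
    so only the slices up to \<open>i\<close> enter the sums.\<close>
  define O' where "O' = slice (X i) -` {..<2 * S i}"
  have cs: "continuous_on UNIV (slice x)" for x using smooth_continuous_on[OF smooth_slice] .
  have O': "open O'" "c \<in> O'" using cs c S by (auto simp: O'_def open_vimage)
  have one: "\<phi> i y = 1" if "y \<in> O'" for y
    unfolding \<phi> by (rule step_eq_1) (use that S in \<open>simp add: O'_def field_simps\<close>)
  have eq: "tele \<phi> a y = W a y" if "y \<in> O'" for a y unfolding W_def by (rule tele_eq) (rule one[OF that])
  have st\<phi>: "stationary c T (\<phi> l)" if "l \<le> i" for l
  proof -
    have "stationary c T (slice (X l))"
      unfolding stationary_def using slice_derivative[of "X l" c] that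
      by (intro exI[of _ "\<lambda>h. grad c h - grad (X l) h"]) (simp add: T_def)
    then have "stationary c T (\<lambda>y. step (3 - (1 / S l) * slice (X l) y))"
      by (intro stationary_step stationary_diff stationary_mult stationary_const)
    then show ?thesis by (simp add: \<phi>)
  qed
  have stW: "stationary c T (W a)" for a
    unfolding W_def by (intro stationary_sum stationary_mult stationary_const stationary_prod stationary_diff st\<phi>) auto
  obtain D E where D: "(W a has_derivative D) (at c)" "\<forall>h\<in>T. D h = 0" and E: "(W b has_derivative E) (at c)" "\<forall>h\<in>T. E h = 0"
    using stW[of a] stW[of b] unfolding stationary_def by blast
  have "((\<lambda>y. W a y + \<Phi> y * W b y) has_derivative (\<lambda>h. D h + (\<Phi> c * E h + \<Phi> h * W b c))) (at c)"
    by (intro has_derivative_add has_derivative_mult D(1) E(1) bounded_linear_imp_has_derivative[OF \<Phi>])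
  moreover have "((\<lambda>y. W a y + \<Phi> y * W b y) has_derivative (\<lambda>_. 0)) (at c)"
    by (rule has_derivative_transform_within_open[OF crit O']) (simp add: eq)
  ultimately have z: "(\<lambda>h. D h + (\<Phi> c * E h + \<Phi> h * W b c)) = (\<lambda>_. 0)" by (rule has_derivative_unique)
  have "tele \<phi> b c \<in> {0<..}"
    by (rule tele_in_convex[where \<phi> = \<phi> and m = i, OF one[OF O'(2)]]) (use b in \<open>simp_all add: \<phi> step_bounds\<close>)
  then have Wb: "W b c > 0" using eq[OF O'(2)] by simp
  \<comment> \<open>The multiple of \<open>v\<close> makes \<open>grad c h\<close> vanish like all
    \<open>grad (X l) h\<close>, so \<open>h\<close> lies in \<open>T\<close>; as
    \<open>\<Phi> v = 0\<close>, the value \<open>\<Phi> h = \<Phi> w\<close> stays nonzero.\<close>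
  define h where "h = w - (grad c w / grad c v) *\<^sub>R v"
  have "h \<in> T" using v(1) w(1) n by (simp add: T_def h_def grad_diff grad_scale)
  then have "\<Phi> h * W b c = 0" using fun_cong[OF z, of h] D(2) E(2) by simp
  then have "\<Phi> h = 0" using Wb by simp
  then show False using w(2) v(2) \<Phi> by (simp add: h_def linear_diff linear_scale bounded_linear.linear)
qed

lemma closed_critical_set:
  assumes F: "smooth p F UNIV"
  shows "closed {c. frechet_derivative F (at c) = (\<lambda>_. 0)}"
proof -
  have "closed {c. frechet_derivative F (at c) h = 0}" for h
  proof -
    have "isCont (\<lambda>c. frechet_derivative F (at c) h) c" for c
      unfolding continuous_at tendsto_iff
    proof (intro allI impI)
      fix e :: real assume e: "0 < e"
      have "0 < e / (norm h + 1)" using e by (simp add: add_nonneg_pos)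
      from smooth_derivative(2)[OF F p1 UNIV_I this, of c]
      have "\<forall>\<^sub>F y in at c. \<forall>h'. \<bar>frechet_derivative F (at y) h' - frechet_derivative F (at c) h'\<bar> \<le> e / (norm h + 1) * norm h'"
        unfolding eventually_nhds_conv_at by blast
      then show "\<forall>\<^sub>F y in at c. dist (frechet_derivative F (at y) h) (frechet_derivative F (at c) h) < e"
      proof eventually_elim
        case (elim y)
        have "e / (norm h + 1) * norm h < e" using e by (simp add: divide_less_eq add_nonneg_pos)
        then show ?case using elim[rule_format, of h] by (simp add: dist_real_def)
      qed
    qed
    then show ?thesis by (intro closed_Collect_eq) (simp_all add: continuous_at_imp_continuous_on)
  qed
  moreover have "{c. frechet_derivative F (at c) = (\<lambda>_. 0)} = (\<Inter>h. {c. frechet_derivative F (at c) h = 0})" by auto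
  ultimately show ?thesis by auto
qed

text \<open>The kernel of the projection consists of the common zeros of \<Phi> and the first
  \<open>i + 1\<close> gradients. It has finite codimension, so a unit vector in it can still be
  chosen to annihilate any finite set of further functionals.\<close>

lemma avoid_flat_slice:
  fixes X :: "nat \<Rightarrow> 'a"
  assumes \<Phi>: "bounded_linear \<Phi>" and C: "closed C" and H: "\<And>l. closed (H l)" and bd: "bounded (H i)"
    and flat: "\<And>c v. c \<in> C \<inter> H i \<Longrightarrow> (\<And>l. l \<le> i \<Longrightarrow> grad (X l) v = 0) \<Longrightarrow> \<Phi> v = (0::real) \<Longrightarrow> grad c v = 0"
    and r: "\<And>c. c \<in> C \<inter> H i - (\<Union>l<i. H l) \<Longrightarrow> 0 < r c \<and> ball c (r c) \<inter> (\<Union>l<i. H l) = {}"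
  shows "\<exists>U. submersive p U (- (C \<inter> H i \<inter> (\<Union>l<i. H l))) \<and> (\<forall>x. x \<notin> C \<inter> H i \<inter> (\<Union>l<i. H l) \<longrightarrow> U x \<notin> C \<inter> H i \<and>
        (U x = x \<or> (\<exists>c\<in>C \<inter> H i - (\<Union>l<i. H l). x \<in> ball c (r c) \<and> U x \<in> ball c (r c))))"
proof -
  define F where "F = insert \<Phi> ((\<lambda>l. grad (X l)) ` {..i})"
  have F: "finite F" "\<And>f. f \<in> F \<Longrightarrow> bounded_linear f" using \<Phi> bounded_linear_grad by (auto simp: F_def)
  obtain P where proj: "bounded_linear P" "\<And>x. P (P x) = P x" "\<And>x. P x = 0 \<longleftrightarrow> (\<forall>f\<in>F. f x = 0)"
    using finite_rank_projection[OF F] by auto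
  define K where "K = C \<inter> H i"
  define Z0 where "Z0 = K \<inter> (\<Union>l<i. H l)"
  have KZ: "K - Z0 = C \<inter> H i - (\<Union>l<i. H l)" by (auto simp: K_def Z0_def)
  have cl: "closed K" "closed Z0" unfolding K_def Z0_def using C H by (auto intro!: closed_Int closed_UN)
  have bK: "bounded K" unfolding K_def using bd by (rule bounded_subset) simp
  have fl: "grad c v = 0" if "c \<in> K" "P v = 0" for c v
    by (rule flat) (use that proj(3) in \<open>auto simp: K_def F_def\<close>)
  interpret flat_critical_set p N \<theta> L P K
    by (rule flat_critical_set.intro[OF lur_convex_axioms], rule flat_critical_set_axioms.intro)
      (fact proj(1,2) cl(1) bK fl)+
  have null: "\<exists>v. N v = 1 \<and> P v = 0 \<and> (\<forall>f\<in>G. f v = (0::real))" if G: "finite G" "\<And>f. f \<in> G \<Longrightarrow> bounded_linear f" for G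
  proof -
    have "\<exists>v. N v = 1 \<and> (\<forall>f\<in>F \<union> G. f v = 0)" by (rule common_null_vector) (use F G in auto)
    then show ?thesis using proj(3) by blast
  qed
  have "\<exists>U. submersive p U (- Z0) \<and> (\<forall>x. x \<notin> Z0 \<longrightarrow> U x \<notin> K \<and>
    (U x = x \<or> (\<exists>c\<in>K - Z0. x \<in> ball c (r c) \<and> U x \<in> ball c (r c))))"
  proof (rule avoid_flat_critical_set[OF null cl(2)])
    show "Z0 \<subseteq> K" by (auto simp: Z0_def)
    show "0 < r c" "ball c (r c) \<inter> Z0 = {}" if "c \<in> K - Z0" for c
      using r[of c] that unfolding KZ by (auto simp: Z0_def)
  qed
  then show ?thesis unfolding KZ unfolding Z0_def K_def .
qed

theorem approximation_without_critical_points: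
  fixes f \<epsilon> :: "'a \<Rightarrow> real"
  assumes f: "continuous_on UNIV f" "continuous_on UNIV \<epsilon>" "\<And>x. 0 < \<epsilon> x"
  shows "\<exists>g. smooth p g UNIV \<and> (\<forall>x. \<bar>f x - g x\<bar> \<le> \<epsilon> x) \<and> (\<forall>x. \<not> critical_point g x)"
proof -
  have "\<exists>\<rho>>0. \<rho> \<le> 1 \<and> ball x \<rho> \<subseteq> UNIV \<and> (\<forall>y\<in>ball x \<rho>. \<forall>z\<in>ball x \<rho>. \<bar>f z - f y\<bar> \<le> (1/8) * \<epsilon> y \<and> \<bar>\<epsilon> z - \<epsilon> y\<bar> \<le> (1/8) * \<epsilon> y)" for x :: 'a
    by (rule small_oscillation_radius[OF f]) auto
  then obtain \<rho> :: "'a \<Rightarrow> real" where \<rho>: "\<And>x. 0 < \<rho> x" "\<And>x. \<rho> x \<le> 1"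
    "\<And>x y z. y \<in> ball x (\<rho> x) \<Longrightarrow> z \<in> ball x (\<rho> x) \<Longrightarrow> \<bar>f z - f y\<bar> \<le> (1/8) * \<epsilon> y \<and> \<bar>\<epsilon> z - \<epsilon> y\<bar> \<le> (1/8) * \<epsilon> y"
    by metis
  obtain s :: "'a \<Rightarrow> real" where s: "\<And>x. 0 < s x" "\<And>x y. slice x y < 4 * s x \<Longrightarrow> y \<in> ball x (\<rho> x)"
  proof -
    have "\<forall>x. \<exists>s>0. \<forall>y. slice x y < 4 * s \<longrightarrow> y \<in> ball x (\<rho> x)" using slice_small \<rho>(1) by blast
    then show ?thesis using that by metis
  qed
  have cs: "continuous_on UNIV (slice x)" for x using smooth_continuous_on[OF smooth_slice] .
  define W where "W x = slice x -` {..<s x}" for x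
  have W: "open (W x)" "x \<in> W x" for x using cs s(1) by (auto simp: W_def open_vimage slice_self)
  obtain X :: "nat \<Rightarrow> 'a" where X: "(\<Union>n. W (X n)) = UNIV"
    using lindelof_sequence[OF sep, of UNIV W] W by auto
  define S where "S i = s (X i)" for i
  \<comment> \<open>The levels of a slice are staggered: \<open>S\<close> for the open cover,
    \<open>3/2 * S\<close> for the closed sets, up to \<open>2 * S\<close> the cutoff is 1, from
    \<open>3 * S\<close> on it is 0, and below \<open>4 * S\<close> the slice lies in its
    ball.\<close>
  define \<phi> where "\<phi> = (\<lambda>l y. step (3 - slice (X l) y / S l))"
  have S: "0 < S i" for i using s(1) by (simp add: S_def)
  obtain \<Phi> where \<Phi>: "bounded_linear \<Phi>" "\<And>i. \<exists>v. (\<forall>l\<le>i. grad (X l) v = 0) \<and> \<Phi> v \<noteq> (0::real)"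
    using functional_outside_finite_spans[of "\<lambda>l. grad (X l)", OF bounded_linear_grad] by metis
  obtain M where M: "0 < M" "\<And>x. norm (\<Phi> x) \<le> norm x * M" using bounded_linear.pos_bounded[OF \<Phi>(1)] by blast
  \<comment> \<open>The radius of the ball is at most 1, so there
    \<open>\<bar>\<Phi> y\<bar>\<close> is at most \<open>(norm (X i) + 1) * M\<close>, and the term
    with \<Phi> contributes at most \<open>\<epsilon> (X i) / 8\<close>.\<close>
  define b where "b i = \<epsilon> (X i) / (8 * ((norm (X i) + 1) * M))" for i
  define a where "a i = f (X i)" for i
  have den: "0 < 8 * ((norm x + 1) * M)" for x :: 'a
    using M(1) by (intro mult_pos_pos) (auto simp: add_nonneg_pos)
  have b: "0 < b i" for i unfolding b_def using f(3) den by (intro divide_pos_pos)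
  have one: "\<phi> i y = 1" if "slice (X i) y < 2 * S i" for i y
    unfolding \<phi>_def by (rule step_eq_1) (use that S[of i] in \<open>simp add: field_simps\<close>)
  have cover: "\<exists>i. slice (X i) y < S i" for y
  proof -
    have "y \<in> (\<Union>n. W (X n))" using X by simp
    then show ?thesis by (auto simp: W_def S_def)
  qed
  have near: "y \<in> ball (X i) (\<rho> (X i))" if "\<phi> i y \<noteq> 0" for i y
  proof (rule s(2), rule ccontr)
    assume "\<not> slice (X i) y < 4 * s (X i)"
    then have "3 - slice (X i) y / S i \<le> 0" using S[of i] by (simp add: S_def field_simps)
    then show False using that step_eq_0 by (simp add: \<phi>_def)
  qed
  have sm\<phi>: "smooth p (\<phi> i) UNIV" for i
    unfolding \<phi>_def using S[of i] by (intro smooth_step smooth_diff smooth_divide smooth_const smooth_slice) auto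
  have loc: "\<exists>n T. open T \<and> y \<in> T \<and> T \<subseteq> UNIV \<and> (\<forall>z\<in>T. \<phi> n z = 1)" for y
  proof -
    obtain i where i: "slice (X i) y < S i" using cover by blast
    have "\<forall>z\<in>W (X i). \<phi> i z = 1" using one S[of i] by (auto simp: W_def S_def)
    then show ?thesis using W(1) i by (intro exI[of _ i] exI[of _ "W (X i)"]) (simp add: W_def S_def)
  qed
  define F where "F y = tele \<phi> a y + \<Phi> y * tele \<phi> b y" for y
  have smF: "smooth p F UNIV"
    unfolding F_def by (intro smooth_add smooth_mult smooth_tele sm\<phi> smooth_linear \<Phi>(1) open_UNIV loc)
  have Ff: "\<bar>F y - f y\<bar> \<le> \<epsilon> y / 2" for y
  proof -
    obtain m where "slice (X m) y < S m" using cover by blast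
    then have m: "\<phi> m y = 1" using one[of m y] S[of m] by simp
    have "F y = tele \<phi> (\<lambda>i. a i + \<Phi> y * b i) y"
      unfolding F_def tele_eq[of \<phi>, OF m] by (simp add: sum.distrib sum_distrib_left distrib_right mult.assoc)
    also have "\<dots> \<in> cball (f y) (\<epsilon> y / 2)"
    proof (rule tele_in_convex[where \<phi> = \<phi> and m = m, OF m])
      fix n assume "\<phi> n y \<noteq> 0"
      then have y: "y \<in> ball (X n) (\<rho> (X n))" by (rule near)
      have x: "X n \<in> ball (X n) (\<rho> (X n))" using \<rho>(1) by simp
      have 1: "\<bar>f (X n) - f y\<bar> \<le> (1/8) * \<epsilon> y" "\<bar>\<epsilon> (X n) - \<epsilon> y\<bar> \<le> (1/8) * \<epsilon> y" using \<rho>(3)[OF y x] by auto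
      have "norm y \<le> norm (X n) + 1"
        using y \<rho>(2)[of "X n"] norm_triangle_ineq4[of "X n" "X n - y"] by (simp add: dist_norm)
      then have "norm y * M \<le> (norm (X n) + 1) * M" using M(1) by (intro mult_right_mono) auto
      then have "\<bar>\<Phi> y\<bar> \<le> (norm (X n) + 1) * M" using M(2)[of y] by simp
      then have "\<bar>\<Phi> y\<bar> * b n \<le> ((norm (X n) + 1) * M) * b n" using b[of n] by (intro mult_right_mono) auto
      also have "\<dots> = \<epsilon> (X n) / 8" unfolding b_def using den[of "X n"] by (simp add: field_simps)
      finally have 2: "\<bar>\<Phi> y * b n\<bar> \<le> \<epsilon> (X n) / 8" using b[of n] by (simp add: abs_mult)
      \<comment> \<open>The error is at most \<open>1/8 + 1/8 * 9/8\<close> times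
        \<open>\<epsilon> y\<close>, since
        \<open>\<epsilon> (X n) \<le> 9/8 * \<epsilon> y\<close>.\<close>
      have "\<bar>a n + \<Phi> y * b n - f y\<bar> \<le> \<epsilon> y / 2"
        using 1 2 f(3)[of y] unfolding a_def abs_le_iff by argo
      then show "a n + \<Phi> y * b n \<in> cball (f y) (\<epsilon> y / 2)" by (simp add: dist_real_def abs_minus_commute)
    qed (simp_all add: \<phi>_def step_bounds)
    finally show ?thesis by (simp add: dist_real_def abs_minus_commute)
  qed
  define C where "C = {c. frechet_derivative F (at c) = (\<lambda>_. 0)}"
  define H where "H i = slice (X i) -` {..3/2 * S i}" for i
  have C: "closed C" unfolding C_def by (rule closed_critical_set[OF smF])
  have dF: "(F has_derivative frechet_derivative F (at x)) (at x)" for x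
    using smooth_derivative(1)[OF smF p1] by simp
  have H: "closed (H i)" for i unfolding H_def using cs by (intro closed_vimage) auto
  have bH: "bounded (H i)" for i
  proof -
    have "H i \<subseteq> ball (X i) (\<rho> (X i))"
      using s(2)[of "X i"] S[of i] unfolding H_def S_def by fastforce
    then show ?thesis using bounded_ball bounded_subset by blast
  qed
  have flat: "grad c v = 0" if "c \<in> C \<inter> H i" "\<And>l. l \<le> i \<Longrightarrow> grad (X l) v = 0" "\<Phi> v = 0" for c v i
  proof -
    obtain w where w: "\<And>l. l \<le> i \<Longrightarrow> grad (X l) w = 0" "\<Phi> w \<noteq> 0" using \<Phi>(2)[of i] by blast
    have "(F has_derivative (\<lambda>_. 0)) (at c)" using dF[of c] that(1) by (simp add: C_def)
    then have d: "((\<lambda>y. tele \<phi> a y + \<Phi> y * tele \<phi> b y) has_derivative (\<lambda>_. 0)) (at c)" by (simp add: F_def[abs_def])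
    have h: "slice (X i) c \<le> 3/2 * S i" using that(1) by (simp add: H_def)
    show ?thesis by (rule critical_point_flat[OF \<Phi>(1) \<phi>_def b S h d that(2,3) w])
  qed
  \<comment> \<open>The displacement is controlled for \<open>F\<close>, not for \<open>f\<close>:
    the other half of \<open>\<epsilon> x\<close> is spent on \<open>F x - f x\<close> at the
    original point.\<close>
  have "\<exists>R. submersive p R UNIV \<and> (\<forall>x. R x \<notin> C \<and> \<bar>F (R x) - F x\<bar> \<le> \<epsilon> x / 2)"
  proof (rule avoid_closed_set[where H = H and O' = "\<lambda>i. W (X i)", OF C H])
    show "W (X j) \<subseteq> H j" for j using S[of j] by (auto simp: W_def H_def S_def)
    show "\<exists>U. submersive p U (- (C \<inter> H i \<inter> (\<Union>l<i. H l))) \<and> (\<forall>x. x \<notin> C \<inter> H i \<inter> (\<Union>l<i. H l) \<longrightarrow> U x \<notin> C \<inter> H i \<and>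
        (U x = x \<or> (\<exists>c\<in>C \<inter> H i - (\<Union>l<i. H l). x \<in> ball c (r c) \<and> U x \<in> ball c (r c))))"
      if "\<And>c. c \<in> C \<inter> H i - (\<Union>l<i. H l) \<Longrightarrow> 0 < r c \<and> ball c (r c) \<inter> (\<Union>l<i. H l) = {}" for i r
      by (rule avoid_flat_slice[OF \<Phi>(1) C H bH flat that])
    show "continuous_on UNIV F" using smooth_continuous_on[OF smF] .
  qed (fact W(1) X f)+
  then obtain R where R: "submersive p R UNIV" "\<And>x. R x \<notin> C" "\<And>x. \<bar>F (R x) - F x\<bar> \<le> \<epsilon> x / 2" by blast
  have "smooth p (\<lambda>x. F (R x)) UNIV" using R(1) smF unfolding submersive_def by fastforce
  moreover have "\<bar>f x - F (R x)\<bar> \<le> \<epsilon> x" for x using Ff[of x] R(3)[of x] by linarith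
  moreover have "\<not> critical_point (\<lambda>x. F (R x)) x" for x
  proof
    assume "critical_point (\<lambda>x. F (R x)) x"
    then have z: "frechet_derivative (\<lambda>x. F (R x)) (at x) = (\<lambda>_. 0)" by (simp add: critical_point_def)
    \<comment> \<open>Since \<open>R'\<close> is onto, a vanishing derivative of the composition
      forces the derivative of \<open>F\<close> at \<open>R x\<close> to vanish, that is,
      \<open>R x \<in> C\<close>.\<close>
    obtain R' where R': "(R has_derivative R') (at x)" "surj R'" using R(1) unfolding submersive_def by blast
    from has_derivative_compose[OF R'(1) dF]
    have "((\<lambda>x. F (R x)) has_derivative (\<lambda>h. frechet_derivative F (at (R x)) (R' h))) (at x)" .
    from frechet_derivative_at[OF this] have 0: "frechet_derivative F (at (R x)) (R' h) = 0" for h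
      using z by metis
    have "frechet_derivative F (at (R x)) k = 0" for k using 0 surjD[OF R'(2), of k] by metis
    then have "R x \<in> C" by (auto simp: C_def)
    then show False using R(2) by blast
  qed
  ultimately show ?thesis by blast
qed

end

theorem theorem1p1:
  fixes p :: enat and N :: "'a::banach \<Rightarrow> real"
    and f \<epsilon> :: "'a \<Rightarrow> real"
  assumes "1 \<le> p"
    and "\<not> (\<exists>B::'a set. finite B \<and> span B = UNIV)"
    and "separable_space (euclidean :: 'a topology)"
    and "equivalent_norm N" and "LUR N" and "C_smooth_on p N (UNIV - {0})"
    and "continuous_on UNIV f"
    and "continuous_on UNIV \<epsilon>" and "\<forall>x. 0 < \<epsilon> x"
  shows "\<exists>g :: 'a \<Rightarrow> real. C_smooth_on p g UNIV \<and>
           (\<forall>x. \<bar>f x - g x\<bar> \<le> \<epsilon> x) \<and>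
           (\<forall>x. \<not> critical_point g x)"
proof -
  interpret smooth_LUR p N by (rule smooth_LUR.intro) (fact assms(1-6))+
  show ?thesis
  proof (rule exists_LUR_convex)
    fix \<theta> :: "'a \<Rightarrow> real" and L
    assume \<theta>: "smooth p \<theta> UNIV" "L > 0" "\<And>x y. \<bar>\<theta> x - \<theta> y\<bar> \<le> L * norm (x - y)"
    "\<And>x y t. 0 \<le> t \<Longrightarrow> t \<le> 1 \<Longrightarrow> \<theta> (x + t *\<^sub>R (y - x)) \<le> (1 - t) * \<theta> x + t * \<theta> y"
    "\<And>(y :: nat \<Rightarrow> 'a) x. (\<lambda>j. \<theta> (y j) / 2 + \<theta> x / 2 - \<theta> (x + (1/2) *\<^sub>R (y j - x))) \<longlonglongrightarrow> 0 \<Longrightarrow> y \<longlonglongrightarrow> x"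
    interpret lur_convex p N \<theta> L
      by (rule lur_convex.intro[OF smooth_LUR_axioms], rule lur_convex_axioms.intro) (fact \<theta>)+
    obtain g where "smooth p g UNIV" "\<forall>x. \<bar>f x - g x\<bar> \<le> \<epsilon> x" "\<forall>x. \<not> critical_point g x"
      using approximation_without_critical_points[OF assms(7,8)] assms(9) by blast
    then show ?thesis using smooth_imp_C_smooth_on by blast
  qed
qed

end
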